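(* Let $(\widetilde M^{4n},Q,\widetilde g)$ be a para-quaternionic Kähler manifold with $\nu\neq 0$, let $\epsilon\in\{-1,1\}$, and let $(M^{2m},\mathcal J^{\epsilon},g)$, $m>1$, be an almost $\epsilon$-Hermitian submanifold of $\widetilde M$. Then: (1) The almost $\epsilon$-complex structure $\mathcal J^\epsilon$ is integrable if and only if the local 1-form $\psi=\omega_3\circ\mathcal J^\epsilon-\omega_2$ on $M^{2m}$ associated with an adapted basis $(J_1,J_2,J_3)$ vanishes. (2) $\mathcal J^\epsilon$ is integrable if one of the following conditions holds: (a) $\dim(\mathcal D_x)>2$ for all $x$ in an open dense set $U\subset M$; (b) $(M,J^\epsilon)$ is analytic and $\dim(\mathcal D_x)>2$ at some point $x\in M$.
   Context: Para-quaternionic Kähler manifolds. An almost para-quaternionic structure on $\widetilde M$ is a rank 3 subbundle $Q\subset \mathrm{End}\,T\widetilde M$ locally generated by three anticommuting fields of endomorphisms $J_1,J_2,J_3=J_1J_2$ with $J_\alpha^2=\epsilon_\alpha Id$, where $(\epsilon_1,\epsilon_2,\epsilon_3)$ is a permutation of $(-1,1,1)$. A para-quaternionic Kähler manifold $(\widetilde M^{4n},Q,\widetilde g)$ is a pseudo-Riemannian manifold (of dimension $4n$, neutral signature) with such a $Q$ consisting of $\widetilde g$-skew-symmetric endomorphisms and preserved by the Levi-Civita connection $\widetilde\nabla$; if $n=1$ one requires in addition that the curvature tensor decomposes as $\widetilde R=\nu R_0+W$, with $R_0(X,Y)=\frac12\sum_\alpha\epsilon_\alpha\widetilde g(J_\alpha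 X,Y)J_\alpha+\frac14(X\wedge Y-\sum_\alpha\epsilon_\alpha J_\alpha X\wedge J_\alpha Y)$, $(X\wedge Y)Z=\widetilde g(Y,Z)X-\widetilde g(X,Z)Y$, and $W$ a trace-free $Q$-invariant algebraic curvature tensor ($Q$ acting by derivations). $\nu=scal/(4n(n+2))$ is the reduced scalar curvature. Almost $\epsilon$-Hermitian submanifolds. A $\widetilde g$-non-degenerate submanifold $M^{2m}\subset\widetilde M$ is an almost $\epsilon$-Hermitian submanifold if there is a section $J^\epsilon:M\to Q|_M$ with $J^\epsilon TM=TM$ and $(J^\epsilon)^2=\epsilon Id$; put $g=\widetilde g|_M$, $\mathcal J^\epsilon=J^\epsilon|_{TM}$. $\mathcal J^\epsilon$ is integrable if its Nijenhuis tensor $N(X,Y)=[\mathcal J^\epsilon X,\mathcal J^\epsilon Y]-\mathcal J^\epsilon[\mathcal J^\epsilon X,Y]-\mathcal J^\epsilon[X,\mathcal J^\epsilon Y]+\epsilon[X,Y]$ vanishes. An adapted basis is a local frame $(J_1,J_2,J_3)$ of $Q$ near a point of $M$ with $J_1|_M=J^\epsilon$, $J_1^2=\epsilon Id$, $J_2^2=Id$, $J_3=J_1J_2=-J_2J_1$ (so $(\epsilon_1,\epsilon_2,\epsilon_3)=(\epsilon,1,-\epsilon)$). The local 1-forms $\omega_\alpha$ are defined by $\widetilde\nabla J_\alpha=-\epsilon_\beta\,\omega_\gamma\otimes J_\beta+\epsilon_\gamma\,\omega_\beta\otimes J_\gamma$ for cyclic permutations $(\alpha,\beta,\gamma)$ of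 $(1,2,3)$; in $\psi$ they are restricted to $TM$. For $x\in M$, $\overline{T_xM}$ denotes the maximal $Q_x$-invariant subspace of $T_xM$ (it equals $T_xM\cap J_2T_xM$), and $\mathcal D_x$ is any $\mathcal J^\epsilon$-invariant complement, $T_xM=\overline{T_xM}\oplus\mathcal D_x$, which is pure, i.e. contains no non-zero $Q$-invariant subspace (its dimension does not depend on the choice).
   Formalization: In (2)(b) the submanifold M is additionally assumed connected; for a disconnected M, a component with dim(D_x) > 2 says nothing about another component, where J^ε may be non-integrable. *)

theory Defs
  imports "HOL-Analysis.Analysis"
begin

section \<open>Regularity of maps between Euclidean spaces\<close>

text \<open>The set \<open>S\<close> is open in all uses.\<close>

primrec Ck_on :: "nat \<Rightarrow> 'e::real_normed_vector set \<Rightarrow> ('e \<Rightarrow> 'r::real_normed_vector) \<Rightarrow> bool" where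
  "Ck_on 0 S f \<longleftrightarrow> continuous_on S f"
| "Ck_on (Suc k) S f \<longleftrightarrow> (\<forall>x\<in>S. f differentiable (at x)) \<and>
     (\<forall>v. Ck_on k S (\<lambda>x. frechet_derivative f (at x) v))"

definition smooth_on :: "'e::real_normed_vector set \<Rightarrow> ('e \<Rightarrow> 'r::real_normed_vector) \<Rightarrow> bool" where
  "smooth_on S f \<longleftrightarrow> (\<forall>k. Ck_on k S f)"

text \<open>Near each point of \<open>S\<close> the map is the sum of a convergent power series in several variables;
  multi-indices are functions on \<open>Basis\<close>.\<close>

definition real_analytic_on :: "'e::euclidean_space set \<Rightarrow> ('e \<Rightarrow> 'r::euclidean_space) \<Rightarrow> bool" where
  "real_analytic_on S f \<longleftrightarrow>
     (\<forall>x\<in>S. \<exists>r>0. \<exists>a :: ('e \<Rightarrow> nat) \<Rightarrow> 'r. \<forall>y\<in>ball x r.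
        ((\<lambda>\<alpha>. (\<Prod>b\<in>Basis. ((y - x) \<bullet> b) ^ \<alpha> b) *\<^sub>R a \<alpha>) has_sum f y) (PiE Basis (\<lambda>_. UNIV)))"

section \<open>Manifolds\<close>

text \<open>A manifold is a topological type together with an atlas.  A chart is a pair of a domain and
  a coordinate map; the coordinate map is irrelevant outside the domain.\<close>

type_synonym ('a, 'e) chart = "'a set \<times> ('a \<Rightarrow> 'e)"

abbreviation chart_inv :: "('a, 'e) chart \<Rightarrow> 'e \<Rightarrow> 'a" where
  "chart_inv c \<equiv> inv_into (fst c) (snd c)"

definition is_chart :: "('a::topological_space, 'e::euclidean_space) chart \<Rightarrow> bool" where
  "is_chart c \<longleftrightarrow> open (fst c) \<and> open (snd c ` fst c) \<and>
     homeomorphism (fst c) (snd c ` fst c) (snd c) (chart_inv c)"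

text \<open>The parameter \<open>reg\<close> is instantiated with \<^const>\<open>smooth_on\<close> and \<^const>\<open>real_analytic_on\<close>.\<close>

definition atlas :: "('e set \<Rightarrow> ('e \<Rightarrow> 'e) \<Rightarrow> bool) \<Rightarrow>
    ('a::topological_space, 'e::euclidean_space) chart set \<Rightarrow> bool" where
  "atlas reg A \<longleftrightarrow> (\<forall>c\<in>A. is_chart c) \<and> (\<Union>c\<in>A. fst c) = UNIV \<and>
     (\<forall>c\<in>A. \<forall>d\<in>A. reg (snd c ` (fst c \<inter> fst d)) (snd d \<circ> chart_inv c))"

definition fun_smooth :: "('a, 'e::euclidean_space) chart set \<Rightarrow> 'a set \<Rightarrow>
    ('a \<Rightarrow> 'r::real_normed_vector) \<Rightarrow> bool" where
  "fun_smooth A U f \<longleftrightarrow> (\<forall>c\<in>A. smooth_on (snd c ` (fst c \<inter> U)) (f \<circ> chart_inv c))"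

subsection \<open>Tangent vectors\<close>

text \<open>A tangent vector at \<open>p\<close> is an equivalence class of pairs of a chart around \<open>p\<close> and a vector of
  the model space, where \<open>(c, v)\<close> and \<open>(d, w)\<close> are identified if the derivative at \<open>p\<close> of the
  coordinate change from \<open>c\<close> to \<open>d\<close> maps \<open>v\<close> to \<open>w\<close>.  Each class contains exactly one pair whose
  chart is \<open>ref_chart A p\<close>, so the tangent space at \<open>p\<close> is represented by the model space \<open>'e\<close>.  The
  reference chart need not vary continuously with \<open>p\<close>: regularity of a vector or tensor field always
  refers to its components in a fixed chart.\<close>

definition ref_chart :: "('a, 'e) chart set \<Rightarrow> 'a \<Rightarrow> ('a, 'e) chart" where
  "ref_chart A p = (SOME c. c \<in> A \<and> p \<in> fst c)"

text \<open>The derivative of a vector-valued function in the direction of a tangent vector at \<open>p\<close>. In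
  particular \<open>tderiv A (snd c) p v\<close> are the components in the chart \<open>c\<close> of the tangent vector \<open>v\<close>.\<close>

definition tderiv :: "('a, 'e::euclidean_space) chart set \<Rightarrow> ('a \<Rightarrow> 'r::real_normed_vector) \<Rightarrow>
    'a \<Rightarrow> 'e \<Rightarrow> 'r" where
  "tderiv A f p = frechet_derivative (f \<circ> chart_inv (ref_chart A p)) (at (snd (ref_chart A p) p))"

text \<open>The vector field on the domain of \<open>c\<close> with constant components \<open>w\<close> in \<open>c\<close>.\<close>

definition coord_field :: "('a, 'e::euclidean_space) chart set \<Rightarrow> ('a, 'e) chart \<Rightarrow> 'e \<Rightarrow> 'a \<Rightarrow> 'e" where
  "coord_field A c w p = inv (tderiv A (snd c) p) w"

text \<open>A vector field near \<open>p\<close> with value \<open>w\<close> at \<open>p\<close>.\<close>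

definition extend_vec :: "('a, 'e::euclidean_space) chart set \<Rightarrow> 'a \<Rightarrow> 'e \<Rightarrow> 'a \<Rightarrow> 'e" where
  "extend_vec A p w = coord_field A (ref_chart A p) w"

definition vfield_smooth :: "('a, 'e::euclidean_space) chart set \<Rightarrow> 'a set \<Rightarrow> ('a \<Rightarrow> 'e) \<Rightarrow> bool" where
  "vfield_smooth A U X \<longleftrightarrow> (\<forall>c\<in>A. fun_smooth A (U \<inter> fst c) (\<lambda>p. tderiv A (snd c) p (X p)))"

text \<open>Smooth sections over \<open>V\<close> of the pullback along \<open>f\<close> (from the manifold with atlas \<open>B\<close> to the one
  with atlas \<open>A\<close>) of the bundle of endomorphisms of the tangent bundle.\<close>

definition endo_smooth_along :: "('b, 'f::euclidean_space) chart set \<Rightarrow>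
    ('a, 'e::euclidean_space) chart set \<Rightarrow> ('b \<Rightarrow> 'a) \<Rightarrow> 'b set \<Rightarrow> ('b \<Rightarrow> 'e \<Rightarrow>\<^sub>L 'e) \<Rightarrow> bool" where
  "endo_smooth_along B A f V K \<longleftrightarrow> (\<forall>c\<in>A. \<forall>w. fun_smooth B (V \<inter> f -` fst c)
     (\<lambda>x. tderiv A (snd c) (f x) (K x (coord_field A c w (f x)))))"

definition endo_smooth :: "('a, 'e::euclidean_space) chart set \<Rightarrow> 'a set \<Rightarrow> ('a \<Rightarrow> 'e \<Rightarrow>\<^sub>L 'e) \<Rightarrow> bool" where
  "endo_smooth A U K \<longleftrightarrow> endo_smooth_along A A (\<lambda>p. p) U K"

definition lie_bracket :: "('a, 'e::euclidean_space) chart set \<Rightarrow>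
    ('a \<Rightarrow> 'e) \<Rightarrow> ('a \<Rightarrow> 'e) \<Rightarrow> 'a \<Rightarrow> 'e" where
  "lie_bracket A X Y p = (let k = snd (ref_chart A p) in
     tderiv A (\<lambda>q. tderiv A k q (Y q)) p (X p) - tderiv A (\<lambda>q. tderiv A k q (X q)) p (Y p))"

definition smooth_map :: "('b::topological_space, 'f::euclidean_space) chart set \<Rightarrow>
    ('a::topological_space, 'e::euclidean_space) chart set \<Rightarrow> ('b \<Rightarrow> 'a) \<Rightarrow> bool" where
  "smooth_map B A f \<longleftrightarrow> continuous_on UNIV f \<and> (\<forall>c\<in>A. fun_smooth B (f -` fst c) (snd c \<circ> f))"

definition differential :: "('b, 'f::euclidean_space) chart set \<Rightarrow>
    ('a, 'e::euclidean_space) chart set \<Rightarrow> ('b \<Rightarrow> 'a) \<Rightarrow> 'b \<Rightarrow> 'f \<Rightarrow> 'e" where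
  "differential B A f x = tderiv B (snd (ref_chart A (f x)) \<circ> f) x"

section \<open>Pseudo-Riemannian manifolds\<close>

definition pseudo_riemannian :: "('a, 'e::euclidean_space) chart set \<Rightarrow> ('a \<Rightarrow> 'e \<Rightarrow> 'e \<Rightarrow> real) \<Rightarrow> bool" where
  "pseudo_riemannian A g \<longleftrightarrow>
     (\<forall>p. bilinear (g p) \<and> (\<forall>v w. g p v w = g p w v) \<and> (\<forall>v. (\<forall>w. g p v w = 0) \<longrightarrow> v = 0)) \<and>
     (\<forall>c\<in>A. \<forall>v w. fun_smooth A (fst c) (\<lambda>p. g p (coord_field A c v p) (coord_field A c w p)))"

definition neutral :: "('a \<Rightarrow> 'e::euclidean_space \<Rightarrow> 'e \<Rightarrow> real) \<Rightarrow> bool" where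
  "neutral g \<longleftrightarrow> (\<forall>p. \<exists>S T. subspace S \<and> subspace T \<and> dim S = dim T \<and> dim S + dim T = DIM('e) \<and>
     (\<forall>v\<in>S. v \<noteq> 0 \<longrightarrow> g p v v > 0) \<and> (\<forall>v\<in>T. v \<noteq> 0 \<longrightarrow> g p v v < 0))"

text \<open>\<open>nabla p v Y\<close> is the covariant derivative at \<open>p\<close>, in the direction of the tangent vector \<open>v\<close> at \<open>p\<close>,
  of a vector field \<open>Y\<close> that is smooth near \<open>p\<close>.  The Leibniz rule for functions that are smooth only
  near \<open>p\<close> forces the value to depend only on the germ of \<open>Y\<close> at \<open>p\<close>.\<close>

type_synonym ('a, 'e) connection = "'a \<Rightarrow> 'e \<Rightarrow> ('a \<Rightarrow> 'e) \<Rightarrow> 'e"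

definition affine_connection :: "('a::topological_space, 'e::euclidean_space) chart set \<Rightarrow>
    ('a, 'e) connection \<Rightarrow> bool" where
  "affine_connection A nabla \<longleftrightarrow> (\<forall>U. open U \<longrightarrow>
     (\<forall>Y. vfield_smooth A U Y \<longrightarrow>
        (\<forall>p\<in>U. linear (\<lambda>v. nabla p v Y)) \<and>
        (\<forall>Z. vfield_smooth A U Z \<longrightarrow>
           (\<forall>p\<in>U. \<forall>v. nabla p v (\<lambda>q. Y q + Z q) = nabla p v Y + nabla p v Z)) \<and>
        (\<forall>f :: 'a \<Rightarrow> real. fun_smooth A U f \<longrightarrow>
           (\<forall>p\<in>U. \<forall>v. nabla p v (\<lambda>q. f q *\<^sub>R Y q) = tderiv A f p v *\<^sub>R Y p + f p *\<^sub>R nabla p v Y)) \<and>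
        (\<forall>X. vfield_smooth A U X \<longrightarrow> vfield_smooth A U (\<lambda>p. nabla p (X p) Y))))"

definition levi_civita :: "('a::topological_space, 'e::euclidean_space) chart set \<Rightarrow>
    ('a \<Rightarrow> 'e \<Rightarrow> 'e \<Rightarrow> real) \<Rightarrow> ('a, 'e) connection \<Rightarrow> bool" where
  "levi_civita A g nabla \<longleftrightarrow> affine_connection A nabla \<and> (\<forall>U. open U \<longrightarrow>
     (\<forall>X Y. vfield_smooth A U X \<longrightarrow> vfield_smooth A U Y \<longrightarrow> (\<forall>p\<in>U.
        nabla p (X p) Y - nabla p (Y p) X = lie_bracket A X Y p \<and>
        (\<forall>v. tderiv A (\<lambda>q. g q (X q) (Y q)) p v = g p (nabla p v X) (Y p) + g p (X p) (nabla p v Y)))))"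

text \<open>The covariant derivative of a field of endomorphisms, \<open>(\<nabla>\<^sub>v K) w = \<nabla>\<^sub>v (K W) - K (\<nabla>\<^sub>v W)\<close> for any
  extension \<open>W\<close> of \<open>w\<close>.\<close>

definition cov_endo :: "('a, 'e::euclidean_space) chart set \<Rightarrow> ('a, 'e) connection \<Rightarrow>
    ('a \<Rightarrow> 'e \<Rightarrow>\<^sub>L 'e) \<Rightarrow> 'a \<Rightarrow> 'e \<Rightarrow> 'e \<Rightarrow>\<^sub>L 'e" where
  "cov_endo A nabla K p v = Blinfun (\<lambda>w. let W = extend_vec A p w in
     nabla p v (\<lambda>q. K q (W q)) - K p (nabla p v W))"

definition curvature :: "('a, 'e::euclidean_space) chart set \<Rightarrow> ('a, 'e) connection \<Rightarrow>
    'a \<Rightarrow> 'e \<Rightarrow> 'e \<Rightarrow> 'e \<Rightarrow> 'e" where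
  "curvature A nabla p x y z =
     (let X = extend_vec A p x; Y = extend_vec A p y; Z = extend_vec A p z in
       nabla p (X p) (\<lambda>q. nabla q (Y q) Z) - nabla p (Y p) (\<lambda>q. nabla q (X q) Z)
       - nabla p (lie_bracket A X Y p) Z)"

text \<open>The trace of \<open>x \<mapsto> R(x,y)z\<close>, for \<open>R\<close> of the type of a curvature tensor at a point.\<close>

definition ricci :: "('e::euclidean_space \<Rightarrow> 'e \<Rightarrow> 'e \<Rightarrow> 'e) \<Rightarrow> 'e \<Rightarrow> 'e \<Rightarrow> real" where
  "ricci R y z = (\<Sum>b\<in>Basis. R b y z \<bullet> b)"

text \<open>The trace of a bilinear form \<open>r\<close> with respect to a scalar product \<open>h\<close>, i.e. the contraction
  of \<open>r\<close> with the inverse of \<open>h\<close>: the vectors \<open>u\<close> below form the \<open>h\<close>-dual of \<open>Basis\<close>.\<close>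

definition metric_trace :: "('e::euclidean_space \<Rightarrow> 'e \<Rightarrow> real) \<Rightarrow> ('e \<Rightarrow> 'e \<Rightarrow> real) \<Rightarrow> real" where
  "metric_trace h r = (\<Sum>b\<in>Basis. r b (THE u. \<forall>w. h u w = b \<bullet> w))"

definition scalar_curvature :: "('a, 'e::euclidean_space) chart set \<Rightarrow> ('a \<Rightarrow> 'e \<Rightarrow> 'e \<Rightarrow> real) \<Rightarrow>
    ('a, 'e) connection \<Rightarrow> 'a \<Rightarrow> real" where
  "scalar_curvature A g nabla p = metric_trace (g p) (ricci (curvature A nabla p))"

definition reduced_scalar_curvature :: "nat \<Rightarrow> ('a, 'e::euclidean_space) chart set \<Rightarrow>
    ('a \<Rightarrow> 'e \<Rightarrow> 'e \<Rightarrow> real) \<Rightarrow> ('a, 'e) connection \<Rightarrow> 'a \<Rightarrow> real" where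
  "reduced_scalar_curvature n A g nabla p =
     scalar_curvature A g nabla p / (4 * real n * (real n + 2))"

section \<open>Para-quaternionic Kaehler manifolds\<close>

text \<open>Triples and frames are indexed by \<open>1, 2, 3\<close>.\<close>

definition pq_triple :: "(nat \<Rightarrow> real) \<Rightarrow> (nat \<Rightarrow> 'e::euclidean_space \<Rightarrow>\<^sub>L 'e) \<Rightarrow> bool" where
  "pq_triple eps J \<longleftrightarrow>
     (eps 1, eps 2, eps 3) \<in> {(-1, 1, 1), (1, -1, 1), (1, 1, -1)} \<and>
     (\<forall>i\<in>{1, 2, 3}. J i o\<^sub>L J i = eps i *\<^sub>R id_blinfun) \<and>
     (\<forall>i\<in>{1, 2, 3}. \<forall>j\<in>{1, 2, 3}. i \<noteq> j \<longrightarrow> J i o\<^sub>L J j = - (J j o\<^sub>L J i)) \<and>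
     J 3 = J 1 o\<^sub>L J 2"

definition local_frame :: "('a::topological_space, 'e::euclidean_space) chart set \<Rightarrow>
    ('a \<Rightarrow> ('e \<Rightarrow>\<^sub>L 'e) set) \<Rightarrow> 'a set \<Rightarrow> (nat \<Rightarrow> real) \<Rightarrow> (nat \<Rightarrow> 'a \<Rightarrow> 'e \<Rightarrow>\<^sub>L 'e) \<Rightarrow> bool" where
  "local_frame A Q U eps J \<longleftrightarrow> open U \<and> (\<forall>i\<in>{1, 2, 3}. endo_smooth A U (J i)) \<and>
     (\<forall>p\<in>U. pq_triple eps (\<lambda>i. J i p) \<and> Q p = span {J 1 p, J 2 p, J 3 p})"

definition almost_para_quaternionic :: "('a::topological_space, 'e::euclidean_space) chart set \<Rightarrow>
    ('a \<Rightarrow> ('e \<Rightarrow>\<^sub>L 'e) set) \<Rightarrow> bool" where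
  "almost_para_quaternionic A Q \<longleftrightarrow> (\<forall>p. \<exists>U eps J. p \<in> U \<and> local_frame A Q U eps J)"

definition skew_symmetric_structure :: "('a \<Rightarrow> 'e \<Rightarrow> 'e \<Rightarrow> real) \<Rightarrow>
    ('a \<Rightarrow> ('e::euclidean_space \<Rightarrow>\<^sub>L 'e) set) \<Rightarrow> bool" where
  "skew_symmetric_structure g Q \<longleftrightarrow> (\<forall>p. \<forall>K\<in>Q p. \<forall>v w. g p (K v) w = - g p v (K w))"

definition parallel_structure :: "('a::topological_space, 'e::euclidean_space) chart set \<Rightarrow>
    ('a, 'e) connection \<Rightarrow> ('a \<Rightarrow> ('e \<Rightarrow>\<^sub>L 'e) set) \<Rightarrow> bool" where
  "parallel_structure A nabla Q \<longleftrightarrow> (\<forall>U K. open U \<longrightarrow> endo_smooth A U K \<longrightarrow> (\<forall>p\<in>U. K p \<in> Q p) \<longrightarrow>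
     (\<forall>p\<in>U. \<forall>v. cov_endo A nabla K p v \<in> Q p))"

definition wedge :: "('e::real_vector \<Rightarrow> 'e \<Rightarrow> real) \<Rightarrow> 'e \<Rightarrow> 'e \<Rightarrow> 'e \<Rightarrow> 'e" where
  "wedge h x y z = h y z *\<^sub>R x - h x z *\<^sub>R y"

definition R0 :: "('e::euclidean_space \<Rightarrow> 'e \<Rightarrow> real) \<Rightarrow> (nat \<Rightarrow> real) \<Rightarrow> (nat \<Rightarrow> 'e \<Rightarrow>\<^sub>L 'e) \<Rightarrow>
    'e \<Rightarrow> 'e \<Rightarrow> 'e \<Rightarrow> 'e" where
  "R0 h eps J x y z =
     (1/2) *\<^sub>R (\<Sum>i\<in>{1, 2, 3}. (eps i * h (J i x) y) *\<^sub>R J i z) +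
     (1/4) *\<^sub>R (wedge h x y z - (\<Sum>i\<in>{1, 2, 3}. eps i *\<^sub>R wedge h (J i x) (J i y) z))"

definition algebraic_curvature_tensor :: "('e::euclidean_space \<Rightarrow> 'e \<Rightarrow> real) \<Rightarrow>
    ('e \<Rightarrow> 'e \<Rightarrow> 'e \<Rightarrow> 'e) \<Rightarrow> bool" where
  "algebraic_curvature_tensor h W \<longleftrightarrow>
     (\<forall>x y. linear (\<lambda>u. W u x y) \<and> linear (\<lambda>u. W x u y) \<and> linear (\<lambda>u. W x y u)) \<and>
     (\<forall>x y z. W x y z = - W y x z) \<and>
     (\<forall>x y z u. h (W x y z) u = - h z (W x y u)) \<and>
     (\<forall>x y z. W x y z + W y z x + W z x y = 0)"

text \<open>Invariance under endomorphisms acting as derivations of the tensor algebra.\<close>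

definition Q_invariant_tensor :: "('e::euclidean_space \<Rightarrow>\<^sub>L 'e) set \<Rightarrow> ('e \<Rightarrow> 'e \<Rightarrow> 'e \<Rightarrow> 'e) \<Rightarrow> bool" where
  "Q_invariant_tensor q W \<longleftrightarrow>
     (\<forall>K\<in>q. \<forall>x y z. K (W x y z) - W (K x) y z - W x (K y) z - W x y (K z) = 0)"

text \<open>The additional requirement in dimension \<open>4\<close>.  The tensor \<^const>\<open>R0\<close> does not depend on the
  choice of the triple, and by the symmetries of an algebraic curvature tensor all its traces
  vanish if its Ricci tensor does.\<close>

definition curvature_decomposes :: "nat \<Rightarrow> ('a::topological_space, 'e::euclidean_space) chart set \<Rightarrow>
    ('a \<Rightarrow> 'e \<Rightarrow> 'e \<Rightarrow> real) \<Rightarrow> ('a, 'e) connection \<Rightarrow> ('a \<Rightarrow> ('e \<Rightarrow>\<^sub>L 'e) set) \<Rightarrow> bool" where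
  "curvature_decomposes n A g nabla Q \<longleftrightarrow> (\<forall>p. \<exists>eps J W.
     pq_triple eps J \<and> Q p = span {J 1, J 2, J 3} \<and>
     algebraic_curvature_tensor (g p) W \<and> (\<forall>y z. ricci W y z = 0) \<and> Q_invariant_tensor (Q p) W \<and>
     (\<forall>x y z. curvature A nabla p x y z =
        reduced_scalar_curvature n A g nabla p *\<^sub>R R0 (g p) eps J x y z + W x y z))"

definition para_quaternionic_kaehler :: "nat \<Rightarrow> ('a::topological_space, 'e::euclidean_space) chart set \<Rightarrow>
    ('a \<Rightarrow> 'e \<Rightarrow> 'e \<Rightarrow> real) \<Rightarrow> ('a, 'e) connection \<Rightarrow> ('a \<Rightarrow> ('e \<Rightarrow>\<^sub>L 'e) set) \<Rightarrow> bool" where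
  "para_quaternionic_kaehler n A g nabla Q \<longleftrightarrow>
     DIM('e) = 4 * n \<and> atlas smooth_on A \<and> pseudo_riemannian A g \<and> neutral g \<and>
     almost_para_quaternionic A Q \<and> skew_symmetric_structure g Q \<and>
     levi_civita A g nabla \<and> parallel_structure A nabla Q \<and>
     (n = 1 \<longrightarrow> curvature_decomposes n A g nabla Q)"

section \<open>Almost epsilon-Hermitian submanifolds\<close>

text \<open>A submanifold is a manifold with an injective immersion \<open>f\<close> (in particular, embedded
  submanifolds are covered).  Its tangent space at \<open>x\<close>, as a subspace of the tangent space
  of the ambient manifold at \<open>f x\<close>, is \<open>range (differential B A f x)\<close>.\<close>

definition submanifold :: "('b::topological_space, 'f::euclidean_space) chart set \<Rightarrow>
    ('a::topological_space, 'e::euclidean_space) chart set \<Rightarrow> ('b \<Rightarrow> 'a) \<Rightarrow> bool" where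
  "submanifold B A f \<longleftrightarrow> atlas smooth_on B \<and> smooth_map B A f \<and> inj f \<and>
     (\<forall>x. inj (differential B A f x))"

definition almost_eps_hermitian_submanifold ::
    "('a::topological_space, 'e::euclidean_space) chart set \<Rightarrow> ('a \<Rightarrow> 'e \<Rightarrow> 'e \<Rightarrow> real) \<Rightarrow>
     ('a \<Rightarrow> ('e \<Rightarrow>\<^sub>L 'e) set) \<Rightarrow> real \<Rightarrow>
     ('b::topological_space, 'f::euclidean_space) chart set \<Rightarrow> ('b \<Rightarrow> 'a) \<Rightarrow> ('b \<Rightarrow> 'e \<Rightarrow>\<^sub>L 'e) \<Rightarrow> bool" where
  "almost_eps_hermitian_submanifold A g Q \<epsilon> B f Je \<longleftrightarrow>
     submanifold B A f \<and>
     (\<forall>x. \<forall>v. (\<forall>w. g (f x) (differential B A f x v) (differential B A f x w) = 0) \<longrightarrow> v = 0) \<and>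
     endo_smooth_along B A f UNIV Je \<and>
     (\<forall>x. Je x \<in> Q (f x) \<and> Je x o\<^sub>L Je x = \<epsilon> *\<^sub>R id_blinfun \<and>
        Je x ` range (differential B A f x) = range (differential B A f x))"

text \<open>The restriction of \<open>Je\<close> to the tangent bundle of the submanifold.\<close>

definition induced_structure :: "('a, 'e::euclidean_space) chart set \<Rightarrow>
    ('b, 'f::euclidean_space) chart set \<Rightarrow> ('b \<Rightarrow> 'a) \<Rightarrow> ('b \<Rightarrow> 'e \<Rightarrow>\<^sub>L 'e) \<Rightarrow> 'b \<Rightarrow> 'f \<Rightarrow> 'f" where
  "induced_structure A B f Je x v = inv (differential B A f x) (Je x (differential B A f x v))"

definition nijenhuis :: "('b, 'f::euclidean_space) chart set \<Rightarrow> real \<Rightarrow> ('b \<Rightarrow> 'f \<Rightarrow> 'f) \<Rightarrow>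
    ('b \<Rightarrow> 'f) \<Rightarrow> ('b \<Rightarrow> 'f) \<Rightarrow> 'b \<Rightarrow> 'f" where
  "nijenhuis B \<epsilon> j X Y x =
     lie_bracket B (\<lambda>y. j y (X y)) (\<lambda>y. j y (Y y)) x
     - j x (lie_bracket B (\<lambda>y. j y (X y)) Y x)
     - j x (lie_bracket B X (\<lambda>y. j y (Y y)) x)
     + \<epsilon> *\<^sub>R lie_bracket B X Y x"

definition integrable_structure :: "('b::topological_space, 'f::euclidean_space) chart set \<Rightarrow> real \<Rightarrow>
    ('b \<Rightarrow> 'f \<Rightarrow> 'f) \<Rightarrow> bool" where
  "integrable_structure B \<epsilon> j \<longleftrightarrow> (\<forall>U X Y. open U \<longrightarrow> vfield_smooth B U X \<longrightarrow> vfield_smooth B U Y \<longrightarrow>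
     (\<forall>x\<in>U. nijenhuis B \<epsilon> j X Y x = 0))"

definition adapted_signs :: "real \<Rightarrow> nat \<Rightarrow> real" where
  "adapted_signs \<epsilon> i = (if i = 1 then \<epsilon> else if i = 2 then 1 else - \<epsilon>)"

text \<open>The frame lives on an open set \<open>U\<close> of the ambient manifold and extends \<open>Je\<close> from an open set \<open>V\<close> of
  the submanifold.\<close>

definition adapted_basis :: "('a::topological_space, 'e::euclidean_space) chart set \<Rightarrow>
    ('a \<Rightarrow> ('e \<Rightarrow>\<^sub>L 'e) set) \<Rightarrow> real \<Rightarrow> ('b::topological_space \<Rightarrow> 'a) \<Rightarrow> ('b \<Rightarrow> 'e \<Rightarrow>\<^sub>L 'e) \<Rightarrow>
    'b set \<Rightarrow> 'a set \<Rightarrow> (nat \<Rightarrow> 'a \<Rightarrow> 'e \<Rightarrow>\<^sub>L 'e) \<Rightarrow> bool" where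
  "adapted_basis A Q \<epsilon> f Je V U J \<longleftrightarrow> open V \<and> f ` V \<subseteq> U \<and>
     local_frame A Q U (adapted_signs \<epsilon>) J \<and> (\<forall>x\<in>V. J 1 (f x) = Je x)"

definition connection_forms :: "('a, 'e::euclidean_space) chart set \<Rightarrow> ('a, 'e) connection \<Rightarrow>
    'a set \<Rightarrow> (nat \<Rightarrow> real) \<Rightarrow> (nat \<Rightarrow> 'a \<Rightarrow> 'e \<Rightarrow>\<^sub>L 'e) \<Rightarrow> (nat \<Rightarrow> 'a \<Rightarrow> 'e \<Rightarrow> real) \<Rightarrow> bool" where
  "connection_forms A nabla U eps J \<omega> \<longleftrightarrow> (\<forall>p\<in>U. \<forall>v.
     \<forall>(\<alpha>, \<beta>, \<gamma>) \<in> {(1, 2, 3), (2, 3, 1), (3, 1, 2)}.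
       cov_endo A nabla (J \<alpha>) p v =
         - (eps \<beta> * \<omega> \<gamma> p v) *\<^sub>R J \<beta> p + (eps \<gamma> * \<omega> \<beta> p v) *\<^sub>R J \<gamma> p)"

definition psi :: "('a, 'e::euclidean_space) chart set \<Rightarrow> ('b, 'f::euclidean_space) chart set \<Rightarrow>
    ('b \<Rightarrow> 'a) \<Rightarrow> ('b \<Rightarrow> 'e \<Rightarrow>\<^sub>L 'e) \<Rightarrow> (nat \<Rightarrow> 'a \<Rightarrow> 'e \<Rightarrow> real) \<Rightarrow> 'b \<Rightarrow> 'f \<Rightarrow> real" where
  "psi A B f Je \<omega> x v =
     \<omega> 3 (f x) (differential B A f x (induced_structure A B f Je x v))
     - \<omega> 2 (f x) (differential B A f x v)"

text \<open>\<open>j\<close> is real analytic with respect to some analytic structure compatible with the smooth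
  structure: its components in the charts of an analytic atlas \<open>C\<close> are real analytic.\<close>

definition analytic_structure :: "('b::topological_space, 'f::euclidean_space) chart set \<Rightarrow>
    ('b \<Rightarrow> 'f \<Rightarrow> 'f) \<Rightarrow> bool" where
  "analytic_structure B j \<longleftrightarrow> (\<exists>C. atlas real_analytic_on C \<and> atlas smooth_on (B \<union> C) \<and>
     (\<forall>c\<in>C. \<forall>w. real_analytic_on (snd c ` fst c)
        ((\<lambda>x. tderiv B (snd c) x (j x (coord_field B c w x))) \<circ> chart_inv c)))"

subsection \<open>Pure complements\<close>

definition Q_invariant :: "('e::euclidean_space \<Rightarrow>\<^sub>L 'e) set \<Rightarrow> 'e set \<Rightarrow> bool" where
  "Q_invariant q S \<longleftrightarrow> (\<forall>K\<in>q. K ` S \<subseteq> S)"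

definition max_Q_invariant :: "('e::euclidean_space \<Rightarrow>\<^sub>L 'e) set \<Rightarrow> 'e set \<Rightarrow> 'e set" where
  "max_Q_invariant q T = (GREATEST S. subspace S \<and> S \<subseteq> T \<and> Q_invariant q S)"

definition pure_complement :: "('e::euclidean_space \<Rightarrow>\<^sub>L 'e) set \<Rightarrow> ('e \<Rightarrow>\<^sub>L 'e) \<Rightarrow>
    'e set \<Rightarrow> 'e set \<Rightarrow> bool" where
  "pure_complement q K T D \<longleftrightarrow> subspace D \<and> K ` D \<subseteq> D \<and>
     max_Q_invariant q T \<inter> D = {0} \<and> {u + v | u v. u \<in> max_Q_invariant q T \<and> v \<in> D} = T \<and>
     (\<forall>S. subspace S \<and> S \<subseteq> D \<and> Q_invariant q S \<longrightarrow> S = {0})"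

end

theory Submission
  imports Defs "HOL-Complex_Analysis.Complex_Analysis"
begin

text \<open>
  Let \<open>J = J\<^sub>1\<close> be the structure of the submanifold, \<open>T\<close> its tangent space at a point, and \<open>\<psi>\<close> the covector
  \<open>\<omega>\<^sub>3 \<circ> J - \<omega>\<^sub>2\<close> of an adapted basis.  Extend two vector fields of the submanifold to ambient fields that are
  related to them by the immersion.  As the Levi-Civita connection has no torsion, the Nijenhuis
  expression only involves \<open>\<nabla> J\<^sub>1 = - \<omega>\<^sub>3 J\<^sub>2 - \<epsilon> \<omega>\<^sub>2 J\<^sub>3\<close>, and for \<open>X\<close>, \<open>Y\<close> in \<open>T\<close> it becomes (\<open>nijenhuis_formula\<close>)
  \<open>N X Y = J\<^sub>2 (\<psi> Y X + \<epsilon> \<psi> (J Y) J X - \<psi> X Y - \<epsilon> \<psi> (J X) J Y)\<close>.  The vector in brackets is called the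
  obstruction below; both parts of the theorem are consequences of this formula.

  If \<open>\<psi> = 0\<close> then \<open>N = 0\<close>.  For the other implications suppose that the obstruction lies in a \<open>J\<close>-invariant
  subspace \<open>S\<close> of \<open>T\<close> for all \<open>X\<close> and \<open>Y\<close>.  If \<open>\<psi> X \<noteq> 0\<close> for some \<open>X\<close>, every \<open>Y\<close> can be expressed modulo \<open>S\<close> by \<open>X\<close> and
  \<open>J X\<close>, so \<open>S\<close> has codimension at most 2 (\<open>covector_vanishes\<close>; in the para-complex case one has to argue
  in the eigenspaces of \<open>J\<close>).  If \<open>N = 0\<close> this applies to \<open>S = 0\<close>, and \<open>\<psi> = 0\<close> follows because \<open>dim T > 2\<close>.  In
  general \<open>N\<close> takes values in \<open>T\<close>, so that it applies to \<open>S = T \<inter> J\<^sub>2 T\<close>, the maximal \<open>Q\<close>-invariant subspace,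
  whose codimension is the dimension of a pure complement: where that dimension exceeds 2, \<open>\<psi>\<close> and hence
  \<open>N\<close> vanish.  If this happens on a dense set, \<open>N\<close> vanishes by continuity.  If it happens at one point, it
  happens in a neighbourhood (\<open>transversal_open\<close>).  The components of \<open>N\<close> are polynomials in those of \<open>J\<close> and
  their first derivatives, so in the analytic case the zero set propagates over the connected
  submanifold (\<open>nij_zero_propagates\<close>).

  Adapted bases exist around every point (\<open>adapted_basis_exists\<close>) because the coefficients of \<open>J\<close> in a
  local frame of \<open>Q\<close> can be extended to the ambient manifold by a local retraction, which the inverse
  function theorem provides; the same retraction yields the related extensions of vector fields.
\<close>

section \<open>Calculus of smooth maps\<close>

lemma has_derivative_linear: "(f has_derivative f') F \<Longrightarrow> linear f'"
  using has_derivative_bounded_linear bounded_linear.linear by blast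

text \<open>The congruence property is a hypothesis because it is itself proved by induction with this rule.\<close>

lemma Ck_on_SucI:
  fixes f :: "'a::real_normed_vector \<Rightarrow> 'b::real_normed_vector"
  assumes "open S" "\<And>x. x \<in> S \<Longrightarrow> (f has_derivative f' x) (at x)"
    and "\<And>v. Ck_on k S (\<lambda>x. f' x v)"
    and cong: "\<And>g h :: 'a \<Rightarrow> 'b. (\<And>x. x \<in> S \<Longrightarrow> g x = h x) \<Longrightarrow> Ck_on k S g \<Longrightarrow> Ck_on k S h"
  shows "Ck_on (Suc k) S f"
proof -
  have "f' x v = frechet_derivative f (at x) v" if "x \<in> S" for x v
    using frechet_derivative_at[OF assms(2)[OF that]] by simp
  then have "Ck_on k S (\<lambda>x. frechet_derivative f (at x) v)" for v
    using cong[of "\<lambda>x. f' x v" "\<lambda>x. frechet_derivative f (at x) v"] assms(3) by blast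
  then show ?thesis
    using assms(2) by (auto simp: differentiable_def)
qed

lemma Ck_on_cong:
  assumes "open S" "\<And>x. x \<in> S \<Longrightarrow> f x = g x" "Ck_on k S f"
  shows "Ck_on k S g"
  using assms(2,3)
proof (induction k arbitrary: f g)
  case 0
  then show ?case by (simp add: continuous_on_eq)
next
  case (Suc k)
  have "(g has_derivative frechet_derivative f (at x)) (at x)" if x: "x \<in> S" for x
  proof -
    have "(f has_derivative frechet_derivative f (at x)) (at x)"
      using Suc.prems(2) x frechet_derivative_works by auto
    then show ?thesis
      using has_derivative_transform_within_open[OF _ assms(1) x] Suc.prems(1) by blast
  qed
  moreover have "Ck_on k S (\<lambda>x. frechet_derivative f (at x) v)" for v
    using Suc.prems(2) by simp
  ultimately show ?case
    by (rule Ck_on_SucI[OF assms(1) _ _ Suc.IH])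
qed

lemma Ck_on_SucI':
  assumes "open S" "\<And>x. x \<in> S \<Longrightarrow> (f has_derivative f' x) (at x)"
    and "\<And>v. Ck_on k S (\<lambda>x. f' x v)"
  shows "Ck_on (Suc k) S f"
  by (rule Ck_on_SucI[OF assms]) (assumption, rule Ck_on_cong[OF assms(1)])

lemma Ck_on_SucD:
  assumes "Ck_on (Suc k) S f"
  shows "x \<in> S \<Longrightarrow> (f has_derivative frechet_derivative f (at x)) (at x)"
    and "Ck_on k S (\<lambda>x. frechet_derivative f (at x) v)"
  using assms frechet_derivative_works by auto

lemma Ck_on_lower: "Ck_on (Suc k) S f \<Longrightarrow> Ck_on k S f"
proof (induction k arbitrary: f)
  case 0
  then show ?case
    by (auto intro!: continuous_at_imp_continuous_on differentiable_imp_continuous_within)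
next
  case (Suc k)
  show ?case
    unfolding Ck_on.simps(2)[of k]
  proof (intro conjI allI)
    show "\<forall>x\<in>S. f differentiable (at x)"
      using Suc.prems unfolding Ck_on.simps(2) by (rule conjunct1)
    show "Ck_on k S (\<lambda>x. frechet_derivative f (at x) v)" for v
      by (rule Suc.IH[OF Ck_on_SucD(2)[OF Suc.prems]])
  qed
qed

lemma Ck_on_subset: "Ck_on k S f \<Longrightarrow> T \<subseteq> S \<Longrightarrow> Ck_on k T f"
  by (induction k arbitrary: f) (simp_all add: continuous_on_subset subset_iff)

lemma Ck_on_local:
  assumes "\<And>x. x \<in> S \<Longrightarrow> \<exists>U. open U \<and> x \<in> U \<and> Ck_on k U f"
  shows "Ck_on k S f"
  using assms
proof (induction k arbitrary: f)
  case 0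
  have "isCont f x" if "x \<in> S" for x
    using 0[OF that] by (auto simp: continuous_on_eq_continuous_at)
  then show ?case by (simp add: continuous_at_imp_continuous_on)
next
  case (Suc k)
  show ?case
    unfolding Ck_on.simps(2)
  proof (intro conjI allI ballI)
    show "f differentiable (at x)" if "x \<in> S" for x
      using Suc.prems[OF that] unfolding Ck_on.simps(2) by blast
    show "Ck_on k S (\<lambda>x. frechet_derivative f (at x) v)" for v
      by (rule Suc.IH) (use Suc.prems in \<open>unfold Ck_on.simps(2), blast\<close>)
  qed
qed

lemma Ck_on_const [simp]: "Ck_on k S (\<lambda>x. c)"
  by (induction k arbitrary: c) auto

lemma Ck_on_linear_comp:
  assumes "open S" "bounded_linear L" "Ck_on k S f"
  shows "Ck_on k S (\<lambda>x. L (f x))"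
  using assms(3)
proof (induction k arbitrary: f)
  case 0
  then show ?case
    by (simp add: bounded_linear.continuous_on[OF assms(2)])
next
  case (Suc k)
  show ?case
  proof (rule Ck_on_SucI'[OF assms(1), where f' = "\<lambda>x v. L (frechet_derivative f (at x) v)"])
    show "((\<lambda>x. L (f x)) has_derivative (\<lambda>v. L (frechet_derivative f (at x) v))) (at x)" if "x \<in> S" for x
      by (rule bounded_linear.has_derivative[OF assms(2) Ck_on_SucD(1)[OF Suc.prems that]])
  qed (rule Suc.IH[OF Ck_on_SucD(2)[OF Suc.prems]])
qed

lemma Ck_on_add:
  assumes "open S" "Ck_on k S f" "Ck_on k S g"
  shows "Ck_on k S (\<lambda>x. f x + g x)"
  using assms(2,3)
proof (induction k arbitrary: f g)
  case 0
  then show ?case by (auto intro: continuous_on_add)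
next
  case (Suc k)
  show ?case
  proof (rule Ck_on_SucI'[OF assms(1), where
      f' = "\<lambda>x v. frechet_derivative f (at x) v + frechet_derivative g (at x) v"])
    show "((\<lambda>x. f x + g x) has_derivative
        (\<lambda>v. frechet_derivative f (at x) v + frechet_derivative g (at x) v)) (at x)" if "x \<in> S" for x
      by (intro has_derivative_add Ck_on_SucD(1)[OF Suc.prems(1) that] Ck_on_SucD(1)[OF Suc.prems(2) that])
  qed (intro Suc.IH Ck_on_SucD(2)[OF Suc.prems(1)] Ck_on_SucD(2)[OF Suc.prems(2)])
qed

lemma Ck_on_bilinear:
  assumes "open S" "bounded_bilinear B" "Ck_on k S f" "Ck_on k S g"
  shows "Ck_on k S (\<lambda>x. B (f x) (g x))"
  using assms(3,4)
proof (induction k arbitrary: f g)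
  case 0
  then show ?case
    by (simp add: bounded_bilinear.continuous_on[OF assms(2)])
next
  case (Suc k)
  show ?case
  proof (rule Ck_on_SucI'[OF assms(1), where
      f' = "\<lambda>x v. B (f x) (frechet_derivative g (at x) v) + B (frechet_derivative f (at x) v) (g x)"])
    show "((\<lambda>x. B (f x) (g x)) has_derivative
        (\<lambda>v. B (f x) (frechet_derivative g (at x) v) + B (frechet_derivative f (at x) v) (g x))) (at x)"
      if "x \<in> S" for x
      using bounded_bilinear.FDERIV[OF assms(2) Ck_on_SucD(1)[OF Suc.prems(1) that] Ck_on_SucD(1)[OF Suc.prems(2) that]] .
  next
    fix v
    show "Ck_on k S (\<lambda>x. B (f x) (frechet_derivative g (at x) v) + B (frechet_derivative f (at x) v) (g x))"
      by (intro Ck_on_add assms(1) Suc.IH Ck_on_lower[OF Suc.prems(1)] Ck_on_lower[OF Suc.prems(2)]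
          Ck_on_SucD(2)[OF Suc.prems(1)] Ck_on_SucD(2)[OF Suc.prems(2)])
  qed
qed

lemma Ck_on_sum:
  assumes "open S" "\<And>i. i \<in> I \<Longrightarrow> Ck_on k S (f i)"
  shows "Ck_on k S (\<lambda>x. \<Sum>i\<in>I. f i x)"
  using assms(2)
proof (induction I rule: infinite_finite_induct)
  case (insert i I)
  then show ?case using Ck_on_add[OF assms(1), of k "f i"] by simp
qed simp_all

lemma linear_eq_sum_Basis:
  fixes L :: "'a::euclidean_space \<Rightarrow> 'b::real_vector"
  assumes "linear L"
  shows "L v = (\<Sum>b\<in>Basis. (v \<bullet> b) *\<^sub>R L b)"
proof -
  have "L v = L (\<Sum>b\<in>Basis. (v \<bullet> b) *\<^sub>R b)"
    by (simp add: euclidean_representation)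
  then show ?thesis
    using assms by (simp add: linear_sum linear_scale)
qed

lemma Ck_on_scaleR: "open S \<Longrightarrow> Ck_on k S f \<Longrightarrow> Ck_on k S g \<Longrightarrow> Ck_on k S (\<lambda>x. f x *\<^sub>R g x)"
  by (rule Ck_on_bilinear[OF _ bounded_bilinear_scaleR])

lemma Ck_on_inner: "open S \<Longrightarrow> Ck_on k S f \<Longrightarrow> Ck_on k S (\<lambda>x. f x \<bullet> c)"
  by (rule Ck_on_linear_comp[OF _ bounded_linear_inner_left])

text \<open>Expanding the argument in a basis reduces a family of linear maps to finitely many products.\<close>

lemma Ck_on_apply:
  fixes M :: "'a::real_normed_vector \<Rightarrow> 'b::euclidean_space \<Rightarrow> 'c::real_normed_vector"
  assumes "open S" "\<And>x. x \<in> S \<Longrightarrow> linear (M x)" "\<And>v. Ck_on k S (\<lambda>x. M x v)" "Ck_on k S f"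
  shows "Ck_on k S (\<lambda>x. M x (f x))"
proof -
  have "Ck_on k S (\<lambda>x. \<Sum>b\<in>Basis. (f x \<bullet> b) *\<^sub>R M x b)"
    by (rule Ck_on_sum[OF assms(1)]) (rule Ck_on_scaleR[OF assms(1) Ck_on_inner[OF assms(1,4)] assms(3)])
  then show ?thesis
    by (rule Ck_on_cong[OF assms(1), rotated]) (rule linear_eq_sum_Basis[OF assms(2), symmetric])
qed

lemma Ck_on_compose:
  fixes f :: "'a::real_normed_vector \<Rightarrow> 'b::euclidean_space"
  assumes "open S" "open T" "f ` S \<subseteq> T" "Ck_on k T g" "Ck_on k S f"
  shows "Ck_on k S (\<lambda>x. g (f x))"
  using assms(4,5)
proof (induction k arbitrary: g)
  case 0
  then show ?case
    using assms(3) continuous_on_compose2[of T g S f] by simp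
next
  case (Suc k)
  note df = Ck_on_SucD[OF Suc.prems(2)] and dg = Ck_on_SucD[OF Suc.prems(1)]
  show ?case
  proof (rule Ck_on_SucI'[OF assms(1), where
      f' = "\<lambda>x v. frechet_derivative g (at (f x)) (frechet_derivative f (at x) v)"])
    show "((\<lambda>x. g (f x)) has_derivative
        (\<lambda>v. frechet_derivative g (at (f x)) (frechet_derivative f (at x) v))) (at x)" if "x \<in> S" for x
    proof -
      have "f x \<in> T" using that assms(3) by blast
      then show ?thesis
        using has_derivative_compose[OF df(1)[OF that] dg(1)] by simp
    qed
  next
    fix v
    show "Ck_on k S (\<lambda>x. frechet_derivative g (at (f x)) (frechet_derivative f (at x) v))"
    proof (rule Ck_on_apply[OF assms(1)])
      show "linear (frechet_derivative g (at (f x)))" if "x \<in> S" for x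
        using dg(1) has_derivative_linear that assms(3) by blast
      show "Ck_on k S (\<lambda>x. frechet_derivative g (at (f x)) v)" for v
        using Suc.IH[OF dg(2) Ck_on_lower[OF Suc.prems(2)]] .
    qed (rule df(2))
  qed
qed

text \<open>The inverse of a continuous family of invertible maps is as regular as the family, because
  \<open>D (M\<inverse>) = - M\<inverse> (D M) M\<inverse>\<close> expresses its derivative by terms one order less regular.\<close>

lemma Ck_on_family_inverse:
  fixes M N :: "'a::real_normed_vector \<Rightarrow> 'b::euclidean_space \<Rightarrow> 'b"
  assumes S: "open S"
    and linM: "\<And>x. x \<in> S \<Longrightarrow> linear (M x)" and linN: "\<And>x. x \<in> S \<Longrightarrow> linear (N x)"
    and NM: "\<And>x v. x \<in> S \<Longrightarrow> N x (M x v) = v" and MN: "\<And>x v. x \<in> S \<Longrightarrow> M x (N x v) = v"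
    and N0: "\<And>v. continuous_on S (\<lambda>x. N x v)"
    and M: "\<And>v. Ck_on k S (\<lambda>x. M x v)"
  shows "Ck_on k S (\<lambda>x. N x v)"
  using M
proof (induction k arbitrary: v)
  case 0
  then show ?case using N0 by simp
next
  case (Suc k)
  let ?DM = "\<lambda>x h w. frechet_derivative (\<lambda>x. M x w) (at x) h"
  have DM: "((\<lambda>x. M x w) has_derivative (\<lambda>h. ?DM x h w)) (at x)" if "x \<in> S" for x w
    using Ck_on_SucD(1)[OF Suc.prems that] by simp
  have linDM: "linear (?DM x h)" if x: "x \<in> S" for x h
  proof (rule linearI)
    fix a b
    have "((\<lambda>y. M y a + M y b) has_derivative (\<lambda>h. ?DM x h a + ?DM x h b)) (at x)"
      by (intro has_derivative_add DM x)
    then have "((\<lambda>y. M y (a + b)) has_derivative (\<lambda>h. ?DM x h a + ?DM x h b)) (at x)"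
      using linM by (auto intro: has_derivative_transform_within_open[OF _ S x] simp: linear_add)
    then show "?DM x h (a + b) = ?DM x h a + ?DM x h b"
      using has_derivative_unique[OF DM[OF x]] by metis
  next
    fix r a
    have "((\<lambda>y. r *\<^sub>R M y a) has_derivative (\<lambda>h. r *\<^sub>R ?DM x h a)) (at x)"
      by (intro has_derivative_scaleR_right DM x)
    then have "((\<lambda>y. M y (r *\<^sub>R a)) has_derivative (\<lambda>h. r *\<^sub>R ?DM x h a)) (at x)"
      using linM by (auto intro: has_derivative_transform_within_open[OF _ S x] simp: linear_scale)
    then show "?DM x h (r *\<^sub>R a) = r *\<^sub>R ?DM x h a"
      using has_derivative_unique[OF DM[OF x]] by metis
  qed
  have IH: "Ck_on k S (\<lambda>x. N x w)" for w
    using Suc.IH[OF Ck_on_lower[OF Suc.prems]] .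
  show ?case
  proof (rule Ck_on_SucI'[OF S, where f' = "\<lambda>x h. - N x (?DM x h (N x v))"])
    fix x assume x: "x \<in> S"
    \<comment> \<open>\<open>N y v - N x v = - N y (M y u - M x u)\<close> for \<open>u = N x v\<close>: a differentiable factor vanishing at
      \<open>x\<close> times a merely continuous one is differentiable at \<open>x\<close>.\<close>
    define u where "u = N x v"
    let ?R = "\<lambda>y. M y u - M x u"
    have R: "((\<lambda>y. M y u - M x u) has_derivative (\<lambda>h. ?DM x h u)) (at x)"
      using has_derivative_diff[OF DM[OF x, of u] has_derivative_const[of "M x u"]] by simp
    have "((\<lambda>y. \<Sum>b\<in>Basis. (?R y \<bullet> b) *\<^sub>R N y b) has_derivative
        (\<lambda>h. \<Sum>b\<in>Basis. (?DM x h u \<bullet> b) *\<^sub>R N x b)) (at x)"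
    proof (rule has_derivative_sum)
      fix b :: 'b assume "b \<in> Basis"
      have r: "((\<lambda>y. ?R y \<bullet> b) has_derivative (\<lambda>h. ?DM x h u \<bullet> b)) (at x)"
        using R by (intro has_derivative_inner_left)
      let ?r = "\<lambda>y. ?R y \<bullet> b" and ?d = "\<lambda>h. ?DM x h u \<bullet> b"
      have cN: "isCont (\<lambda>y. N y b) x"
        using N0 S x by (simp add: continuous_on_eq_continuous_at)
      have bl: "bounded_linear ?d" using r has_derivative_bounded_linear by blast
      obtain K where K: "\<And>h. norm (?d h) \<le> norm h * K" "K > 0"
        using bounded_linear.pos_bounded[OF bl] by blast
      have lim1: "((\<lambda>h. norm (?r (x + h) - ?r x - ?d h) / norm h) \<longlongrightarrow> 0) (at 0)"
        using r unfolding has_derivative_at by blast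
      have cN0: "((\<lambda>h. N (x + h) b) \<longlongrightarrow> N x b) (at 0)"
        by (rule LIM_offset_zero[OF cN[unfolded isCont_def]])
      show "((\<lambda>y. ?r y *\<^sub>R N y b) has_derivative (\<lambda>h. ?d h *\<^sub>R N x b)) (at x)"
        unfolding has_derivative_at
      proof
        show "bounded_linear (\<lambda>h. ?d h *\<^sub>R N x b)"
          using bl bounded_linear_scaleR_const by blast
        have "((\<lambda>h. norm (?r (x + h) - ?r x - ?d h) / norm h * norm (N (x + h) b)
            + K * norm (N (x + h) b - N x b)) \<longlongrightarrow> 0 * norm (N x b) + K * norm (N x b - N x b)) (at 0)"
          using lim1 cN0 by (intro tendsto_intros)
        then have l2: "((\<lambda>h. norm (?r (x + h) - ?r x - ?d h) / norm h * norm (N (x + h) b)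
            + K * norm (N (x + h) b - N x b)) \<longlongrightarrow> 0) (at 0)" by simp
        show "(\<lambda>h. norm (?r (x + h) *\<^sub>R N (x + h) b - ?r x *\<^sub>R N x b - ?d h *\<^sub>R N x b) / norm h)
            \<midarrow>0\<rightarrow> 0"
        proof (rule Lim_null_comparison[OF _ l2])
          have "norm (norm (?r (x + h) *\<^sub>R N (x + h) b - ?r x *\<^sub>R N x b - ?d h *\<^sub>R N x b) / norm h)
             \<le> norm (?r (x + h) - ?r x - ?d h) / norm h * norm (N (x + h) b)
            + K * norm (N (x + h) b - N x b)" for h
          proof (cases "h = 0")
            case False
            have "?r (x + h) *\<^sub>R N (x + h) b - ?r x *\<^sub>R N x b - ?d h *\<^sub>R N x b
              = (?r (x + h) - ?r x - ?d h) *\<^sub>R N (x + h) b + ?d h *\<^sub>R (N (x + h) b - N x b)"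
              by (simp add: algebra_simps)
            then have "norm (?r (x + h) *\<^sub>R N (x + h) b - ?r x *\<^sub>R N x b - ?d h *\<^sub>R N x b)
              \<le> norm (?r (x + h) - ?r x - ?d h) * norm (N (x + h) b) + norm (?d h) * norm (N (x + h) b - N x b)"
              using norm_triangle_ineq by (metis norm_scaleR real_norm_def)
            also have "\<dots> \<le> norm (?r (x + h) - ?r x - ?d h) * norm (N (x + h) b) + (norm h * K) * norm (N (x + h) b - N x b)"
              by (intro add_mono mult_right_mono K order_refl) auto
            finally show ?thesis using False by (simp add: field_simps)
          qed (use K in simp)
          then show "\<forall>\<^sub>F h in at 0. norm (norm (?r (x + h) *\<^sub>R N (x + h) b - ?r x *\<^sub>R N x b - ?d h *\<^sub>R N x b) / norm h)
             \<le> norm (?r (x + h) - ?r x - ?d h) / norm h * norm (N (x + h) b)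
            + K * norm (N (x + h) b - N x b)" by (intro always_eventually) blast
        qed
      qed
    qed
    then have "((\<lambda>y. \<Sum>b\<in>Basis. (?R y \<bullet> b) *\<^sub>R N y b) has_derivative (\<lambda>h. N x (?DM x h u))) (at x)"
      by (simp only: linear_eq_sum_Basis[OF linN[OF x], symmetric])
    then have d: "((\<lambda>y. v' - (\<Sum>b\<in>Basis. (?R y \<bullet> b) *\<^sub>R N y b)) has_derivative (\<lambda>h. - N x (?DM x h u))) (at x)" for v'
      using has_derivative_diff[OF has_derivative_const[of v']] by simp
    have e: "u - (\<Sum>b\<in>Basis. (?R y \<bullet> b) *\<^sub>R N y b) = N y v" if "y \<in> S" for y
    proof -
      have "(\<Sum>b\<in>Basis. (?R y \<bullet> b) *\<^sub>R N y b) = N y (M y u - M x u)"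
        using linear_eq_sum_Basis[OF linN[OF that], of "M y u - M x u"] by simp
      then show ?thesis
        using linN[OF that] NM[OF that] MN[OF x] u_def by (simp add: linear_diff)
    qed
    show "((\<lambda>x. N x v) has_derivative (\<lambda>h. - N x (?DM x h (N x v)))) (at x)"
      using has_derivative_transform_within_open[OF d[of u] S x e] by (simp only: u_def)
  next
    fix h
    have "Ck_on k S (\<lambda>x. N x (?DM x h (N x v)))"
      by (rule Ck_on_apply[OF S linN _ Ck_on_apply[OF S linDM _ IH]])
        (simp_all add: IH Ck_on_SucD(2)[OF Suc.prems])
    then show "Ck_on k S (\<lambda>x. - N x (?DM x h (N x v)))"
      by (rule Ck_on_linear_comp[OF S bounded_linear_minus[OF bounded_linear_ident]])
  qed
qed

subsection \<open>Smooth maps\<close>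

lemma smooth_on_cong: "open S \<Longrightarrow> (\<And>x. x \<in> S \<Longrightarrow> f x = g x) \<Longrightarrow> smooth_on S f \<Longrightarrow> smooth_on S g"
  unfolding smooth_on_def using Ck_on_cong[of S f g] by blast

lemma smooth_on_subset: "smooth_on S f \<Longrightarrow> T \<subseteq> S \<Longrightarrow> smooth_on T f"
  unfolding smooth_on_def using Ck_on_subset by blast

lemma smooth_on_local:
  assumes "\<And>x. x \<in> S \<Longrightarrow> \<exists>U. open U \<and> x \<in> U \<and> smooth_on U f"
  shows "smooth_on S f"
  unfolding smooth_on_def
proof
  show "Ck_on k S f" for k
    by (rule Ck_on_local) (use assms in \<open>unfold smooth_on_def, blast\<close>)
qed

lemma smooth_on_const [simp]: "smooth_on S (\<lambda>x. c)"
  by (simp add: smooth_on_def)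

lemma smooth_on_linear_comp: "open S \<Longrightarrow> bounded_linear L \<Longrightarrow> smooth_on S f \<Longrightarrow> smooth_on S (\<lambda>x. L (f x))"
  by (simp add: smooth_on_def Ck_on_linear_comp)

lemma smooth_on_ident: "open S \<Longrightarrow> smooth_on S (\<lambda>x. x)"
  unfolding smooth_on_def
proof
  fix k assume S: "open S"
  show "Ck_on k S (\<lambda>x. x)"
  proof (cases k)
    case (Suc j)
    show ?thesis
      unfolding Suc by (rule Ck_on_SucI'[OF S, where f' = "\<lambda>x v. v"]) (simp_all)
  qed simp
qed

lemma smooth_on_linear: "open S \<Longrightarrow> bounded_linear L \<Longrightarrow> smooth_on S L"
  using smooth_on_linear_comp[OF _ _ smooth_on_ident] by blast

lemma smooth_on_add: "open S \<Longrightarrow> smooth_on S f \<Longrightarrow> smooth_on S g \<Longrightarrow> smooth_on S (\<lambda>x. f x + g x)"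
  by (simp add: smooth_on_def Ck_on_add)

lemma smooth_on_minus: "open S \<Longrightarrow> smooth_on S f \<Longrightarrow> smooth_on S (\<lambda>x. - f x)"
  by (rule smooth_on_linear_comp[OF _ bounded_linear_minus[OF bounded_linear_ident]])

lemma smooth_on_diff: "open S \<Longrightarrow> smooth_on S f \<Longrightarrow> smooth_on S g \<Longrightarrow> smooth_on S (\<lambda>x. f x - g x)"
  using smooth_on_add[of S f "\<lambda>x. - g x"] smooth_on_minus[of S g] by simp

lemma smooth_on_scaleR: "open S \<Longrightarrow> smooth_on S f \<Longrightarrow> smooth_on S g \<Longrightarrow> smooth_on S (\<lambda>x. f x *\<^sub>R g x)"
  by (simp add: smooth_on_def Ck_on_scaleR)

lemma smooth_on_mult:
  fixes f g :: "'a::real_normed_vector \<Rightarrow> real"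
  shows "open S \<Longrightarrow> smooth_on S f \<Longrightarrow> smooth_on S g \<Longrightarrow> smooth_on S (\<lambda>x. f x * g x)"
  using smooth_on_scaleR[of S f g] by simp

lemma smooth_on_inner: "open S \<Longrightarrow> smooth_on S f \<Longrightarrow> smooth_on S (\<lambda>x. f x \<bullet> c)"
  by (simp add: smooth_on_def Ck_on_inner)

lemma smooth_on_apply:
  fixes M :: "'a::real_normed_vector \<Rightarrow> 'b::euclidean_space \<Rightarrow> 'c::real_normed_vector"
  assumes "open S" "\<And>x. x \<in> S \<Longrightarrow> linear (M x)" "\<And>v. smooth_on S (\<lambda>x. M x v)" "smooth_on S f"
  shows "smooth_on S (\<lambda>x. M x (f x))"
  using assms by (simp add: smooth_on_def Ck_on_apply)

lemma smooth_on_compose: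
  fixes f :: "'a::real_normed_vector \<Rightarrow> 'b::euclidean_space"
  assumes "open S" "open T" "f ` S \<subseteq> T" "smooth_on T g" "smooth_on S f"
  shows "smooth_on S (\<lambda>x. g (f x))"
  using assms(4,5) by (simp add: smooth_on_def Ck_on_compose[OF assms(1-3)])

lemma smooth_on_has_derivative:
  "smooth_on S f \<Longrightarrow> x \<in> S \<Longrightarrow> (f has_derivative frechet_derivative f (at x)) (at x)"
  unfolding smooth_on_def using Ck_on_SucD(1) by blast

lemma smooth_on_linear_derivative: "smooth_on S f \<Longrightarrow> x \<in> S \<Longrightarrow> linear (frechet_derivative f (at x))"
  using smooth_on_has_derivative has_derivative_linear by blast

lemma smooth_on_derivative: "smooth_on S f \<Longrightarrow> smooth_on S (\<lambda>x. frechet_derivative f (at x) v)"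
  unfolding smooth_on_def using Ck_on_SucD(2) by blast

lemma smooth_on_derivative_apply:
  fixes f :: "'a::euclidean_space \<Rightarrow> 'b::real_normed_vector"
  assumes "open S" "smooth_on S f" "smooth_on S w"
  shows "smooth_on S (\<lambda>x. frechet_derivative f (at x) (w x))"
  by (rule smooth_on_apply[OF assms(1) smooth_on_linear_derivative[OF assms(2)] smooth_on_derivative[OF assms(2)] assms(3)])

lemma smooth_on_continuous: "smooth_on S f \<Longrightarrow> continuous_on S f"
  unfolding smooth_on_def using Ck_on.simps(1) by blast

lemma smooth_on_family_inverse:
  fixes M N :: "'a::real_normed_vector \<Rightarrow> 'b::euclidean_space \<Rightarrow> 'b"
  assumes "open S" "\<And>x. x \<in> S \<Longrightarrow> linear (M x)" "\<And>x. x \<in> S \<Longrightarrow> linear (N x)"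
    and "\<And>x v. x \<in> S \<Longrightarrow> N x (M x v) = v" "\<And>x v. x \<in> S \<Longrightarrow> M x (N x v) = v"
    and "\<And>v. continuous_on S (\<lambda>x. N x v)" "\<And>v. smooth_on S (\<lambda>x. M x v)"
  shows "smooth_on S (\<lambda>x. N x v)"
  using Ck_on_family_inverse[OF assms(1-6)] assms(7) unfolding smooth_on_def by blast

text \<open>Division by \<open>g x\<close> is the inverse of the family of multiplications by \<open>g x\<close>.\<close>

lemma smooth_on_divide:
  fixes f g :: "'a::real_normed_vector \<Rightarrow> real"
  assumes "open S" "smooth_on S f" "smooth_on S g" "\<And>x. x \<in> S \<Longrightarrow> g x \<noteq> 0"
  shows "smooth_on S (\<lambda>x. f x / g x)"
proof -
  have "smooth_on S (\<lambda>x. (1 / g x) * 1)"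
  proof (rule smooth_on_family_inverse[OF assms(1), where M = "\<lambda>x v. g x * v" and N = "\<lambda>x v. (1 / g x) * v" and v = 1])
    show "continuous_on S (\<lambda>x. 1 / g x * v)" for v
      using smooth_on_continuous[OF assms(3)] assms(4) by (intro continuous_intros) auto
    show "smooth_on S (\<lambda>x. g x * v)" for v
      by (rule smooth_on_mult[OF assms(1,3)]) simp
  qed (use assms(4) in \<open>auto intro!: linearI simp: algebra_simps add_divide_distrib\<close>)
  then show ?thesis
    using smooth_on_mult[OF assms(1,2), of "\<lambda>x. 1 / g x"] by simp
qed

text \<open>The derivative \<open>f' / (2 f) * sqrt f\<close> contains the square root itself, one order less regular, so
  induction over the order of differentiability applies.\<close>

lemma smooth_on_sqrt:
  assumes S: "open S" and f: "smooth_on S f" and pos: "\<And>x. x \<in> S \<Longrightarrow> f x > 0"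
  shows "smooth_on S (\<lambda>x. sqrt (f x))"
  unfolding smooth_on_def
proof
  show "Ck_on k S (\<lambda>x. sqrt (f x))" for k
  proof (induction k)
    case 0
    show ?case using smooth_on_continuous[OF f] by (simp add: continuous_on_real_sqrt)
  next
    case (Suc k)
    have d: "((\<lambda>x. sqrt (f x)) has_derivative
        (\<lambda>v. (frechet_derivative f (at x) v / (2 * f x)) *\<^sub>R sqrt (f x))) (at x)" if "x \<in> S" for x
    proof -
      have "((\<lambda>x. sqrt (f x)) has_derivative
        (\<lambda>v. frechet_derivative f (at x) v * (inverse (sqrt (f x)) / 2))) (at x)"
        using DERIV_real_sqrt[OF pos[OF that]] smooth_on_has_derivative[OF f that]
        by (rule DERIV_compose_FDERIV)
      moreover have "frechet_derivative f (at x) v * (inverse (sqrt (f x)) / 2)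
          = (frechet_derivative f (at x) v / (2 * f x)) *\<^sub>R sqrt (f x)" for v
      proof -
        have "sqrt (f x) * sqrt (f x) = f x" "sqrt (f x) \<noteq> 0"
          using pos[OF that] by auto
        then have "inverse (sqrt (f x)) / 2 = sqrt (f x) / (2 * f x)"
          by (simp add: field_simps)
        then show ?thesis by simp
      qed
      ultimately show ?thesis by (simp only:)
    qed
    show ?case
    proof (rule Ck_on_SucI'[OF S d])
      fix v
      have "smooth_on S (\<lambda>x. frechet_derivative f (at x) v / (2 * f x))"
      proof (rule smooth_on_divide[OF S smooth_on_derivative[OF f]])
        show "smooth_on S (\<lambda>x. 2 * f x)"
          by (rule smooth_on_mult[OF S _ f]) simp
        show "2 * f x \<noteq> 0" if "x \<in> S" for x
          using pos[OF that] by simp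
      qed
      then show "Ck_on k S (\<lambda>x. (frechet_derivative f (at x) v / (2 * f x)) *\<^sub>R sqrt (f x))"
        unfolding smooth_on_def using Ck_on_scaleR[OF S _ Suc.IH] by blast
    qed
  qed
qed

subsection \<open>Second derivatives\<close>

lemma smooth_on_has_real_derivative_line:
  fixes f :: "'a::real_normed_vector \<Rightarrow> real"
  assumes "smooth_on S f" "a + t *\<^sub>R v \<in> S"
  shows "((\<lambda>t. f (a + t *\<^sub>R v)) has_real_derivative frechet_derivative f (at (a + t *\<^sub>R v)) v) (at t)"
proof -
  have "((\<lambda>t. a + t *\<^sub>R v) has_derivative (\<lambda>h. h *\<^sub>R v)) (at t)"
    by (auto intro!: derivative_eq_intros)
  then have "((\<lambda>t. f (a + t *\<^sub>R v)) has_derivative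
      (\<lambda>h. frechet_derivative f (at (a + t *\<^sub>R v)) (h *\<^sub>R v))) (at t)"
    using smooth_on_has_derivative[OF assms] by (rule has_derivative_compose)
  moreover have "frechet_derivative f (at (a + t *\<^sub>R v)) (h *\<^sub>R v) = h * frechet_derivative f (at (a + t *\<^sub>R v)) v" for h
    using smooth_on_linear_derivative[OF assms] by (simp add: linear_scale)
  ultimately show ?thesis
    unfolding has_field_derivative_def by (simp add: mult.commute[of _ "frechet_derivative f (at (a + t *\<^sub>R v)) v"])
qed

text \<open>Both mixed derivatives are limits of the same second difference quotient: the mean value theorem,
  applied once in each direction, turns the second difference into a value of a mixed derivative at a
  nearby point.\<close>

lemma second_difference_mean_value:
  fixes f :: "'a::real_normed_vector \<Rightarrow> real"
  assumes f: "smooth_on S f" and h: "0 < h"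
    and S: "\<And>s t. 0 \<le> s \<Longrightarrow> s \<le> h \<Longrightarrow> 0 \<le> t \<Longrightarrow> t \<le> h \<Longrightarrow> u + s *\<^sub>R v + t *\<^sub>R w \<in> S"
  shows "\<exists>s t. 0 \<le> s \<and> s \<le> h \<and> 0 \<le> t \<and> t \<le> h \<and>
    f (u + h *\<^sub>R v + h *\<^sub>R w) - f (u + h *\<^sub>R v) - f (u + h *\<^sub>R w) + f u =
    h * h * frechet_derivative (\<lambda>x. frechet_derivative f (at x) v) (at (u + s *\<^sub>R v + t *\<^sub>R w)) w"
proof -
  let ?g = "\<lambda>s. f ((u + h *\<^sub>R w) + s *\<^sub>R v) - f (u + s *\<^sub>R v)"
  have g: "(?g has_real_derivative (frechet_derivative f (at ((u + h *\<^sub>R w) + s *\<^sub>R v)) v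
      - frechet_derivative f (at (u + s *\<^sub>R v)) v)) (at s)" if "0 \<le> s" "s \<le> h" for s
    using S[OF that, of h] S[OF that, of 0] h
    by (intro DERIV_diff smooth_on_has_real_derivative_line[OF f]) (auto simp: algebra_simps)
  obtain s where s: "0 < s" "s < h" "?g h - ?g 0 = (h - 0) *
      (frechet_derivative f (at ((u + h *\<^sub>R w) + s *\<^sub>R v)) v - frechet_derivative f (at (u + s *\<^sub>R v)) v)"
    using MVT2[OF h g] by blast
  let ?k = "\<lambda>t. frechet_derivative f (at ((u + s *\<^sub>R v) + t *\<^sub>R w)) v"
  have k: "(?k has_real_derivative
      frechet_derivative (\<lambda>x. frechet_derivative f (at x) v) (at ((u + s *\<^sub>R v) + t *\<^sub>R w)) w) (at t)"
    if "0 \<le> t" "t \<le> h" for t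
    using S[of s t] that s by (intro smooth_on_has_real_derivative_line[OF smooth_on_derivative[OF f]]) auto
  obtain t where t: "0 < t" "t < h" "?k h - ?k 0 = (h - 0) *
      frechet_derivative (\<lambda>x. frechet_derivative f (at x) v) (at ((u + s *\<^sub>R v) + t *\<^sub>R w)) w"
    using MVT2[OF h k] by blast
  have "?g h - ?g 0 = h * (?k h - ?k 0)"
    using s(3) by (simp add: algebra_simps)
  then have "?g h - ?g 0 = h * h * frechet_derivative (\<lambda>x. frechet_derivative f (at x) v) (at (u + s *\<^sub>R v + t *\<^sub>R w)) w"
    using t(3) by simp
  moreover have "?g h - ?g 0 = f (u + h *\<^sub>R v + h *\<^sub>R w) - f (u + h *\<^sub>R v) - f (u + h *\<^sub>R w) + f u"
    by (simp add: algebra_simps)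
  ultimately show ?thesis
    using s t by (metis less_imp_le)
qed

text \<open>If the two mixed derivatives differed at \<open>u\<close>, continuity would separate their values in a
  neighbourhood, whereas the second difference over a small parallelogram is a value of either.\<close>

lemma second_derivative_symmetric_real:
  fixes f :: "'a::real_normed_vector \<Rightarrow> real"
  assumes f: "smooth_on S f" and S: "open S" and u: "u \<in> S"
  shows "frechet_derivative (\<lambda>x. frechet_derivative f (at x) v) (at u) w =
    frechet_derivative (\<lambda>x. frechet_derivative f (at x) w) (at u) v"
proof (rule ccontr)
  let ?D = "\<lambda>v w x. frechet_derivative (\<lambda>x. frechet_derivative f (at x) v) (at x) w"
  assume ne: "?D v w u \<noteq> ?D w v u"
  define e where "e = \<bar>?D v w u - ?D w v u\<bar> / 2"
  have e: "e > 0" using ne by (simp add: e_def)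
  have cont: "isCont (?D v w) u" for v w
    using smooth_on_continuous[OF smooth_on_derivative[OF smooth_on_derivative[OF f]]] S u
    by (simp add: continuous_on_eq_continuous_at)
  have near: "eventually (\<lambda>x. x \<in> S \<and> \<bar>?D v w x - ?D v w u\<bar> < e \<and> \<bar>?D w v x - ?D w v u\<bar> < e) (nhds u)"
  proof (intro eventually_conj)
    show "eventually (\<lambda>x. x \<in> S) (nhds u)"
      using S u by (rule eventually_nhds_in_open)
    have ev: "eventually (\<lambda>x. \<bar>?D v w x - ?D v w u\<bar> < e) (nhds u)" for v w
      using tendstoD[OF cont[of v w, unfolded isCont_def tendsto_at_iff_tendsto_nhds] e] e by (simp add: dist_real_def eventually_nhds_conv_at)
    show "eventually (\<lambda>x. \<bar>?D v w x - ?D v w u\<bar> < e) (nhds u)"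
      "eventually (\<lambda>x. \<bar>?D w v x - ?D w v u\<bar> < e) (nhds u)" by (rule ev)+
  qed
  then obtain d where d: "d > 0"
    "\<And>x. dist x u < d \<Longrightarrow> x \<in> S \<and> \<bar>?D v w x - ?D v w u\<bar> < e \<and> \<bar>?D w v x - ?D w v u\<bar> < e"
    unfolding eventually_nhds_metric by blast
  \<comment> \<open>a step for which the parallelogram stays in the ball of radius \<open>d\<close>\<close>
  define h where "h = d / (2 * (norm v + norm w + 1))"
  have h: "h > 0" using d(1) by (simp add: h_def add_nonneg_pos)
  have hd: "h * (norm v + norm w) < d"
  proof -
    have "h * (norm v + norm w) \<le> h * (norm v + norm w + 1)"
      using h by (intro mult_left_mono) auto
    also have "\<dots> = d / 2"
      using add_nonneg_pos[of "norm v + norm w" 1] by (simp add: h_def field_simps)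
    also have "\<dots> < d" using d(1) by simp
    finally show ?thesis .
  qed
  have close: "dist (u + s *\<^sub>R v + t *\<^sub>R w) u < d" if "0 \<le> s" "s \<le> h" "0 \<le> t" "t \<le> h" for s t
  proof -
    have "dist (u + s *\<^sub>R v + t *\<^sub>R w) u = norm (s *\<^sub>R v + t *\<^sub>R w)"
      by (simp add: dist_norm algebra_simps)
    also have "\<dots> \<le> s * norm v + t * norm w"
      using norm_triangle_ineq[of "s *\<^sub>R v" "t *\<^sub>R w"] that by simp
    also have "\<dots> \<le> h * norm v + h * norm w"
      using that by (intro add_mono mult_right_mono) auto
    finally show ?thesis using hd by (simp add: distrib_left)
  qed
  have close': "dist (u + s *\<^sub>R w + t *\<^sub>R v) u < d" if "0 \<le> s" "s \<le> h" "0 \<le> t" "t \<le> h" for s t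
    using close[of t s] that by (simp add: algebra_simps)
  obtain s t where 1: "0 \<le> s" "s \<le> h" "0 \<le> t" "t \<le> h"
    "f (u + h *\<^sub>R v + h *\<^sub>R w) - f (u + h *\<^sub>R v) - f (u + h *\<^sub>R w) + f u = h * h * ?D v w (u + s *\<^sub>R v + t *\<^sub>R w)"
    using second_difference_mean_value[OF f h, of u v w] close d(2) by blast
  obtain s' t' where 2: "0 \<le> s'" "s' \<le> h" "0 \<le> t'" "t' \<le> h"
    "f (u + h *\<^sub>R w + h *\<^sub>R v) - f (u + h *\<^sub>R w) - f (u + h *\<^sub>R v) + f u = h * h * ?D w v (u + s' *\<^sub>R w + t' *\<^sub>R v)"
    using second_difference_mean_value[OF f h, of u w v] close' d(2) by blast
  have sw: "u + h *\<^sub>R w + h *\<^sub>R v = u + h *\<^sub>R v + h *\<^sub>R w" by (simp add: algebra_simps)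
  have "h * h * ?D v w (u + s *\<^sub>R v + t *\<^sub>R w) = h * h * ?D w v (u + s' *\<^sub>R w + t' *\<^sub>R v)"
    using 1(5) 2(5) unfolding sw by linarith
  then have "?D v w (u + s *\<^sub>R v + t *\<^sub>R w) = ?D w v (u + s' *\<^sub>R w + t' *\<^sub>R v)"
    using h by simp
  moreover have False if "p = q" "\<bar>p - a\<bar> < \<bar>a - b\<bar> / 2" "\<bar>q - b\<bar> < \<bar>a - b\<bar> / 2" for p q a b :: real
    using that by (auto simp: abs_if split: if_splits)
  ultimately show False
    using d(2)[OF close[OF 1(1-4)]] d(2)[OF close'[OF 2(1-4)]] unfolding e_def by blast
qed

lemma frechet_derivative_inner:
  assumes "f differentiable (at x)"
  shows "frechet_derivative (\<lambda>x. f x \<bullet> b) (at x) v = frechet_derivative f (at x) v \<bullet> b"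
  using fun_cong[OF frechet_derivative_at[OF has_derivative_inner_left[OF assms[unfolded frechet_derivative_works], of b]], of v]
  by (rule sym)

lemma second_derivative_symmetric:
  fixes f :: "'a::real_normed_vector \<Rightarrow> 'b::euclidean_space"
  assumes f: "smooth_on S f" and S: "open S" and u: "u \<in> S"
  shows "frechet_derivative (\<lambda>x. frechet_derivative f (at x) v) (at u) w =
    frechet_derivative (\<lambda>x. frechet_derivative f (at x) w) (at u) v"
proof (rule euclidean_eqI)
  fix b :: 'b
  have dif: "g differentiable (at x)" if "smooth_on S g" "x \<in> S" for g :: "'a \<Rightarrow> 'b" and x
    using smooth_on_has_derivative[OF that] unfolding differentiable_def by blast
  have *: "frechet_derivative (\<lambda>x. frechet_derivative f (at x) v) (at u) w \<bullet> b =
    frechet_derivative (\<lambda>x. frechet_derivative (\<lambda>x. f x \<bullet> b) (at x) v) (at u) w" for v w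
  proof -
    have "((\<lambda>x. frechet_derivative f (at x) v \<bullet> b) has_derivative
        (\<lambda>w. frechet_derivative (\<lambda>x. frechet_derivative f (at x) v) (at u) w \<bullet> b)) (at u)"
      using has_derivative_inner_left[OF smooth_on_has_derivative[OF smooth_on_derivative[OF f] u]] .
    then have "((\<lambda>x. frechet_derivative (\<lambda>x. f x \<bullet> b) (at x) v) has_derivative
        (\<lambda>w. frechet_derivative (\<lambda>x. frechet_derivative f (at x) v) (at u) w \<bullet> b)) (at u)"
      by (rule has_derivative_transform_within_open[OF _ S u]) (simp add: frechet_derivative_inner dif[OF f])
    then show ?thesis
      by (rule fun_cong[OF frechet_derivative_at])
  qed
  show "frechet_derivative (\<lambda>x. frechet_derivative f (at x) v) (at u) w \<bullet> b =
    frechet_derivative (\<lambda>x. frechet_derivative f (at x) w) (at u) v \<bullet> b"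
    using second_derivative_symmetric_real[OF smooth_on_inner[OF S f] S u, of b v w] *[of v w] *[of w v]
    by (simp only:)
qed

text \<open>Brackets of related vector fields are related: the second derivatives of the map cancel by
  symmetry.\<close>

lemma euclidean_bracket_related:
  fixes F :: "'a::euclidean_space \<Rightarrow> 'b::euclidean_space"
  assumes F: "smooth_on S F" and S: "open S" and u: "u \<in> S"
    and xi: "(\<xi> has_derivative \<xi>') (at u)" and eta: "(\<eta> has_derivative \<eta>') (at u)"
    and xi2: "(\<Xi> has_derivative \<Xi>') (at (F u))" and eta2: "(H has_derivative H') (at (F u))"
    and rel: "\<And>x. x \<in> S \<Longrightarrow> \<Xi> (F x) = frechet_derivative F (at x) (\<xi> x)"
      "\<And>x. x \<in> S \<Longrightarrow> H (F x) = frechet_derivative F (at x) (\<eta> x)"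
  shows "H' (\<Xi> (F u)) - \<Xi>' (H (F u)) = frechet_derivative F (at u) (\<eta>' (\<xi> u) - \<xi>' (\<eta> u))"
proof -
  let ?DF = "\<lambda>x. frechet_derivative F (at x)"
  let ?D2 = "\<lambda>v w. frechet_derivative (\<lambda>x. ?DF x v) (at u) w"
  have push: "Z' (?DF u w) = ?D2 (\<zeta> u) w + ?DF u (\<zeta>' w)"
    if z: "(\<zeta> has_derivative \<zeta>') (at u)" and Z: "(Z has_derivative Z') (at (F u))"
      and r: "\<And>x. x \<in> S \<Longrightarrow> Z (F x) = ?DF x (\<zeta> x)" for \<zeta> \<zeta>' Z Z' w
  proof -
    have lin: "linear (?DF x)" if "x \<in> S" for x
      using smooth_on_linear_derivative[OF F that] .
    have sw: "?D2 v w = ?D2 w v" for v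
      by (rule second_derivative_symmetric[OF F S u])
    have "((\<lambda>x. Z (F x)) has_derivative (\<lambda>w. Z' (?DF u w))) (at u)"
      by (rule has_derivative_compose[OF smooth_on_has_derivative[OF F u] Z])
    then have 1: "((\<lambda>x. ?DF x (\<zeta> x)) has_derivative (\<lambda>w. Z' (?DF u w))) (at u)"
      by (rule has_derivative_transform_within_open[OF _ S u]) (rule r)
    have "((\<lambda>x. \<Sum>b\<in>Basis. (\<zeta> x \<bullet> b) *\<^sub>R ?DF x b) has_derivative
        (\<lambda>w. \<Sum>b\<in>Basis. (\<zeta> u \<bullet> b) *\<^sub>R ?D2 b w + (\<zeta>' w \<bullet> b) *\<^sub>R ?DF u b)) (at u)"
      by (intro has_derivative_sum has_derivative_scaleR has_derivative_inner_left z
          smooth_on_has_derivative[OF smooth_on_derivative[OF F] u])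
    then have "((\<lambda>x. ?DF x (\<zeta> x)) has_derivative
        (\<lambda>w. \<Sum>b\<in>Basis. (\<zeta> u \<bullet> b) *\<^sub>R ?D2 b w + (\<zeta>' w \<bullet> b) *\<^sub>R ?DF u b)) (at u)"
      by (rule has_derivative_transform_within_open[OF _ S u]) (rule linear_eq_sum_Basis[OF lin, symmetric])
    then have "Z' (?DF u w) = (\<Sum>b\<in>Basis. (\<zeta> u \<bullet> b) *\<^sub>R ?D2 b w + (\<zeta>' w \<bullet> b) *\<^sub>R ?DF u b)"
      by (rule fun_cong[OF has_derivative_unique[OF 1]])
    also have "\<dots> = (\<Sum>b\<in>Basis. (\<zeta> u \<bullet> b) *\<^sub>R ?D2 w b) + (\<Sum>b\<in>Basis. (\<zeta>' w \<bullet> b) *\<^sub>R ?DF u b)"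
      by (simp only: sum.distrib sw)
    also have "\<dots> = ?D2 w (\<zeta> u) + ?DF u (\<zeta>' w)"
      using linear_eq_sum_Basis[OF lin[OF u], of "\<zeta>' w"]
        linear_eq_sum_Basis[OF smooth_on_linear_derivative[OF smooth_on_derivative[OF F] u], of w "\<zeta> u"] by (simp only:)
    finally show ?thesis
      by (simp only: sw)
  qed
  have "H' (\<Xi> (F u)) = ?D2 (\<eta> u) (\<xi> u) + ?DF u (\<eta>' (\<xi> u))"
    using push[OF eta eta2 rel(2), of "\<xi> u"] rel(1)[OF u] by simp
  moreover have "\<Xi>' (H (F u)) = ?D2 (\<xi> u) (\<eta> u) + ?DF u (\<xi>' (\<eta> u))"
    using push[OF xi xi2 rel(1), of "\<eta> u"] rel(2)[OF u] by simp
  ultimately show ?thesis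
    using second_derivative_symmetric[OF F S u, of "\<xi> u" "\<eta> u"] smooth_on_linear_derivative[OF F u]
    by (simp add: linear_diff)
qed

subsection \<open>Local left inverses of immersions\<close>

text \<open>The inverse function theorem yields a differentiable inverse whose derivative at \<open>y\<close> is the inverse
  of the derivative of \<open>F\<close>.  Once this inverse matrix is known to be continuous in \<open>y\<close>, each order of
  differentiability of the inverse map gives the next one.\<close>

lemma smooth_local_inverse:
  fixes F :: "'a::euclidean_space \<Rightarrow> 'a"
  assumes F: "smooth_on S F" and S: "open S" and u: "u \<in> S"
    and inv: "\<And>v. L (frechet_derivative F (at u) v) = v" and L: "linear L"
  obtains U V G where "open U" "U \<subseteq> S" "u \<in> U" "open V" "homeomorphism U V F G" "smooth_on V G"
proof -
  let ?DF = "\<lambda>x. frechet_derivative F (at x)"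
  define F' where "F' x = Blinfun (?DF x)" for x
  have bl: "bounded_linear (?DF x)" if "x \<in> S" for x
    using smooth_on_has_derivative[OF F that] has_derivative_bounded_linear by blast
  have F'_apply: "blinfun_apply (F' x) = ?DF x" if "x \<in> S" for x
    using bounded_linear_Blinfun_apply[OF bl[OF that]] by (simp add: F'_def)
  have blL: "bounded_linear L" using L linear_conv_bounded_linear by blast
  obtain U V g g' where U: "open U" "U \<subseteq> S" "u \<in> U" "open V" "homeomorphism U V F g"
    and g: "\<And>y. y \<in> V \<Longrightarrow> (g has_derivative g' y) (at y)"
    and g': "\<And>y. y \<in> V \<Longrightarrow> g' y = Hilbert_Choice.inv (blinfun_apply (F' (g y)))"
    and bij: "\<And>y. y \<in> V \<Longrightarrow> bij (blinfun_apply (F' (g y)))"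
  proof (rule inverse_function_theorem[OF S, of F F' u "Blinfun L"])
    show "(F has_derivative blinfun_apply (F' x)) (at x)" if "x \<in> S" for x
      using smooth_on_has_derivative[OF F that] F'_apply[OF that] by simp
    have "continuous_on S (\<lambda>x. blinfun_apply (F' x) v)" for v
      using continuous_on_eq[OF smooth_on_continuous[OF smooth_on_derivative[OF F, of v]]] F'_apply by force
    then show "continuous_on S F'"
      by (intro continuous_on_blinfun_componentwise) auto
    show "Blinfun L o\<^sub>L F' u = id_blinfun"
      by (rule blinfun_eqI) (simp add: bounded_linear_Blinfun_apply[OF blL] F'_apply[OF u] inv)
  qed (use u in auto)
  have gU: "g y \<in> U" if "y \<in> V" for y
    using U(5) that unfolding homeomorphism_def by blast
  have gS: "g y \<in> S" if "y \<in> V" for y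
    using gU[OF that] U(2) by blast
  have N: "linear (g' y)" if "y \<in> V" for y
    using g[OF that] has_derivative_linear by blast
  have inv1: "g' y (?DF (g y) v) = v" if "y \<in> V" for y v
    using g'[OF that] bij[OF that] F'_apply[OF gS[OF that]] by (simp add: bij_is_inj)
  have inv2: "?DF (g y) (g' y v) = v" if "y \<in> V" for y v
    using g'[OF that] bij[OF that] F'_apply[OF gS[OF that]] by (simp add: bij_is_surj surj_f_inv_f)
  have contg: "continuous_on V g"
    using U(5) homeomorphism_def by blast
  have cont': "continuous_on V (\<lambda>y. g' y v)" for v
  proof -
    have "isCont (\<lambda>y. g' y v) y" if y: "y \<in> V" for y
    proof -
      \<comment> \<open>an invertible matrix stays invertible, with bounded inverse, under small perturbations\<close>
      let ?M = "\<lambda>y. ?DF (g y)"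
      let ?K = "onorm (g' y) + 1"
      have blg: "bounded_linear (g' y)" using g[OF y] has_derivative_bounded_linear by blast
      have K: "?K > 0" using onorm_pos_le[OF blg] by simp
      have le: "norm w \<le> ?K * norm (?M y w)" for w
      proof -
        have "norm w = norm (g' y (?M y w))" using inv1[OF y] by simp
        also have "\<dots> \<le> onorm (g' y) * norm (?M y w)" by (rule onorm[OF blg])
        also have "\<dots> \<le> ?K * norm (?M y w)" by (intro mult_right_mono) auto
        finally show ?thesis .
      qed
      have cM: "isCont (\<lambda>z. ?M z w) y" for w
        using continuous_on_compose2[OF smooth_on_continuous[OF smooth_on_derivative[OF F, of w]] contg]
          gS U(4) y by (auto simp: continuous_on_eq_continuous_at)
      have small: "((\<lambda>z. (\<Sum>b\<in>Basis. norm (?M z b - ?M y b))) \<longlongrightarrow> 0) (at y)"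
      proof -
        have "((\<lambda>z. (\<Sum>b\<in>Basis. norm (?M z b - ?M y b))) \<longlongrightarrow> (\<Sum>b\<in>Basis. norm (?M y b - ?M y b))) (at y)"
          using cM unfolding isCont_def by (intro tendsto_intros)
        then show ?thesis by simp
      qed
      have est: "norm (?M z w - ?M y w) \<le> (\<Sum>b\<in>Basis. norm (?M z b - ?M y b)) * norm w" if "z \<in> V" for z w
      proof -
        have "?M z w - ?M y w = (\<Sum>b\<in>Basis. (w \<bullet> b) *\<^sub>R (?M z b - ?M y b))"
          using linear_eq_sum_Basis[OF smooth_on_linear_derivative[OF F gS[OF that]], of w]
            linear_eq_sum_Basis[OF smooth_on_linear_derivative[OF F gS[OF y]], of w]
          by (simp add: sum_subtractf algebra_simps)
        also have "norm \<dots> \<le> (\<Sum>b\<in>Basis. norm ((w \<bullet> b) *\<^sub>R (?M z b - ?M y b)))"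
          by (rule norm_sum)
        also have "\<dots> \<le> (\<Sum>b\<in>Basis. norm (?M z b - ?M y b) * norm w)"
          by (intro sum_mono) (simp add: mult.commute[of "norm (_ :: 'a)" "norm w"] mult_right_mono[OF Basis_le_norm])
        finally show ?thesis by (simp add: sum_distrib_right)
      qed
      define c where "c z = (\<Sum>b\<in>Basis. norm (?M z b - ?M y b))" for z
      have c: "(c \<longlongrightarrow> 0) (at y)" using small by (simp add: c_def[abs_def])
      have ev1: "eventually (\<lambda>z. ?K * c z < 1 / 2) (at y)"
        using tendsto_mult_right_zero[OF c, of ?K] by (rule order_tendstoD(2)) simp
      have ev2: "eventually (\<lambda>z. z \<in> V) (at y)"
        using U(4) y by (simp add: eventually_at_in_open')
      have bound: "eventually (\<lambda>z. norm (g' z v - g' y v) \<le> 2 * ?K * (c z * norm (g' y v))) (at y)"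
        using ev1 ev2
      proof eventually_elim
        case (elim z)
        have low: "norm w \<le> 2 * ?K * norm (?M z w)" for w
        proof -
          have "norm (?M y w) \<le> norm (?M z w) + norm (?M z w - ?M y w)"
            by (metis norm_minus_commute norm_triangle_sub)
          then have "norm w \<le> ?K * (norm (?M z w) + norm (?M z w - ?M y w))"
            using le[of w] mult_left_mono[of _ _ ?K] K by (meson less_imp_le order_trans)
          also have "\<dots> \<le> ?K * (norm (?M z w) + c z * norm w)"
            using est[OF elim(2), of w] K by (intro mult_left_mono add_left_mono) (auto simp: c_def)
          also have "\<dots> \<le> ?K * norm (?M z w) + 1 / 2 * norm w"
            using mult_right_mono[of "?K * c z" "1/2" "norm w"] elim(1) by (simp add: algebra_simps)
          finally show ?thesis by (simp add: algebra_simps)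
        qed
        have "norm (g' z v - g' y v) \<le> 2 * ?K * norm (?M z (g' z v - g' y v))" by (rule low)
        also have "?M z (g' z v - g' y v) = - (?M z (g' y v) - ?M y (g' y v))"
          using inv2[OF elim(2)] inv2[OF y] smooth_on_linear_derivative[OF F gS[OF elim(2)]]
          by (simp add: linear_diff)
        also have "2 * ?K * norm (- (?M z (g' y v) - ?M y (g' y v))) \<le> 2 * ?K * (c z * norm (g' y v))"
          using est[OF elim(2), of "g' y v"] K by (intro mult_left_mono) (auto simp: c_def norm_minus_cancel simp del: minus_diff_eq)
        finally show ?case .
      qed
      have "((\<lambda>z. 2 * ?K * (c z * norm (g' y v))) \<longlongrightarrow> 0) (at y)"
        by (intro tendsto_mult_right_zero tendsto_mult_left_zero c)
      then have "((\<lambda>z. g' z v - g' y v) \<longlongrightarrow> 0) (at y)"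
        using Lim_null_comparison[OF bound] by blast
      then show ?thesis
        unfolding isCont_def by (rule Lim_null[THEN iffD2])
    qed
    then show ?thesis by (simp add: continuous_at_imp_continuous_on)
  qed
  have Ckg: "Ck_on k V g" for k
  proof (induction k)
    case 0
    show ?case using contg by simp
  next
    case (Suc k)
    show ?case
    proof (rule Ck_on_SucI'[OF U(4) g])
      fix v
      have "Ck_on k V (\<lambda>y. ?DF (g y) w)" for w
        by (rule Ck_on_compose[OF U(4) S _ _ Suc.IH])
          (use gS smooth_on_derivative[OF F] in \<open>auto simp: smooth_on_def\<close>)
      then show "Ck_on k V (\<lambda>y. g' y v)"
        using Ck_on_family_inverse[OF U(4) smooth_on_linear_derivative[OF F gS] N inv1 inv2 cont'] by blast
    qed
  qed
  show thesis
    by (rule that[OF U]) (simp add: smooth_on_def Ckg)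
qed

text \<open>Composing \<open>F\<close> with a linear left inverse of its derivative yields a map that is locally invertible.\<close>

lemma smooth_local_left_inverse:
  fixes F :: "'a::euclidean_space \<Rightarrow> 'b::euclidean_space"
  assumes F: "smooth_on S F" and S: "open S" and u: "u \<in> S"
    and inj: "inj (frechet_derivative F (at u))"
  obtains U W R where "open U" "u \<in> U" "U \<subseteq> S" "open W" "F ` U \<subseteq> W" "smooth_on W R" "R ` W \<subseteq> U"
    "\<And>x. x \<in> U \<Longrightarrow> R (F x) = x"
proof -
  have lin: "linear (frechet_derivative F (at u))"
    by (rule smooth_on_linear_derivative[OF F u])
  obtain L where L: "linear L" "L \<circ> frechet_derivative F (at u) = id"
    using linear_injective_left_inverse[OF lin inj] by blast
  have blL: "bounded_linear L" using L(1) linear_conv_bounded_linear by blast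
  have LF: "smooth_on S (\<lambda>x. L (F x))"
    by (rule smooth_on_linear_comp[OF S blL F])
  have "((\<lambda>x. L (F x)) has_derivative (\<lambda>v. L (frechet_derivative F (at u) v))) (at u)"
    by (rule bounded_linear.has_derivative[OF blL smooth_on_has_derivative[OF F u]])
  then have "((\<lambda>x. L (F x)) has_derivative (\<lambda>v. v)) (at u)"
    using L(2) by (simp add: fun_eq_iff)
  then have "frechet_derivative (\<lambda>x. L (F x)) (at u) v = v" for v
    using fun_cong[OF frechet_derivative_at, of _ "\<lambda>v. v" u v] by simp
  then obtain U V G where U: "open U" "U \<subseteq> S" "u \<in> U" "open V" "homeomorphism U V (\<lambda>x. L (F x)) G" "smooth_on V G"
    by (rule smooth_local_inverse[OF LF S u _ linear_id[unfolded id_def]]) blast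
  show thesis
  proof
    show "open (L -` V)"
      using U(4) blL continuous_open_vimage linear_continuous_on open_vimage by blast
    show "smooth_on (L -` V) (\<lambda>y. G (L y))"
      by (rule smooth_on_compose[OF \<open>open (L -` V)\<close> U(4) _ U(6) smooth_on_linear[OF _ blL]])
        (use \<open>open (L -` V)\<close> in auto)
    show "F ` U \<subseteq> L -` V" "(\<lambda>y. G (L y)) ` (L -` V) \<subseteq> U" "\<And>x. x \<in> U \<Longrightarrow> G (L (F x)) = x"
      using U(5) unfolding homeomorphism_def by blast+
  qed (use U in auto)
qed

section \<open>Charts and tangent vectors\<close>

lemma is_chartD:
  assumes "is_chart c"
  shows "open (fst c)" "open (snd c ` fst c)"
    and "\<And>p. p \<in> fst c \<Longrightarrow> chart_inv c (snd c p) = p"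
    and "\<And>u. u \<in> snd c ` fst c \<Longrightarrow> snd c (chart_inv c u) = u"
    and "\<And>u. u \<in> snd c ` fst c \<Longrightarrow> chart_inv c u \<in> fst c"
    and "continuous_on (fst c) (snd c)" "continuous_on (snd c ` fst c) (chart_inv c)"
  using assms unfolding is_chart_def homeomorphism_def by auto

lemma chart_image_open:
  assumes c: "is_chart c" and U: "open U"
  shows "open (snd c ` (fst c \<inter> U))"
proof -
  have "openin (top_of_set (snd c ` fst c)) (snd c ` (fst c \<inter> U))"
    using c U unfolding is_chart_def
    by (meson homeomorphism_imp_open_map openin_open_Int)
  then show ?thesis
    using is_chartD(2)[OF c] openin_open_eq by blast
qed

lemma chart_vimage_open:
  assumes c: "is_chart c" and V: "open V"
  shows "open {p \<in> fst c. snd c p \<in> V}"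
  using continuous_open_preimage[OF is_chartD(6,1)[OF c] V] by (simp add: vimage_def Int_def)

text \<open>Charts that may be added to the atlas.  The analytic structure supplies charts of this kind.\<close>

definition compatible_chart :: "('a::topological_space, 'e::euclidean_space) chart set \<Rightarrow> ('a, 'e) chart \<Rightarrow> bool" where
  "compatible_chart A c \<longleftrightarrow> is_chart c \<and>
     (\<forall>d\<in>A. smooth_on (snd c ` (fst c \<inter> fst d)) (\<lambda>u. snd d (chart_inv c u)) \<and>
        smooth_on (snd d ` (fst d \<inter> fst c)) (\<lambda>u. snd c (chart_inv d u)))"

definition tangent_comp :: "('a, 'e::euclidean_space) chart set \<Rightarrow> ('a, 'e) chart \<Rightarrow> ('a \<Rightarrow> 'e) \<Rightarrow> 'e \<Rightarrow> 'e" where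
  "tangent_comp A c X u = tderiv A (snd c) (chart_inv c u) (X (chart_inv c u))"

lemma atlas_compatible:
  assumes "atlas smooth_on A'" "A \<subseteq> A'" "c \<in> A'"
  shows "compatible_chart A c"
  using assms unfolding atlas_def compatible_chart_def o_def by blast

locale smooth_manifold =
  fixes A :: "('a::topological_space, 'e::euclidean_space) chart set"
  assumes atlas: "atlas smooth_on A"
begin

lemma compatible [simp]: "c \<in> A \<Longrightarrow> compatible_chart A c"
  by (rule atlas_compatible[OF atlas subset_refl])

lemma is_chart [simp]: "compatible_chart A c \<Longrightarrow> is_chart c"
  by (simp add: compatible_chart_def)

lemma ref_chart: "ref_chart A p \<in> A" "p \<in> fst (ref_chart A p)"
proof -
  have "\<exists>c. c \<in> A \<and> p \<in> fst c"
    using atlas unfolding atlas_def by blast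
  then show "ref_chart A p \<in> A" "p \<in> fst (ref_chart A p)"
    unfolding ref_chart_def by (rule someI2_ex, blast)+
qed

text \<open>Near each point the two charts are compared through a chart of the atlas.\<close>

lemma transition_smooth:
  assumes c: "compatible_chart A c" and d: "compatible_chart A d"
  shows "smooth_on (snd c ` (fst c \<inter> fst d)) (\<lambda>u. snd d (chart_inv c u))"
proof (rule smooth_on_local)
  fix u assume "u \<in> snd c ` (fst c \<inter> fst d)"
  then obtain p where p: "p \<in> fst c" "p \<in> fst d" "u = snd c p" by blast
  define r where "r = ref_chart A p"
  have r: "r \<in> A" "p \<in> fst r" using ref_chart[of p] by (auto simp: r_def)
  let ?S = "snd c ` (fst c \<inter> (fst d \<inter> fst r))" and ?T = "snd r ` (fst r \<inter> fst d)"
  have dr: "open (fst d \<inter> fst r)"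
    using is_chartD(1)[OF is_chart[OF d]] is_chartD(1)[OF is_chart[OF compatible[OF r(1)]]] by blast
  have S: "open ?S" by (rule chart_image_open[OF is_chart[OF c] dr])
  have T: "open ?T" using r d chart_image_open is_chartD(1) is_chart compatible by blast
  have 1: "smooth_on ?S (\<lambda>u. snd r (chart_inv c u))"
    using c r(1) unfolding compatible_chart_def by (blast intro: smooth_on_subset)
  have 2: "smooth_on ?T (\<lambda>u. snd d (chart_inv r u))"
    using d r(1) unfolding compatible_chart_def by blast
  have inv: "chart_inv c (snd c q) = q" if "q \<in> fst c" for q
    using is_chartD(3)[OF is_chart[OF c] that] .
  have inv': "chart_inv r (snd r q) = q" if "q \<in> fst r" for q
    using is_chartD(3)[OF is_chart[OF compatible[OF r(1)]] that] .
  have "smooth_on ?S (\<lambda>u. snd d (chart_inv r (snd r (chart_inv c u))))"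
    by (rule smooth_on_compose[OF S T _ 2 1]) (auto simp: inv)
  then have "smooth_on ?S (\<lambda>u. snd d (chart_inv c u))"
    by (rule smooth_on_cong[OF S, rotated]) (auto simp: inv inv')
  then show "\<exists>U. open U \<and> u \<in> U \<and> smooth_on U (\<lambda>u. snd d (chart_inv c u))"
    using S p r by blast
qed

lemma transition_open:
  "compatible_chart A c \<Longrightarrow> compatible_chart A d \<Longrightarrow> open (snd c ` (fst c \<inter> fst d))"
  using chart_image_open is_chartD(1) is_chart by blast

text \<open>The chain rule for the change from the reference chart of \<open>p\<close> to \<open>c\<close>.\<close>

lemma has_derivative_in_chart:
  fixes h :: "'a \<Rightarrow> 'r::real_normed_vector"
  assumes c: "compatible_chart A c" and p: "p \<in> fst c"
    and h: "((\<lambda>u. h (chart_inv c u)) has_derivative h') (at (snd c p))"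
  shows "tderiv A h p v = h' (tderiv A (snd c) p v)"
    and "((\<lambda>u. h (chart_inv (ref_chart A p) u)) has_derivative (\<lambda>v. h' (tderiv A (snd c) p v)))
      (at (snd (ref_chart A p) p))"
proof -
  define r where "r = ref_chart A p"
  have r: "r \<in> A" "p \<in> fst r" using ref_chart[of p] by (auto simp: r_def)
  let ?S = "snd r ` (fst r \<inter> fst c)"
  have S: "open ?S" "snd r p \<in> ?S"
    using transition_open[OF compatible[OF r(1)] c] r p by auto
  have inv: "chart_inv c (snd c q) = q" if "q \<in> fst c" for q
    using is_chartD(3)[OF is_chart[OF c] that] .
  have inv': "chart_inv r (snd r q) = q" if "q \<in> fst r" for q
    using is_chartD(3)[OF is_chart[OF compatible[OF r(1)]] that] .
  have "((\<lambda>u. snd c (chart_inv r u)) has_derivative tderiv A (snd c) p) (at (snd r p))"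
    using smooth_on_has_derivative[OF transition_smooth[OF compatible[OF r(1)] c] S(2)]
    by (simp add: tderiv_def r_def o_def)
  then have "((\<lambda>u. h (chart_inv c (snd c (chart_inv r u)))) has_derivative (\<lambda>v. h' (tderiv A (snd c) p v))) (at (snd r p))"
    by (rule has_derivative_compose) (use h inv' r in simp)
  then show *: "((\<lambda>u. h (chart_inv (ref_chart A p) u)) has_derivative (\<lambda>v. h' (tderiv A (snd c) p v)))
      (at (snd (ref_chart A p) p))"
    unfolding r_def[symmetric]
    by (rule has_derivative_transform_within_open[OF _ S]) (auto simp: inv inv')
  show "tderiv A h p v = h' (tderiv A (snd c) p v)"
    using fun_cong[OF frechet_derivative_at[OF *], of v] by (simp add: tderiv_def o_def)
qed

lemma tderiv_change:
  assumes c: "compatible_chart A c" and d: "compatible_chart A d" and p: "p \<in> fst c" "p \<in> fst d"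
  shows "tderiv A (snd d) p v =
    frechet_derivative (\<lambda>u. snd d (chart_inv c u)) (at (snd c p)) (tderiv A (snd c) p v)"
  by (rule has_derivative_in_chart(1)[OF c p(1) smooth_on_has_derivative[OF transition_smooth[OF c d]]])
    (use p in blast)

lemma tderiv_ref: "tderiv A (snd (ref_chart A p)) p v = v"
proof -
  define r where "r = ref_chart A p"
  have r: "r \<in> A" "p \<in> fst r" using ref_chart[of p] by (auto simp: r_def)
  note ch = is_chartD[OF is_chart[OF compatible[OF r(1)]]]
  have "((\<lambda>u. snd r (chart_inv r u)) has_derivative (\<lambda>v. v)) (at (snd r p))"
    by (rule has_derivative_transform_within_open[OF has_derivative_ident ch(2)])
      (use r ch(4) in auto)
  from fun_cong[OF frechet_derivative_at[OF this], of v] show ?thesis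
    by (simp add: tderiv_def r_def o_def)
qed

lemma tderiv_linear:
  assumes c: "compatible_chart A c" and p: "p \<in> fst c"
  shows "linear (tderiv A (snd c) p)"
proof -
  have "snd (ref_chart A p) p \<in> snd (ref_chart A p) ` (fst (ref_chart A p) \<inter> fst c)"
    using ref_chart[of p] p by blast
  from smooth_on_linear_derivative[OF transition_smooth[OF compatible[OF ref_chart(1)] c] this]
  show ?thesis by (simp add: tderiv_def o_def)
qed

text \<open>The coordinate change back to the reference chart provides a left inverse.\<close>

lemma tderiv_bij:
  assumes c: "compatible_chart A c" and p: "p \<in> fst c"
  shows "bij (tderiv A (snd c) p)"
proof -
  let ?r = "ref_chart A p"
  have 1: "frechet_derivative (\<lambda>u. snd ?r (chart_inv c u)) (at (snd c p)) (tderiv A (snd c) p v) = v" for v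
    using tderiv_change[OF c compatible[OF ref_chart(1)] p ref_chart(2), of v] tderiv_ref by simp
  have "inj (tderiv A (snd c) p)"
    by (rule inj_on_inverseI[of _ "frechet_derivative (\<lambda>u. snd ?r (chart_inv c u)) (at (snd c p))"]) (rule 1)
  then show ?thesis
    using linear_injective_imp_surjective[OF tderiv_linear[OF c p]] by (simp add: bij_def)
qed

lemma tderiv_coord_field [simp]:
  "compatible_chart A c \<Longrightarrow> p \<in> fst c \<Longrightarrow> tderiv A (snd c) p (coord_field A c w p) = w"
  unfolding coord_field_def using tderiv_bij by (simp add: bij_is_surj surj_f_inv_f)

lemma coord_field_tderiv [simp]:
  "compatible_chart A c \<Longrightarrow> p \<in> fst c \<Longrightarrow> coord_field A c (tderiv A (snd c) p v) p = v"
  unfolding coord_field_def using tderiv_bij by (simp add: bij_is_inj)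

lemma tderiv_inject:
  "compatible_chart A c \<Longrightarrow> p \<in> fst c \<Longrightarrow> tderiv A (snd c) p v = tderiv A (snd c) p w \<longleftrightarrow> v = w"
  using tderiv_bij bij_is_inj inj_eq by metis

lemma coord_field_linear:
  assumes "compatible_chart A c" "p \<in> fst c"
  shows "linear (\<lambda>w. coord_field A c w p)"
proof (rule linearI)
  note lin = tderiv_linear[OF assms]
  show "coord_field A c (v + w) p = coord_field A c v p + coord_field A c w p" for v w
    by (rule tderiv_inject[OF assms, THEN iffD1]) (simp add: assms linear_add[OF lin])
  show "coord_field A c (r *\<^sub>R v) p = r *\<^sub>R coord_field A c v p" for r v
    by (rule tderiv_inject[OF assms, THEN iffD1]) (simp add: assms linear_scale[OF lin])
qed

lemma extend_vec_at [simp]: "extend_vec A p w p = w"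
  using coord_field_tderiv[OF compatible[OF ref_chart(1)] ref_chart(2), of p w]
  unfolding extend_vec_def tderiv_ref .

subsection \<open>Smooth functions and vector fields in charts\<close>

lemma fun_smooth_in_chart:
  assumes f: "fun_smooth A U f" and U: "open U" and c: "compatible_chart A c"
  shows "smooth_on (snd c ` (fst c \<inter> U)) (\<lambda>u. f (chart_inv c u))"
proof (rule smooth_on_local)
  fix u assume "u \<in> snd c ` (fst c \<inter> U)"
  then obtain p where p: "p \<in> fst c" "p \<in> U" "u = snd c p" by blast
  define r where "r = ref_chart A p"
  have r: "r \<in> A" "p \<in> fst r" using ref_chart[of p] by (auto simp: r_def)
  note ch = is_chartD[OF is_chart[OF c]] and rh = is_chartD[OF is_chart[OF compatible[OF r(1)]]]
  let ?S = "snd c ` (fst c \<inter> (U \<inter> fst r))" and ?T = "snd r ` (fst r \<inter> U)"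
  have S: "open ?S" using U rh(1) chart_image_open[OF is_chart[OF c]] by blast
  have T: "open ?T" by (rule chart_image_open[OF is_chart[OF compatible[OF r(1)]] U])
  have 1: "smooth_on ?S (\<lambda>u. snd r (chart_inv c u))"
    using transition_smooth[OF c compatible[OF r(1)]] by (rule smooth_on_subset) blast
  have 2: "smooth_on ?T (\<lambda>u. f (chart_inv r u))"
    using f r(1) unfolding fun_smooth_def o_def by blast
  have "smooth_on ?S (\<lambda>u. f (chart_inv r (snd r (chart_inv c u))))"
    by (rule smooth_on_compose[OF S T _ 2 1]) (auto simp: ch(3))
  then have "smooth_on ?S (\<lambda>u. f (chart_inv c u))"
    by (rule smooth_on_cong[OF S, rotated]) (auto simp: ch(3) rh(3))
  then show "\<exists>V. open V \<and> u \<in> V \<and> smooth_on V (\<lambda>u. f (chart_inv c u))"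
    using S p r by blast
qed

text \<open>Smoothness in one chart carries over to all charts by the smoothness of the coordinate changes.\<close>

lemma fun_smooth_from_chart:
  assumes f: "smooth_on (snd c ` U) (\<lambda>u. f (chart_inv c u))" and U: "open U" "U \<subseteq> fst c"
    and c: "compatible_chart A c"
  shows "fun_smooth A U f"
  unfolding fun_smooth_def o_def
proof
  fix d assume d: "d \<in> A"
  note ch = is_chartD[OF is_chart[OF c]] and dh = is_chartD[OF is_chart[OF compatible[OF d]]]
  let ?S = "snd d ` (fst d \<inter> U)"
  have S: "open ?S" by (rule chart_image_open[OF is_chart[OF compatible[OF d]] U(1)])
  have T: "open (snd c ` U)" using chart_image_open[OF is_chart[OF c] U(1)] U(2) by (simp add: Int_absorb1)
  have 1: "smooth_on ?S (\<lambda>u. snd c (chart_inv d u))"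
    using transition_smooth[OF compatible[OF d] c] by (rule smooth_on_subset) (use U(2) in blast)
  have "smooth_on ?S (\<lambda>u. f (chart_inv c (snd c (chart_inv d u))))"
    by (rule smooth_on_compose[OF S T _ f 1]) (use U(2) in \<open>auto simp: dh(3)\<close>)
  then show "smooth_on ?S (\<lambda>u. f (chart_inv d u))"
    by (rule smooth_on_cong[OF S, rotated]) (use U(2) in \<open>auto simp: dh(3) ch(3) subset_iff\<close>)
qed

lemma fun_smooth_subset: "fun_smooth A U f \<Longrightarrow> V \<subseteq> U \<Longrightarrow> fun_smooth A V f"
  unfolding fun_smooth_def by (blast intro: smooth_on_subset)

lemma vfield_smooth_subset: "vfield_smooth A U X \<Longrightarrow> V \<subseteq> U \<Longrightarrow> vfield_smooth A V X"
  unfolding vfield_smooth_def by (blast intro: fun_smooth_subset)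

lemma tangent_comp_change:
  assumes c: "compatible_chart A c" and d: "compatible_chart A d" and u: "u \<in> snd c ` (fst c \<inter> fst d)"
  shows "tangent_comp A d X (snd d (chart_inv c u)) =
    frechet_derivative (\<lambda>u. snd d (chart_inv c u)) (at u) (tangent_comp A c X u)"
proof -
  obtain p where p: "p \<in> fst c" "p \<in> fst d" "u = snd c p" using u by blast
  show ?thesis
    using tderiv_change[OF c d p(1,2)] p is_chartD(3)[OF is_chart[OF c] p(1)] is_chartD(3)[OF is_chart[OF d] p(2)]
    by (simp add: tangent_comp_def)
qed

text \<open>The components in \<open>c\<close> arise from those in a chart of the atlas by the derivative of the coordinate
  change.\<close>

lemma vfield_smooth_in_chart:
  assumes X: "vfield_smooth A U X" and U: "open U" and c: "compatible_chart A c"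
  shows "smooth_on (snd c ` (fst c \<inter> U)) (tangent_comp A c X)"
proof (rule smooth_on_local)
  fix u assume "u \<in> snd c ` (fst c \<inter> U)"
  then obtain p where p: "p \<in> fst c" "p \<in> U" "u = snd c p" by blast
  define r where "r = ref_chart A p"
  have r: "r \<in> A" "p \<in> fst r" using ref_chart[of p] by (auto simp: r_def)
  have rc: "compatible_chart A r" using r by simp
  note ch = is_chartD[OF is_chart[OF c]] and rh = is_chartD[OF is_chart[OF rc]]
  let ?S = "snd c ` (fst c \<inter> (U \<inter> fst r))" and ?T = "snd r ` (fst r \<inter> (U \<inter> fst r))"
  have S: "open ?S" using U rh(1) chart_image_open[OF is_chart[OF c]] by blast
  have T: "open ?T" using U rh(1) chart_image_open[OF is_chart[OF rc]] by blast
  have R: "open (snd r ` (fst r \<inter> (fst c \<inter> U)))"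
    using U ch(1) chart_image_open[OF is_chart[OF rc]] by blast
  have 1: "smooth_on ?S (\<lambda>u. snd r (chart_inv c u))"
    using transition_smooth[OF c rc] by (rule smooth_on_subset) blast
  have "fun_smooth A (U \<inter> fst r) (\<lambda>p. tderiv A (snd r) p (X p))"
    using X r(1) unfolding vfield_smooth_def by blast
  then have "smooth_on ?T (tangent_comp A r X)"
    using fun_smooth_in_chart[OF _ _ rc] U rh(1) unfolding tangent_comp_def[abs_def] by blast
  then have 2: "smooth_on (snd r ` (fst r \<inter> (fst c \<inter> U))) (tangent_comp A r X)"
    by (rule smooth_on_subset) blast
  have 3: "smooth_on (snd r ` (fst r \<inter> (fst c \<inter> U)))
      (\<lambda>w. frechet_derivative (\<lambda>u. snd c (chart_inv r u)) (at w) (tangent_comp A r X w))"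
    by (rule smooth_on_derivative_apply[OF R _ 2])
      (rule smooth_on_subset[OF transition_smooth[OF rc c]], blast)
  have "smooth_on ?S (\<lambda>u. frechet_derivative (\<lambda>u. snd c (chart_inv r u)) (at (snd r (chart_inv c u)))
      (tangent_comp A r X (snd r (chart_inv c u))))"
    by (rule smooth_on_compose[OF S R _ 3 1]) (auto simp: ch(3))
  then have "smooth_on ?S (tangent_comp A c X)"
  proof (rule smooth_on_cong[OF S, rotated])
    fix w assume "w \<in> ?S"
    then obtain q where q: "q \<in> fst c" "q \<in> fst r" "w = snd c q" by blast
    show "frechet_derivative (\<lambda>u. snd c (chart_inv r u)) (at (snd r (chart_inv c w)))
      (tangent_comp A r X (snd r (chart_inv c w))) = tangent_comp A c X w"
      using tangent_comp_change[OF rc c, of "snd r q" X] q ch(3) rh(3) by simp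
  qed
  then show "\<exists>V. open V \<and> u \<in> V \<and> smooth_on V (tangent_comp A c X)"
    using S p r by blast
qed

lemma vfield_smooth_from_chart:
  assumes X: "smooth_on (snd c ` U) (tangent_comp A c X)" and U: "open U" "U \<subseteq> fst c"
    and c: "compatible_chart A c"
  shows "vfield_smooth A U X"
  unfolding vfield_smooth_def
proof
  fix d assume d: "d \<in> A"
  have dc: "compatible_chart A d" using d by simp
  note ch = is_chartD[OF is_chart[OF c]] and dh = is_chartD[OF is_chart[OF dc]]
  have oU: "open (U \<inter> fst d)" using U(1) dh(1) by blast
  let ?S = "snd c ` (U \<inter> fst d)"
  have S: "open ?S"
    using chart_image_open[OF is_chart[OF c] oU] U(2) by (simp add: Int_absorb1 le_infI1)
  have "smooth_on ?S (\<lambda>u. frechet_derivative (\<lambda>u. snd d (chart_inv c u)) (at u) (tangent_comp A c X u))"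
    by (rule smooth_on_derivative_apply[OF S])
      (rule smooth_on_subset[OF transition_smooth[OF c dc]] smooth_on_subset[OF X], use U(2) in blast)+
  then have "smooth_on ?S (\<lambda>u. tderiv A (snd d) (chart_inv c u) (X (chart_inv c u)))"
  proof (rule smooth_on_cong[OF S, rotated])
    fix u assume "u \<in> ?S"
    then obtain q where q: "q \<in> fst c" "q \<in> fst d" "u = snd c q" using U(2) by blast
    then show "frechet_derivative (\<lambda>u. snd d (chart_inv c u)) (at u) (tangent_comp A c X u) =
        tderiv A (snd d) (chart_inv c u) (X (chart_inv c u))"
      using tderiv_change[OF c dc q(1,2)] ch(3)[OF q(1)] by (simp add: tangent_comp_def)
  qed
  then show "fun_smooth A (U \<inter> fst d) (\<lambda>p. tderiv A (snd d) p (X p))"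
    by (rule fun_smooth_from_chart[OF _ oU _ c]) (use U(2) in blast)
qed

lemma coord_field_smooth:
  assumes c: "compatible_chart A c"
  shows "vfield_smooth A (fst c) (coord_field A c w)"
proof (rule vfield_smooth_from_chart[OF _ _ subset_refl c])
  note ch = is_chartD[OF is_chart[OF c]]
  show "smooth_on (snd c ` fst c) (tangent_comp A c (coord_field A c w))"
    by (rule smooth_on_cong[OF ch(2) _ smooth_on_const[of _ w]]) (auto simp: tangent_comp_def ch(3) c)
  show "open (fst c)" by (rule ch(1))
qed

lemma extend_vec_smooth: "vfield_smooth A (fst (ref_chart A p)) (extend_vec A p w)"
  unfolding extend_vec_def by (rule coord_field_smooth) (simp add: ref_chart)

text \<open>The bracket is defined by the reference chart of the point.  The coordinate change to another chart
  relates the components of the fields, hence also the brackets of the components.\<close>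

lemma lie_bracket_in_chart:
  assumes c: "compatible_chart A c" and p: "p \<in> fst c" "p \<in> U" and U: "open U"
    and X: "vfield_smooth A U X" and Y: "vfield_smooth A U Y"
  shows "tderiv A (snd c) p (lie_bracket A X Y p) =
    frechet_derivative (tangent_comp A c Y) (at (snd c p)) (tangent_comp A c X (snd c p)) -
    frechet_derivative (tangent_comp A c X) (at (snd c p)) (tangent_comp A c Y (snd c p))"
proof -
  define r where "r = ref_chart A p"
  have r: "r \<in> A" "p \<in> fst r" using ref_chart[of p] by (auto simp: r_def)
  have rc: "compatible_chart A r" using r by simp
  note ch = is_chartD[OF is_chart[OF c]] and rh = is_chartD[OF is_chart[OF rc]]
  have vr: "tangent_comp A r Z (snd r p) = Z p" for Z
    using rh(3)[OF r(2)] tderiv_ref[of p] by (simp add: tangent_comp_def r_def)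
  have vc: "tangent_comp A c Z (snd c p) = tderiv A (snd c) p (Z p)" for Z
    using ch(3)[OF p(1)] by (simp add: tangent_comp_def)
  have d: "(tangent_comp A e Z has_derivative frechet_derivative (tangent_comp A e Z) (at (snd e p))) (at (snd e p))"
    if "vfield_smooth A U Z" "compatible_chart A e" "p \<in> fst e" for Z e
    by (rule smooth_on_has_derivative[OF vfield_smooth_in_chart[OF that(1) U that(2)]])
      (use that p in blast)
  let ?S = "snd r ` (fst r \<inter> fst c)" and ?F = "\<lambda>u. snd c (chart_inv r u)"
  have F: "?F (snd r p) = snd c p" using rh(3)[OF r(2)] by simp
  have D: "frechet_derivative ?F (at (snd r p)) v = tderiv A (snd c) p v" for v
    by (simp add: tderiv_def r_def o_def)
  have "frechet_derivative (tangent_comp A c Y) (at (snd c p)) (tangent_comp A c X (?F (snd r p))) -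
    frechet_derivative (tangent_comp A c X) (at (snd c p)) (tangent_comp A c Y (?F (snd r p))) =
    frechet_derivative ?F (at (snd r p)) (
      frechet_derivative (tangent_comp A r Y) (at (snd r p)) (tangent_comp A r X (snd r p)) -
      frechet_derivative (tangent_comp A r X) (at (snd r p)) (tangent_comp A r Y (snd r p)))"
  proof (rule euclidean_bracket_related[OF transition_smooth[OF rc c] transition_open[OF rc c], where
        \<xi> = "tangent_comp A r X" and \<eta> = "tangent_comp A r Y" and \<Xi> = "tangent_comp A c X" and H = "tangent_comp A c Y"])
    show "snd r p \<in> ?S" using r p by blast
    show "(tangent_comp A r X has_derivative frechet_derivative (tangent_comp A r X) (at (snd r p))) (at (snd r p))"
      "(tangent_comp A r Y has_derivative frechet_derivative (tangent_comp A r Y) (at (snd r p))) (at (snd r p))"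
      using d[OF X rc r(2)] d[OF Y rc r(2)] by auto
    show "(tangent_comp A c X has_derivative frechet_derivative (tangent_comp A c X) (at (snd c p))) (at (?F (snd r p)))"
      "(tangent_comp A c Y has_derivative frechet_derivative (tangent_comp A c Y) (at (snd c p))) (at (?F (snd r p)))"
      unfolding F using d[OF X c p(1)] d[OF Y c p(1)] by auto
  qed (rule tangent_comp_change[OF rc c], assumption)+
  moreover have "lie_bracket A X Y p =
      frechet_derivative (tangent_comp A r Y) (at (snd r p)) (tangent_comp A r X (snd r p)) -
      frechet_derivative (tangent_comp A r X) (at (snd r p)) (tangent_comp A r Y (snd r p))"
    unfolding vr by (simp add: lie_bracket_def Let_def tderiv_def[of A "\<lambda>q. tderiv A (snd r) q (X q)"]
        tderiv_def[of A "\<lambda>q. tderiv A (snd r) q (Y q)"] r_def[symmetric]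
        o_def tangent_comp_def[abs_def])
  ultimately show ?thesis
    unfolding F D by simp
qed

end

subsection \<open>Maps between manifolds\<close>

locale smooth_manifold_map = M: smooth_manifold B + N: smooth_manifold A
  for B :: "('b::topological_space, 'f::euclidean_space) chart set"
    and A :: "('a::topological_space, 'e::euclidean_space) chart set" +
  fixes f :: "'b \<Rightarrow> 'a"
  assumes smooth_map: "smooth_map B A f"
begin

lemma open_vimage_map: "open U \<Longrightarrow> open (f -` U)"
  using smooth_map open_vimage unfolding smooth_map_def by blast

lemma map_in_charts_open:
  assumes "c \<in> B" "d \<in> A"
  shows "open (snd c ` (fst c \<inter> f -` fst d))"
  by (rule chart_image_open[OF M.is_chart open_vimage_map[OF is_chartD(1)[OF N.is_chart]]]) (simp_all add: assms)

lemma map_in_charts_smooth: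
  assumes c: "c \<in> B" and d: "d \<in> A"
  shows "smooth_on (snd c ` (fst c \<inter> f -` fst d)) (\<lambda>u. snd d (f (chart_inv c u)))"
  using smooth_map c d unfolding smooth_map_def fun_smooth_def o_def by blast

lemma differential_in_charts:
  assumes c: "c \<in> B" "x \<in> fst c" and d: "d \<in> A" "f x \<in> fst d"
  shows "tderiv A (snd d) (f x) (differential B A f x v) =
    frechet_derivative (\<lambda>u. snd d (f (chart_inv c u))) (at (snd c x)) (tderiv B (snd c) x v)"
proof -
  let ?r = "ref_chart A (f x)"
  have r: "?r \<in> A" "f x \<in> fst ?r" by (rule N.ref_chart)+
  have rc: "compatible_chart A ?r" "compatible_chart A d" "compatible_chart B c" using r c d by auto
  note ch = is_chartD[OF M.is_chart[OF rc(3)]] and rh = is_chartD[OF N.is_chart[OF rc(1)]]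
  have "snd c x \<in> snd c ` (fst c \<inter> f -` fst e)" if "f x \<in> fst e" for e :: "('a, 'e) chart"
    using c that by blast
  then have der: "((\<lambda>u. snd e (f (chart_inv c u))) has_derivative
      frechet_derivative (\<lambda>u. snd e (f (chart_inv c u))) (at (snd c x))) (at (snd c x))"
    if "e \<in> A" "f x \<in> fst e" for e
    using smooth_on_has_derivative[OF map_in_charts_smooth[OF c(1)]] that by blast
  have 1: "differential B A f x v =
      frechet_derivative (\<lambda>u. snd ?r (f (chart_inv c u))) (at (snd c x)) (tderiv B (snd c) x v)"
    unfolding differential_def o_def
    by (rule M.has_derivative_in_chart(1)[OF rc(3) c(2) der[OF r]])
  have tr: "((\<lambda>u. snd d (chart_inv ?r u)) has_derivative
      frechet_derivative (\<lambda>u. snd d (chart_inv ?r u)) (at (snd ?r (f x)))) (at (snd ?r (f x)))"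
    by (rule smooth_on_has_derivative[OF N.transition_smooth[OF rc(1,2)]]) (use r d in blast)
  have "((\<lambda>u. snd d (chart_inv ?r (snd ?r (f (chart_inv c u))))) has_derivative
      (\<lambda>v. frechet_derivative (\<lambda>u. snd d (chart_inv ?r u)) (at (snd ?r (f x)))
        (frechet_derivative (\<lambda>u. snd ?r (f (chart_inv c u))) (at (snd c x)) v))) (at (snd c x))"
    by (rule has_derivative_compose[OF der[OF r]]) (use tr ch(3)[OF c(2)] in simp)
  then have "((\<lambda>u. snd d (f (chart_inv c u))) has_derivative
      (\<lambda>v. frechet_derivative (\<lambda>u. snd d (chart_inv ?r u)) (at (snd ?r (f x)))
        (frechet_derivative (\<lambda>u. snd ?r (f (chart_inv c u))) (at (snd c x)) v))) (at (snd c x))"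
    by (rule has_derivative_transform_within_open[OF _ map_in_charts_open[OF c(1) r(1)]])
      (use c r in \<open>auto simp: ch(3) rh(3)\<close>)
  from fun_cong[OF frechet_derivative_at[OF this], of "tderiv B (snd c) x v"]
  show ?thesis
    using N.tderiv_change[OF rc(1,2) r(2) d(2), of "differential B A f x v"] N.tderiv_ref[of "f x"] 1 by simp
qed

lemma differential_linear: "linear (differential B A f x)"
proof -
  let ?c = "ref_chart B x" and ?d = "ref_chart A (f x)"
  have 1: "differential B A f x v = frechet_derivative (\<lambda>u. snd ?d (f (chart_inv ?c u))) (at (snd ?c x)) v" for v
    using differential_in_charts[OF M.ref_chart N.ref_chart, of x v] by (simp add: M.tderiv_ref N.tderiv_ref)
  have "snd ?c x \<in> snd ?c ` (fst ?c \<inter> f -` fst ?d)"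
    using M.ref_chart[of x] N.ref_chart[of "f x"] by blast
  from smooth_on_linear_derivative[OF map_in_charts_smooth[OF M.ref_chart(1) N.ref_chart(1)] this]
  show ?thesis unfolding 1[abs_def] .
qed

text \<open>The coordinate expression of the map relates the components of the fields.\<close>

lemma lie_bracket_related:
  assumes V: "open V" "x \<in> V" and W: "open W" "f x \<in> W"
    and X: "vfield_smooth B V X" "vfield_smooth B V Y"
    and Z: "vfield_smooth A W X'" "vfield_smooth A W Y'"
    and rel: "\<And>y. y \<in> V \<Longrightarrow> X' (f y) = differential B A f y (X y)"
      "\<And>y. y \<in> V \<Longrightarrow> Y' (f y) = differential B A f y (Y y)"
  shows "lie_bracket A X' Y' (f x) = differential B A f x (lie_bracket B X Y x)"
proof -
  define c d where "c = ref_chart B x" and "d = ref_chart A (f x)"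
  have c: "c \<in> B" "x \<in> fst c" and d: "d \<in> A" "f x \<in> fst d"
    using M.ref_chart[of x] N.ref_chart[of "f x"] by (auto simp: c_def d_def)
  have cc: "compatible_chart B c" "compatible_chart A d" using c d by auto
  note ch = is_chartD[OF M.is_chart[OF cc(1)]] and dh = is_chartD[OF N.is_chart[OF cc(2)]]
  let ?F = "\<lambda>u. snd d (f (chart_inv c u))"
  let ?S = "snd c ` (fst c \<inter> (f -` fst d \<inter> V))"
  have S: "open ?S"
    by (rule chart_image_open[OF M.is_chart[OF cc(1)]]) (intro open_Int open_vimage_map V dh(1))
  have F: "smooth_on ?S ?F"
    using map_in_charts_smooth[OF c(1) d(1)] by (rule smooth_on_subset) blast
  have Fx: "?F (snd c x) = snd d (f x)" using ch(3)[OF c(2)] by simp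
  have dM: "(tangent_comp B c Z has_derivative frechet_derivative (tangent_comp B c Z) (at (snd c x))) (at (snd c x))"
    if "vfield_smooth B V Z" for Z
    by (rule smooth_on_has_derivative[OF M.vfield_smooth_in_chart[OF that V(1) cc(1)]]) (use c V in blast)
  have dN: "(tangent_comp A d Z has_derivative frechet_derivative (tangent_comp A d Z) (at (snd d (f x)))) (at (snd d (f x)))"
    if "vfield_smooth A W Z" for Z
    by (rule smooth_on_has_derivative[OF N.vfield_smooth_in_chart[OF that W(1) cc(2)]]) (use d W in blast)
  have rl: "tangent_comp A d Z' (?F u) = frechet_derivative ?F (at u) (tangent_comp B c Z u)"
    if u: "u \<in> ?S" and r: "\<And>y. y \<in> V \<Longrightarrow> Z' (f y) = differential B A f y (Z y)" for Z Z' u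
  proof -
    obtain q where q: "q \<in> fst c" "f q \<in> fst d" "q \<in> V" "u = snd c q" using u by blast
    show ?thesis
      using differential_in_charts[OF c(1) q(1) d(1) q(2)] r[OF q(3)] q ch(3)[OF q(1)] dh(3)[OF q(2)]
      by (simp add: tangent_comp_def)
  qed
  have "frechet_derivative (tangent_comp A d Y') (at (snd d (f x))) (tangent_comp A d X' (?F (snd c x))) -
    frechet_derivative (tangent_comp A d X') (at (snd d (f x))) (tangent_comp A d Y' (?F (snd c x))) =
    frechet_derivative ?F (at (snd c x)) (
      frechet_derivative (tangent_comp B c Y) (at (snd c x)) (tangent_comp B c X (snd c x)) -
      frechet_derivative (tangent_comp B c X) (at (snd c x)) (tangent_comp B c Y (snd c x)))"
  proof (rule euclidean_bracket_related[OF F S, where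
        \<xi> = "tangent_comp B c X" and \<eta> = "tangent_comp B c Y" and \<Xi> = "tangent_comp A d X'" and H = "tangent_comp A d Y'"])
    show "snd c x \<in> ?S" using c d V by blast
    show "(tangent_comp B c X has_derivative frechet_derivative (tangent_comp B c X) (at (snd c x))) (at (snd c x))"
      "(tangent_comp B c Y has_derivative frechet_derivative (tangent_comp B c Y) (at (snd c x))) (at (snd c x))"
      using dM X by auto
    show "(tangent_comp A d X' has_derivative frechet_derivative (tangent_comp A d X') (at (snd d (f x)))) (at (?F (snd c x)))"
      "(tangent_comp A d Y' has_derivative frechet_derivative (tangent_comp A d Y') (at (snd d (f x)))) (at (?F (snd c x)))"
      unfolding Fx using dN Z by auto
  qed (rule rl, assumption, erule rel)+
  then have "tderiv A (snd d) (f x) (lie_bracket A X' Y' (f x)) =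
      frechet_derivative ?F (at (snd c x)) (tderiv B (snd c) x (lie_bracket B X Y x))"
    unfolding Fx N.lie_bracket_in_chart[OF cc(2) d(2) W(2,1) Z] M.lie_bracket_in_chart[OF cc(1) c(2) V(2,1) X] .
  also have "\<dots> = tderiv A (snd d) (f x) (differential B A f x (lie_bracket B X Y x))"
    by (rule differential_in_charts[OF c d, symmetric])
  finally show ?thesis
    by (simp add: N.tderiv_inject[OF cc(2) d(2)])
qed

end

section \<open>Connections\<close>

context smooth_manifold
begin

lemma chart_domain_open: "c \<in> A \<Longrightarrow> open (fst c)"
  by (rule is_chartD(1)[OF is_chart[OF compatible]])

lemma fun_smooth_cong:
  assumes "open U" "\<And>q. q \<in> U \<Longrightarrow> f q = h q" "fun_smooth A U f"
  shows "fun_smooth A U h"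
  unfolding fun_smooth_def o_def
proof
  fix c assume c: "c \<in> A"
  show "smooth_on (snd c ` (fst c \<inter> U)) (\<lambda>u. h (chart_inv c u))"
    by (rule smooth_on_cong[OF chart_image_open[OF is_chart[OF compatible[OF c]] assms(1)]
          _ fun_smooth_in_chart[OF assms(3,1) compatible[OF c]]])
      (auto simp: is_chartD(3)[OF is_chart[OF compatible[OF c]]] assms(2))
qed

lemma vfield_smooth_cong:
  assumes "open U" "\<And>q. q \<in> U \<Longrightarrow> X q = Y q" "vfield_smooth A U X"
  shows "vfield_smooth A U Y"
  unfolding vfield_smooth_def
proof
  fix c assume c: "c \<in> A"
  have "open (U \<inter> fst c)" using assms(1) chart_domain_open[OF c] by auto
  then show "fun_smooth A (U \<inter> fst c) (\<lambda>p. tderiv A (snd c) p (Y p))"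
    by (rule fun_smooth_cong[where f = "\<lambda>p. tderiv A (snd c) p (X p)"])
      (use assms(2,3) c in \<open>auto simp: vfield_smooth_def\<close>)
qed

lemma fun_smooth_lift:
  assumes U: "open U" and "fun_smooth A U f" "fun_smooth A U h"
    and op: "\<And>(S :: 'e set) f' h'. open S \<Longrightarrow> smooth_on S f' \<Longrightarrow> smooth_on S h' \<Longrightarrow> smooth_on S (\<lambda>u. F (f' u) (h' u))"
  shows "fun_smooth A U (\<lambda>q. F (f q) (h q))"
  unfolding fun_smooth_def o_def
proof
  fix c assume c: "c \<in> A"
  show "smooth_on (snd c ` (fst c \<inter> U)) (\<lambda>u. F (f (chart_inv c u)) (h (chart_inv c u)))"
    by (rule op[OF chart_image_open[OF is_chart[OF compatible[OF c]] U]
          fun_smooth_in_chart[OF assms(2) U compatible[OF c]]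
          fun_smooth_in_chart[OF assms(3) U compatible[OF c]]])
qed

lemma fun_smooth_const [simp]: "fun_smooth A U (\<lambda>q. c)"
  by (simp add: fun_smooth_def o_def)

lemma fun_smooth_add:
  "open U \<Longrightarrow> fun_smooth A U f \<Longrightarrow> fun_smooth A U h \<Longrightarrow> fun_smooth A U (\<lambda>q. f q + h q)"
  by (rule fun_smooth_lift[OF _ _ _ smooth_on_add])

lemma fun_smooth_scaleR:
  "open U \<Longrightarrow> fun_smooth A U f \<Longrightarrow> fun_smooth A U h \<Longrightarrow> fun_smooth A U (\<lambda>q. f q *\<^sub>R h q)"
  by (rule fun_smooth_lift[OF _ _ _ smooth_on_scaleR])

lemma fun_smooth_inner: "open U \<Longrightarrow> fun_smooth A U f \<Longrightarrow> fun_smooth A U (\<lambda>q. f q \<bullet> b)"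
  by (rule fun_smooth_lift[where F = "\<lambda>x y. x \<bullet> b"]) (assumption, assumption, assumption, rule smooth_on_inner)

lemma fun_smooth_mult:
  fixes f h :: "'a \<Rightarrow> real"
  shows "open U \<Longrightarrow> fun_smooth A U f \<Longrightarrow> fun_smooth A U h \<Longrightarrow> fun_smooth A U (\<lambda>q. f q * h q)"
  by (rule fun_smooth_lift[OF _ _ _ smooth_on_mult])

lemma fun_smooth_divide:
  fixes f h :: "'a \<Rightarrow> real"
  assumes "open U" "fun_smooth A U f" "fun_smooth A U h" "\<And>q. q \<in> U \<Longrightarrow> h q \<noteq> 0"
  shows "fun_smooth A U (\<lambda>q. f q / h q)"
  unfolding fun_smooth_def o_def
proof
  fix c assume c: "c \<in> A"
  note ch = is_chart[OF compatible[OF c]]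
  show "smooth_on (snd c ` (fst c \<inter> U)) (\<lambda>u. f (chart_inv c u) / h (chart_inv c u))"
    by (rule smooth_on_divide[OF chart_image_open[OF ch assms(1)]
          fun_smooth_in_chart[OF assms(2,1) compatible[OF c]]
          fun_smooth_in_chart[OF assms(3,1) compatible[OF c]]])
      (use assms(4) is_chartD(3)[OF ch] in auto)
qed

lemma fun_smooth_sqrt:
  assumes "open U" "fun_smooth A U f" "\<And>q. q \<in> U \<Longrightarrow> f q > 0"
  shows "fun_smooth A U (\<lambda>q. sqrt (f q))"
  unfolding fun_smooth_def o_def
proof
  fix c assume c: "c \<in> A"
  note ch = is_chart[OF compatible[OF c]]
  show "smooth_on (snd c ` (fst c \<inter> U)) (\<lambda>u. sqrt (f (chart_inv c u)))"
    by (rule smooth_on_sqrt[OF chart_image_open[OF ch assms(1)]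
          fun_smooth_in_chart[OF assms(2,1) compatible[OF c]]])
      (use assms(3) is_chartD(3)[OF ch] in auto)
qed

lemma vfield_smooth_chart: "c \<in> A \<Longrightarrow> vfield_smooth A U X \<Longrightarrow> fun_smooth A (U \<inter> fst c) (\<lambda>p. tderiv A (snd c) p (X p))"
  by (simp add: vfield_smooth_def)

lemma vfield_smooth_add:
  assumes U: "open U" and X: "vfield_smooth A U X" and Y: "vfield_smooth A U Y"
  shows "vfield_smooth A U (\<lambda>q. X q + Y q)"
  unfolding vfield_smooth_def
proof
  fix c assume c: "c \<in> A"
  have o: "open (U \<inter> fst c)" using U chart_domain_open[OF c] by auto
  show "fun_smooth A (U \<inter> fst c) (\<lambda>p. tderiv A (snd c) p (X p + Y p))"
    by (rule fun_smooth_cong[OF o _ fun_smooth_add[OF o vfield_smooth_chart[OF c X] vfield_smooth_chart[OF c Y]]])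
      (use c in \<open>simp add: linear_add[OF tderiv_linear]\<close>)
qed

lemma vfield_smooth_scaleR:
  assumes U: "open U" and f: "fun_smooth A U f" and X: "vfield_smooth A U X"
  shows "vfield_smooth A U (\<lambda>q. f q *\<^sub>R X q)"
  unfolding vfield_smooth_def
proof
  fix c assume c: "c \<in> A"
  have o: "open (U \<inter> fst c)" using U chart_domain_open[OF c] by auto
  show "fun_smooth A (U \<inter> fst c) (\<lambda>p. tderiv A (snd c) p (f p *\<^sub>R X p))"
    by (rule fun_smooth_cong[OF o _ fun_smooth_scaleR[OF o fun_smooth_subset[OF f] vfield_smooth_chart[OF c X]]])
      (use c in \<open>auto simp add: linear_scale[OF tderiv_linear]\<close>)
qed

lemma vfield_smooth_zero: "vfield_smooth A U (\<lambda>q. 0)"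
proof (rule vfield_smooth_subset[of UNIV])
  show "vfield_smooth A UNIV (\<lambda>q. 0)"
    unfolding vfield_smooth_def
  proof
    fix c assume c: "c \<in> A"
    have o: "open (UNIV \<inter> fst c)" using chart_domain_open[OF c] by auto
    show "fun_smooth A (UNIV \<inter> fst c) (\<lambda>p. tderiv A (snd c) p 0)"
      by (rule fun_smooth_cong[OF o _ fun_smooth_const[of _ 0]]) (use c in \<open>simp add: linear_0[OF tderiv_linear]\<close>)
  qed
qed simp

lemma vfield_smooth_sum:
  assumes "open U" "\<And>i. i \<in> I \<Longrightarrow> vfield_smooth A U (X i)"
  shows "vfield_smooth A U (\<lambda>q. \<Sum>i\<in>I. X i q)"
  using assms(2)
proof (induction I rule: infinite_finite_induct)
  case (insert i I)
  then show ?case using vfield_smooth_add[OF assms(1), of "X i"] by simp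
qed (simp_all add: vfield_smooth_zero)

lemma vfield_smooth_minus:
  "open U \<Longrightarrow> vfield_smooth A U X \<Longrightarrow> vfield_smooth A U (\<lambda>q. - X q)"
  using vfield_smooth_scaleR[OF _ fun_smooth_const[of U "-1 :: real"], of X] by simp

text \<open>Together with the converse below this characterises smooth fields of endomorphisms by their action on
  vector fields, which makes their closure properties immediate.\<close>

lemma endo_smooth_apply:
  assumes K: "endo_smooth A U K" and V: "open V" "V \<subseteq> U" and W: "vfield_smooth A V W"
  shows "vfield_smooth A V (\<lambda>q. K q (W q))"
  unfolding vfield_smooth_def
proof
  fix c assume c: "c \<in> A"
  note cc = compatible[OF c]
  note ch = is_chartD[OF is_chart[OF cc]]
  have o: "open (V \<inter> fst c)" using V ch(1) by auto
  let ?S = "snd c ` (V \<inter> fst c)"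
  have S: "open ?S" using chart_image_open[OF is_chart[OF cc] o] by (simp add: Int_ac)
  let ?M = "\<lambda>u w. tderiv A (snd c) (chart_inv c u) (K (chart_inv c u) (coord_field A c w (chart_inv c u)))"
  have "smooth_on ?S (\<lambda>u. ?M u (tangent_comp A c W u))"
  proof (rule smooth_on_apply[OF S, where M = ?M and f = "tangent_comp A c W"])
    show "linear (?M u)" if u: "u \<in> ?S" for u
    proof -
      have q: "chart_inv c u \<in> fst c" using u ch(3) by auto
      show ?thesis
        using linear_compose[OF linear_compose[OF coord_field_linear[OF cc q] bounded_linear.linear[OF blinfun.bounded_linear_right]] tderiv_linear[OF cc q], of "K (chart_inv c u)"]
        by (simp add: o_def)
    qed
    show "smooth_on ?S (\<lambda>u. ?M u w)" for w
    proof -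
      have "smooth_on (snd c ` (fst c \<inter> (U \<inter> fst c))) (\<lambda>u. ?M u w)"
        using K c unfolding endo_smooth_def endo_smooth_along_def fun_smooth_def o_def by auto
      then show ?thesis by (rule smooth_on_subset) (use V(2) in blast)
    qed
    show "smooth_on ?S (tangent_comp A c W)"
      using vfield_smooth_in_chart[OF W V(1) cc] by (simp add: Int_commute)
  qed
  then have "smooth_on ?S (\<lambda>u. tderiv A (snd c) (chart_inv c u) (K (chart_inv c u) (W (chart_inv c u))))"
    by (rule smooth_on_cong[OF S, rotated]) (auto simp: tangent_comp_def ch(3) cc)
  then show "fun_smooth A (V \<inter> fst c) (\<lambda>q. tderiv A (snd c) q (K q (W q)))"
    by (rule fun_smooth_from_chart[OF _ o _ cc]) blast
qed

lemma endo_smoothI: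
  fixes K :: "'a \<Rightarrow> 'e \<Rightarrow>\<^sub>L 'e"
  assumes U: "open U"
    and K: "\<And>V W. open V \<Longrightarrow> V \<subseteq> U \<Longrightarrow> vfield_smooth A V W \<Longrightarrow> vfield_smooth A V (\<lambda>q. K q (W q))"
  shows "endo_smooth A U K"
  unfolding endo_smooth_def endo_smooth_along_def
proof (intro ballI allI)
  fix c w assume c: "c \<in> A"
  have o: "open (U \<inter> fst c)" using U chart_domain_open[OF c] by auto
  have "vfield_smooth A (U \<inter> fst c) (\<lambda>q. K q (coord_field A c w q))"
    by (rule K[OF o]) (use c vfield_smooth_subset[OF coord_field_smooth[OF compatible[OF c]]] in auto)
  from vfield_smooth_chart[OF c this]
  show "fun_smooth A (U \<inter> (\<lambda>p. p) -` fst c) (\<lambda>x. tderiv A (snd c) x (K x (coord_field A c w x)))"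
    by (simp add: Int_ac)
qed

lemma endo_smooth_subset: "endo_smooth A U K \<Longrightarrow> open V \<Longrightarrow> V \<subseteq> U \<Longrightarrow> endo_smooth A V K"
  by (rule endo_smoothI) (use endo_smooth_apply in blast)+

lemma endo_smooth_compose:
  assumes "open U" "endo_smooth A U K" "endo_smooth A U L"
  shows "endo_smooth A U (\<lambda>q. K q o\<^sub>L L q)"
  by (rule endo_smoothI[OF assms(1)])
    (simp add: endo_smooth_apply[OF assms(2)] endo_smooth_apply[OF assms(3)])

lemma endo_smooth_add:
  assumes "open U" "endo_smooth A U K" "endo_smooth A U L"
  shows "endo_smooth A U (\<lambda>q. K q + L q)"
  by (rule endo_smoothI[OF assms(1)])
    (simp add: blinfun.add_left vfield_smooth_add endo_smooth_apply[OF assms(2)] endo_smooth_apply[OF assms(3)])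

lemma endo_smooth_scaleR:
  assumes "open U" "fun_smooth A U h" "endo_smooth A U K"
  shows "endo_smooth A U (\<lambda>q. h q *\<^sub>R K q)"
  by (rule endo_smoothI[OF assms(1)])
    (simp add: blinfun.scaleR_left vfield_smooth_scaleR endo_smooth_apply[OF assms(3)] fun_smooth_subset[OF assms(2)])

lemma endo_smooth_minus: "open U \<Longrightarrow> endo_smooth A U K \<Longrightarrow> endo_smooth A U (\<lambda>q. - K q)"
  using endo_smooth_scaleR[OF _ fun_smooth_const[of U "-1 :: real"], of K] by simp

lemma endo_smooth_const_id: "open U \<Longrightarrow> endo_smooth A U (\<lambda>q. c *\<^sub>R id_blinfun)"
  by (rule endo_smoothI) (simp_all add: blinfun.scaleR_left vfield_smooth_scaleR)

lemma tderiv_locally_const: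
  assumes U: "open U" "p \<in> U" and h: "\<And>q. q \<in> U \<Longrightarrow> h q = c"
  shows "tderiv A h p v = 0"
proof -
  define r where "r = ref_chart A p"
  have r: "r \<in> A" "p \<in> fst r" using ref_chart[of p] by (auto simp: r_def)
  note rc = compatible[OF r(1)]
  have S: "open (snd r ` (fst r \<inter> U))" by (rule chart_image_open[OF is_chart[OF rc] U(1)])
  have "((\<lambda>u. h (chart_inv r u)) has_derivative (\<lambda>v. 0)) (at (snd r p))"
    by (rule has_derivative_transform_within_open[OF has_derivative_const[of c] S])
      (use r U h is_chartD(3)[OF is_chart[OF rc]] in auto)
  from has_derivative_in_chart(1)[OF rc r(2) this] show ?thesis by simp
qed

end

locale affine_manifold = smooth_manifold A
  for A :: "('a::topological_space, 'e::euclidean_space) chart set" +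
  fixes nabla :: "('a, 'e) connection"
  assumes affine: "affine_connection A nabla"
begin

lemmas affine_rules = affine[unfolded affine_connection_def, rule_format]

lemma nabla_linear:
  assumes "open U" "vfield_smooth A U Y" "p \<in> U"
  shows "linear (\<lambda>v. nabla p v Y)"
  using conjunct1[OF affine_rules[OF assms(1,2)]] assms(3) by (rule bspec)

lemma nabla_add:
  assumes "open U" "vfield_smooth A U Y" "vfield_smooth A U Z" "p \<in> U"
  shows "nabla p v (\<lambda>q. Y q + Z q) = nabla p v Y + nabla p v Z"
  using conjunct1[OF conjunct2[OF affine_rules[OF assms(1,2)]], rule_format, OF assms(3,4)] .

lemma nabla_scaleR:
  assumes "open U" "vfield_smooth A U Y" "fun_smooth A U f" "p \<in> U"
  shows "nabla p v (\<lambda>q. f q *\<^sub>R Y q) = tderiv A f p v *\<^sub>R Y p + f p *\<^sub>R nabla p v Y"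
  using conjunct1[OF conjunct2[OF conjunct2[OF affine_rules[OF assms(1,2)]]], rule_format, OF assms(3,4)] .

text \<open>Multiplication with the indicator function of \<open>U\<close>, which is smooth on \<open>U\<close> with derivative zero, leaves
  the covariant derivative at \<open>p\<close> unchanged and makes the two fields equal everywhere.\<close>

lemma nabla_local:
  assumes U: "open U" "p \<in> U" and Y: "vfield_smooth A U Y" and eq: "\<And>q. q \<in> U \<Longrightarrow> Y q = Z q"
  shows "nabla p v Y = nabla p v Z"
proof -
  let ?h = "\<lambda>q. if q \<in> U then 1 else 0 :: real"
  have h: "fun_smooth A U ?h"
    by (rule fun_smooth_cong[OF U(1) _ fun_smooth_const[of U 1]]) simp
  have h0: "tderiv A ?h p v = 0"
    by (rule tderiv_locally_const[OF U, of _ 1]) simp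
  have *: "nabla p v (\<lambda>q. ?h q *\<^sub>R X q) = nabla p v X" if "vfield_smooth A U X" for X
    using nabla_scaleR[OF U(1) that h U(2), of v] h0 U(2) by simp
  have "(\<lambda>q. ?h q *\<^sub>R Y q) = (\<lambda>q. ?h q *\<^sub>R Z q)"
    using eq by auto
  then show ?thesis
    using *[OF Y] *[OF vfield_smooth_cong[OF U(1) eq Y]] by simp
qed

lemma nabla_zero: "nabla p v (\<lambda>q. 0) = 0"
  using nabla_add[OF open_UNIV vfield_smooth_zero vfield_smooth_zero, of p v] by simp

lemma nabla_minus:
  "open U \<Longrightarrow> vfield_smooth A U Y \<Longrightarrow> p \<in> U \<Longrightarrow> nabla p v (\<lambda>q. - Y q) = - nabla p v Y"
  using nabla_scaleR[OF _ _ fun_smooth_const[of U "-1"], of Y p v] tderiv_locally_const[of U p "\<lambda>q. -1" "-1 :: real" v] by simp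

text \<open>In both terms the Leibniz rule produces the derivatives of the coefficients of \<open>W\<close> in a local frame;
  they cancel in the difference, which makes it tensorial in \<open>W\<close>.\<close>

lemma cov_endo_tensorial:
  assumes U: "open U" "p \<in> U" and K: "endo_smooth A U K" and W: "vfield_smooth A U W"
  shows "nabla p v (\<lambda>q. K q (W q)) - K p (nabla p v W) =
    (\<Sum>b\<in>Basis. (W p \<bullet> b) *\<^sub>R (nabla p v (\<lambda>q. K q (extend_vec A p b q)) - K p (nabla p v (extend_vec A p b))))"
proof -
  define r where "r = ref_chart A p"
  have r: "r \<in> A" "p \<in> fst r" using ref_chart[of p] by (auto simp: r_def)
  note rc = compatible[OF r(1)]
  define V where "V = U \<inter> fst r"
  have V: "open V" "p \<in> V" "V \<subseteq> U" "V \<subseteq> fst r"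
    using U r is_chartD(1)[OF is_chart[OF rc]] by (auto simp: V_def)
  let ?D = "\<lambda>Z. nabla p v (\<lambda>q. K q (Z q)) - K p (nabla p v Z)"
  let ?E = "extend_vec A p"
  define \<phi> where "\<phi> b q = tderiv A (snd r) q (W q) \<bullet> b" for b q
  have \<phi>: "fun_smooth A V (\<phi> b)" for b
    unfolding \<phi>_def[abs_def] V_def
    by (rule fun_smooth_inner) (use V vfield_smooth_chart[OF r(1) W] in \<open>auto simp: V_def\<close>)
  have E: "vfield_smooth A V (?E b)" for b
    using extend_vec_smooth[of p b] by (rule vfield_smooth_subset) (use V in \<open>simp add: r_def\<close>)
  have KV: "vfield_smooth A V (\<lambda>q. K q (Z q))" if "vfield_smooth A V Z" for Z
    by (rule endo_smooth_apply[OF K V(1,3) that])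
  have Dadd: "?D (\<lambda>q. Y q + Z q) = ?D Y + ?D Z" if "vfield_smooth A V Y" "vfield_smooth A V Z" for Y Z
    using nabla_add[OF V(1) that V(2)] nabla_add[OF V(1) KV[OF that(1)] KV[OF that(2)] V(2)]
    by (simp add: blinfun.add_right)
  have Dscale: "?D (\<lambda>q. f q *\<^sub>R Z q) = f p *\<^sub>R ?D Z" if f: "fun_smooth A V f" and Z: "vfield_smooth A V Z" for f Z
    using nabla_scaleR[OF V(1) Z f V(2)] nabla_scaleR[OF V(1) KV[OF Z] f V(2)]
    by (simp add: blinfun.add_right blinfun.scaleR_right scaleR_diff_right)
  have sum: "?D (\<lambda>q. \<Sum>b\<in>I. \<phi> b q *\<^sub>R ?E b q) = (\<Sum>b\<in>I. \<phi> b p *\<^sub>R ?D (?E b))" if "finite I" for I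
    using that
  proof (induction I)
    case empty
    show ?case by (simp add: nabla_zero)
  next
    case (insert b I)
    have "?D (\<lambda>q. \<phi> b q *\<^sub>R ?E b q + (\<Sum>b\<in>I. \<phi> b q *\<^sub>R ?E b q)) =
        ?D (\<lambda>q. \<phi> b q *\<^sub>R ?E b q) + ?D (\<lambda>q. \<Sum>b\<in>I. \<phi> b q *\<^sub>R ?E b q)"
      by (rule Dadd) (intro vfield_smooth_sum V(1) vfield_smooth_scaleR \<phi> E)+
    then show ?case
      unfolding insert.IH Dscale[OF \<phi> E] using insert.hyps by simp
  qed
  have W_eq: "W q = (\<Sum>b\<in>Basis. \<phi> b q *\<^sub>R ?E b q)" if "q \<in> V" for q
  proof -
    have q: "q \<in> fst r" using that V by blast
    have "W q = coord_field A r (tderiv A (snd r) q (W q)) q" using rc q by simp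
    then show ?thesis
      using linear_eq_sum_Basis[OF coord_field_linear[OF rc q], of "tderiv A (snd r) q (W q)"]
      by (simp add: \<phi>_def extend_vec_def r_def)
  qed
  have WV: "vfield_smooth A V W" using W V(3) by (rule vfield_smooth_subset)
  have 1: "nabla p v W = nabla p v (\<lambda>q. \<Sum>b\<in>Basis. \<phi> b q *\<^sub>R ?E b q)"
    by (rule nabla_local[OF V(1,2) WV W_eq])
  have 2: "nabla p v (\<lambda>q. K q (W q)) = nabla p v (\<lambda>q. K q (\<Sum>b\<in>Basis. \<phi> b q *\<^sub>R ?E b q))"
    by (rule nabla_local[OF V(1,2) KV[OF WV]]) (rule arg_cong[OF W_eq])
  have "?D W = ?D (\<lambda>q. \<Sum>b\<in>Basis. \<phi> b q *\<^sub>R ?E b q)"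
    unfolding 1 2 by (rule refl)
  also have "\<dots> = (\<Sum>b\<in>Basis. \<phi> b p *\<^sub>R ?D (?E b))" by (rule sum) simp
  finally show ?thesis
    using tderiv_ref[of p] by (simp add: \<phi>_def r_def)
qed

text \<open>By tensoriality the defining expression is linear in the vector, so \<open>Blinfun\<close> represents it, and it may
  be evaluated with any extension of the vector.\<close>

lemma cov_endo_apply:
  assumes U: "open U" "p \<in> U" and K: "endo_smooth A U K" and W: "vfield_smooth A U W"
  shows "cov_endo A nabla K p v (W p) = nabla p v (\<lambda>q. K q (W q)) - K p (nabla p v W)"
proof -
  let ?L = "\<lambda>w. nabla p v (\<lambda>q. K q (extend_vec A p w q)) - K p (nabla p v (extend_vec A p w))"
  let ?V = "U \<inter> fst (ref_chart A p)"
  have V: "open ?V" "p \<in> ?V" using U ref_chart[of p] chart_domain_open[of "ref_chart A p"] by auto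
  have L: "?L w = (\<Sum>b\<in>Basis. (w \<bullet> b) *\<^sub>R ?L b)" for w
    using cov_endo_tensorial[OF V endo_smooth_subset[OF K V(1)] vfield_smooth_subset[OF extend_vec_smooth[of p w]], of v]
    by simp
  have bl: "bounded_linear (\<lambda>w. \<Sum>b\<in>Basis. (w \<bullet> b) *\<^sub>R ?L b)"
    by (rule bounded_linear_sum) (rule bounded_linear_scaleR_const[OF bounded_linear_inner_left])
  have eqL: "?L = (\<lambda>w. \<Sum>b\<in>Basis. (w \<bullet> b) *\<^sub>R ?L b)"
    by (rule ext) (rule L)
  have "bounded_linear ?L"
    by (rule ssubst[of _ _ bounded_linear, OF eqL bl])
  then have "cov_endo A nabla K p v (W p) = ?L (W p)"
    unfolding cov_endo_def Let_def by (rule bounded_linear_Blinfun_apply[THEN fun_cong])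
  also have "\<dots> = nabla p v (\<lambda>q. K q (W q)) - K p (nabla p v W)"
    by (rule trans[OF L cov_endo_tensorial[OF U K W, symmetric]])
  finally show ?thesis .
qed

lemma cov_endo_eqI:
  assumes U: "open U" "p \<in> U" and K: "endo_smooth A U K"
    and B: "\<And>W V. open V \<Longrightarrow> p \<in> V \<Longrightarrow> V \<subseteq> U \<Longrightarrow> vfield_smooth A V W \<Longrightarrow>
      nabla p v (\<lambda>q. K q (W q)) - K p (nabla p v W) = blinfun_apply B (W p)"
  shows "cov_endo A nabla K p v = B"
proof (rule blinfun_eqI)
  fix w
  let ?V = "U \<inter> fst (ref_chart A p)"
  have V: "open ?V" "p \<in> ?V" "?V \<subseteq> U" using U ref_chart[of p] chart_domain_open[of "ref_chart A p"] by auto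
  have W: "vfield_smooth A ?V (extend_vec A p w)"
    using extend_vec_smooth by (rule vfield_smooth_subset) simp
  show "cov_endo A nabla K p v w = B w"
    using cov_endo_apply[OF V(1,2) endo_smooth_subset[OF K V(1,3)] W, of v] B[OF V W] by simp
qed

lemma cov_endo_local:
  assumes U: "open U" "p \<in> U" and K: "endo_smooth A U K" and eq: "\<And>q. q \<in> U \<Longrightarrow> K q = L q"
  shows "cov_endo A nabla K p v = cov_endo A nabla L p v"
proof (rule cov_endo_eqI[OF U K])
  fix V W assume V: "open V" "p \<in> V" "V \<subseteq> U" and W: "vfield_smooth A V W"
  have KV: "endo_smooth A V K" by (rule endo_smooth_subset[OF K V(1,3)])
  have "endo_smooth A V L"
  proof (rule endo_smoothI[OF V(1)])
    fix V' W' assume *: "open V'" "V' \<subseteq> V" "vfield_smooth A V' W'"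
    show "vfield_smooth A V' (\<lambda>q. L q (W' q))"
      by (rule vfield_smooth_cong[OF *(1) _ endo_smooth_apply[OF KV *]]) (use eq * V in auto)
  qed
  note LV = this
  have "nabla p v (\<lambda>q. K q (W q)) = nabla p v (\<lambda>q. L q (W q))"
    by (rule nabla_local[OF V(1,2) endo_smooth_apply[OF KV V(1) subset_refl W]]) (use eq V in auto)
  then show "nabla p v (\<lambda>q. K q (W q)) - K p (nabla p v W) = cov_endo A nabla L p v (W p)"
    using cov_endo_apply[OF V(1,2) LV W, of v] eq[OF U(2)] by simp
qed

lemma cov_endo_compose:
  assumes U: "open U" "p \<in> U" and K: "endo_smooth A U K" and L: "endo_smooth A U L"
  shows "cov_endo A nabla (\<lambda>q. K q o\<^sub>L L q) p v =
    (cov_endo A nabla K p v o\<^sub>L L p) + (K p o\<^sub>L cov_endo A nabla L p v)"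
proof (rule cov_endo_eqI[OF U endo_smooth_compose[OF U(1) K L]])
  fix V W assume V: "open V" "p \<in> V" "V \<subseteq> U" and W: "vfield_smooth A V W"
  have KV: "endo_smooth A V K" and LV: "endo_smooth A V L"
    using endo_smooth_subset[OF K V(1,3)] endo_smooth_subset[OF L V(1,3)] .
  show "nabla p v (\<lambda>q. (K q o\<^sub>L L q) (W q)) - (K p o\<^sub>L L p) (nabla p v W) =
    ((cov_endo A nabla K p v o\<^sub>L L p) + (K p o\<^sub>L cov_endo A nabla L p v)) (W p)"
    using cov_endo_apply[OF V(1,2) LV W, of v]
      cov_endo_apply[OF V(1,2) KV endo_smooth_apply[OF LV V(1) subset_refl W], of v]
    by (simp add: blinfun.add_left blinfun.diff_right)
qed

lemma cov_endo_minus: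
  assumes U: "open U" "p \<in> U" and K: "endo_smooth A U K"
  shows "cov_endo A nabla (\<lambda>q. - K q) p v = - cov_endo A nabla K p v"
proof (rule cov_endo_eqI[OF U endo_smooth_minus[OF U(1) K]])
  fix V W assume V: "open V" "p \<in> V" "V \<subseteq> U" and W: "vfield_smooth A V W"
  have KV: "endo_smooth A V K" using endo_smooth_subset[OF K V(1,3)] .
  show "nabla p v (\<lambda>q. (- K q) (W q)) - (- K p) (nabla p v W) = (- cov_endo A nabla K p v) (W p)"
    using cov_endo_apply[OF V(1,2) KV W, of v] nabla_minus[OF V(1) endo_smooth_apply[OF KV V(1) subset_refl W] V(2), of v]
    by (simp add: blinfun.minus_left)
qed

lemma cov_endo_const_id: "cov_endo A nabla (\<lambda>q. c *\<^sub>R id_blinfun) p v = 0"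
proof (rule cov_endo_eqI[OF open_UNIV UNIV_I endo_smooth_const_id[OF open_UNIV]])
  fix V W assume V: "open V" "p \<in> V" and W: "vfield_smooth A V W"
  show "nabla p v (\<lambda>q. (c *\<^sub>R id_blinfun) (W q)) - (c *\<^sub>R id_blinfun) (nabla p v W) = blinfun_apply 0 (W p)"
    using nabla_scaleR[OF V(1) W fun_smooth_const V(2), of v c] tderiv_locally_const[OF V, of "\<lambda>q. c" c v]
    by (simp add: blinfun.scaleR_left)
qed

lemma cov_endo_linear:
  assumes U: "open U" "p \<in> U" and K: "endo_smooth A U K"
  shows "linear (\<lambda>v. cov_endo A nabla K p v)"
proof (rule linearI)
  let ?V = "U \<inter> fst (ref_chart A p)"
  have V: "open ?V" "p \<in> ?V" "?V \<subseteq> U" using U ref_chart[of p] chart_domain_open[of "ref_chart A p"] by auto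
  have KV: "endo_smooth A ?V K" by (rule endo_smooth_subset[OF K V(1,3)])
  have W: "vfield_smooth A ?V (extend_vec A p w)" for w
    using extend_vec_smooth by (rule vfield_smooth_subset) simp
  have ap: "cov_endo A nabla K p v w =
      nabla p v (\<lambda>q. K q (extend_vec A p w q)) - K p (nabla p v (extend_vec A p w))" for v w
    using cov_endo_apply[OF V(1,2) KV W, of v w] by simp
  have lin: "linear (\<lambda>v. nabla p v (\<lambda>q. K q (extend_vec A p w q)))" "linear (\<lambda>v. nabla p v (extend_vec A p w))" for w
    using nabla_linear[OF V(1) endo_smooth_apply[OF KV V(1) subset_refl W] V(2)] nabla_linear[OF V(1) W V(2)] .
  show "cov_endo A nabla K p (v + v') = cov_endo A nabla K p v + cov_endo A nabla K p v'" for v v'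
    by (rule blinfun_eqI) (simp add: ap blinfun.add_left linear_add[OF lin(1)] linear_add[OF lin(2)] blinfun.add_right)
  show "cov_endo A nabla K p (s *\<^sub>R v) = s *\<^sub>R cov_endo A nabla K p v" for s v
    by (rule blinfun_eqI) (simp add: ap blinfun.scaleR_left linear_scale[OF lin(1)] linear_scale[OF lin(2)] blinfun.scaleR_right scaleR_diff_right)
qed

text \<open>Once the brackets are written with the connection, the derivatives of \<open>X\<close> and \<open>Y\<close> cancel because the
  square of \<open>K\<close> at \<open>p\<close> is \<open>\<epsilon>\<close>.\<close>

lemma nijenhuis_torsion_free:
  assumes tf: "\<And>V X Y. open V \<Longrightarrow> p \<in> V \<Longrightarrow> vfield_smooth A V X \<Longrightarrow> vfield_smooth A V Y \<Longrightarrow>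
      lie_bracket A X Y p = nabla p (X p) Y - nabla p (Y p) X"
    and U: "open U" "p \<in> U" and K: "endo_smooth A U K" and sq: "K p o\<^sub>L K p = \<epsilon> *\<^sub>R id_blinfun"
    and X: "vfield_smooth A U X" and Y: "vfield_smooth A U Y"
  shows "lie_bracket A (\<lambda>q. K q (X q)) (\<lambda>q. K q (Y q)) p
      - K p (lie_bracket A (\<lambda>q. K q (X q)) Y p) - K p (lie_bracket A X (\<lambda>q. K q (Y q)) p)
      + \<epsilon> *\<^sub>R lie_bracket A X Y p =
    cov_endo A nabla K p (K p (X p)) (Y p) - cov_endo A nabla K p (K p (Y p)) (X p)
      + K p (cov_endo A nabla K p (Y p) (X p)) - K p (cov_endo A nabla K p (X p) (Y p))"
proof -
  have KX: "vfield_smooth A U (\<lambda>q. K q (X q))" and KY: "vfield_smooth A U (\<lambda>q. K q (Y q))"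
    using endo_smooth_apply[OF K U(1) subset_refl X] endo_smooth_apply[OF K U(1) subset_refl Y] .
  have sq': "K p (K p w) = \<epsilon> *\<^sub>R w" for w
    using arg_cong[OF sq, of "\<lambda>L. blinfun_apply L w"] by (simp add: blinfun.scaleR_left)
  show ?thesis
    unfolding tf[OF U KX KY] tf[OF U KX Y] tf[OF U X KY] tf[OF U X Y]
      cov_endo_apply[OF U K X] cov_endo_apply[OF U K Y]
    by (simp add: blinfun.diff_right sq' algebra_simps)
qed

end

section \<open>Immersed submanifolds\<close>

context smooth_manifold
begin

lemma fun_smooth_continuous:
  assumes U: "open U" and f: "fun_smooth A U f"
  shows "continuous_on U f"
proof -
  have "continuous_on (\<Union>p\<in>U. U \<inter> fst (ref_chart A p)) f"
  proof (rule continuous_on_open_UN)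
    fix p assume p: "p \<in> U"
    define r where "r = ref_chart A p"
    have r: "r \<in> A" "p \<in> fst r" using ref_chart[of p] by (auto simp: r_def)
    note rc = compatible[OF r(1)]
    note rh = is_chartD[OF is_chart[OF rc]]
    show "open (U \<inter> fst (ref_chart A p))" using U rh(1) unfolding r_def by blast
    have "continuous_on (U \<inter> fst r) (\<lambda>q. f (chart_inv r (snd r q)))"
      by (rule continuous_on_compose2[OF smooth_on_continuous[OF fun_smooth_in_chart[OF f U rc]]
            continuous_on_subset[OF rh(6)]]) auto
    then have "continuous_on (U \<inter> fst r) f"
      by (rule continuous_on_eq) (simp add: rh(3))
    then show "continuous_on (U \<inter> fst (ref_chart A p)) f" by (simp add: r_def)
  qed
  moreover have "(\<Union>p\<in>U. U \<inter> fst (ref_chart A p)) = U" using ref_chart(2) by blast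
  ultimately show ?thesis by simp
qed

lemma fun_smooth_apply:
  fixes M :: "'a \<Rightarrow> 'x::euclidean_space \<Rightarrow> 'y::real_normed_vector"
  assumes U: "open U" and lin: "\<And>q. q \<in> U \<Longrightarrow> linear (M q)"
    and M: "\<And>w. fun_smooth A U (\<lambda>q. M q w)" and h: "fun_smooth A U h"
  shows "fun_smooth A U (\<lambda>q. M q (h q))"
  unfolding fun_smooth_def o_def
proof
  fix c assume c: "c \<in> A"
  note cc = compatible[OF c]
  show "smooth_on (snd c ` (fst c \<inter> U)) (\<lambda>u. M (chart_inv c u) (h (chart_inv c u)))"
    by (rule smooth_on_apply[OF chart_image_open[OF is_chart[OF cc] U] _
          fun_smooth_in_chart[OF M U cc] fun_smooth_in_chart[OF h U cc]])
      (use lin is_chartD(3)[OF is_chart[OF cc]] in auto)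
qed

end

context smooth_manifold_map
begin

lemma fun_smooth_pullback:
  assumes h: "fun_smooth A W h" and W: "open W"
  shows "fun_smooth B (f -` W) (\<lambda>x. h (f x))"
  unfolding fun_smooth_def o_def
proof
  fix c assume c: "c \<in> B"
  note ch = is_chartD[OF M.is_chart[OF M.compatible[OF c]]]
  show "smooth_on (snd c ` (fst c \<inter> f -` W)) (\<lambda>u. h (f (chart_inv c u)))"
  proof (rule smooth_on_local)
    fix u assume "u \<in> snd c ` (fst c \<inter> f -` W)"
    then obtain x where x: "x \<in> fst c" "f x \<in> W" "u = snd c x" by blast
    define d where "d = ref_chart A (f x)"
    have d: "d \<in> A" "f x \<in> fst d" using N.ref_chart[of "f x"] by (auto simp: d_def)
    note dc = N.compatible[OF d(1)]
    note dh = is_chartD[OF N.is_chart[OF dc]]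
    let ?S = "snd c ` (fst c \<inter> (f -` fst d \<inter> f -` W))"
    have S: "open ?S"
      by (rule chart_image_open[OF M.is_chart[OF M.compatible[OF c]]]) (intro open_Int open_vimage_map W dh(1))
    have T: "open (snd d ` (fst d \<inter> W))" by (rule chart_image_open[OF N.is_chart[OF dc] W])
    have F: "smooth_on ?S (\<lambda>u. snd d (f (chart_inv c u)))"
      using map_in_charts_smooth[OF c d(1)] by (rule smooth_on_subset) blast
    have "smooth_on ?S (\<lambda>u. h (chart_inv d (snd d (f (chart_inv c u)))))"
      by (rule smooth_on_compose[OF S T _ N.fun_smooth_in_chart[OF h W dc] F]) (auto simp: ch(3))
    then have "smooth_on ?S (\<lambda>u. h (f (chart_inv c u)))"
      by (rule smooth_on_cong[OF S, rotated]) (auto simp: ch(3) dh(3))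
    then show "\<exists>U. open U \<and> u \<in> U \<and> smooth_on U (\<lambda>u. h (f (chart_inv c u)))"
      using S x d by blast
  qed
qed

text \<open>\<open>\<rho>\<close> is a smooth left inverse of the map near a point, and \<open>\<Lambda> x\<close> is the derivative of \<open>\<rho>\<close> at \<open>f x\<close>
  in the charts \<open>d\<close> and \<open>c\<close>.\<close>

definition retraction :: "('b, 'f) chart \<Rightarrow> ('a, 'e) chart \<Rightarrow> 'b set \<Rightarrow> 'a set \<Rightarrow> ('a \<Rightarrow> 'b) \<Rightarrow> ('b \<Rightarrow> 'e \<Rightarrow> 'f) \<Rightarrow> bool" where
  "retraction c d V W \<rho> \<Lambda> \<longleftrightarrow> c \<in> B \<and> d \<in> A \<and> open V \<and> V \<subseteq> fst c \<and> open W \<and> W \<subseteq> fst d \<and>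
     f ` V \<subseteq> W \<and> \<rho> ` W \<subseteq> V \<and> (\<forall>x\<in>V. \<rho> (f x) = x) \<and>
     (\<forall>h :: 'b \<Rightarrow> real. fun_smooth B V h \<longrightarrow> fun_smooth A W (\<lambda>p. h (\<rho> p))) \<and>
     (\<forall>x\<in>V. linear (\<Lambda> x)) \<and> (\<forall>w. fun_smooth B V (\<lambda>x. \<Lambda> x w)) \<and>
     (\<forall>x\<in>V. \<forall>v. \<Lambda> x (tderiv A (snd d) (f x) (differential B A f x v)) = tderiv B (snd c) x v)"

lemma retractionD:
  assumes "retraction c d V W \<rho> \<Lambda>"
  shows "c \<in> B" "d \<in> A" "open V" "V \<subseteq> fst c" "open W" "W \<subseteq> fst d" "f ` V \<subseteq> W" "\<rho> ` W \<subseteq> V"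
    and "\<And>x. x \<in> V \<Longrightarrow> \<rho> (f x) = x"
    and "\<And>h :: 'b \<Rightarrow> real. fun_smooth B V h \<Longrightarrow> fun_smooth A W (\<lambda>p. h (\<rho> p))"
    and "\<And>x. x \<in> V \<Longrightarrow> linear (\<Lambda> x)" "\<And>w. fun_smooth B V (\<lambda>x. \<Lambda> x w)"
    and "\<And>x v. x \<in> V \<Longrightarrow> \<Lambda> x (tderiv A (snd d) (f x) (differential B A f x v)) = tderiv B (snd c) x v"
  using assms unfolding retraction_def by (elim conjE; (assumption | rule bspec[rule_format], assumption | blast))+

text \<open>The retraction is the local left inverse of the coordinate expression of the map.\<close>

lemma retraction_exists:
  assumes inj: "inj (differential B A f x0)" and N: "open N" "x0 \<in> N"
  obtains c d V W \<rho> \<Lambda> where "retraction c d V W \<rho> \<Lambda>" "x0 \<in> V" "V \<subseteq> N"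
proof -
  define c d where "c = ref_chart B x0" and "d = ref_chart A (f x0)"
  have c: "c \<in> B" "x0 \<in> fst c" and d: "d \<in> A" "f x0 \<in> fst d"
    using M.ref_chart[of x0] N.ref_chart[of "f x0"] by (auto simp: c_def d_def)
  have cc: "compatible_chart B c" "compatible_chart A d" using c d by auto
  note ch = is_chartD[OF M.is_chart[OF cc(1)]] and dh = is_chartD[OF N.is_chart[OF cc(2)]]
  let ?F = "\<lambda>u. snd d (f (chart_inv c u))"
  let ?S = "snd c ` (fst c \<inter> (f -` fst d \<inter> N))"
  have S: "open ?S"
    by (rule chart_image_open[OF M.is_chart[OF cc(1)]]) (intro open_Int open_vimage_map N dh(1))
  have F: "smooth_on ?S ?F"
    using map_in_charts_smooth[OF c(1) d(1)] by (rule smooth_on_subset) blast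
  have "differential B A f x0 v = frechet_derivative ?F (at (snd c x0)) v" for v
    using differential_in_charts[OF c d, of v] M.tderiv_ref[of x0 v] N.tderiv_ref[of "f x0"]
    by (simp add: c_def d_def)
  then have "differential B A f x0 = frechet_derivative ?F (at (snd c x0))" by (rule ext)
  then have injF: "inj (frechet_derivative ?F (at (snd c x0)))" using inj by simp
  have x0S: "snd c x0 \<in> ?S" using c d N by blast
  obtain U W' R where U: "open U" "snd c x0 \<in> U" "U \<subseteq> ?S" "open W'" "?F ` U \<subseteq> W'" "smooth_on W' R" "R ` W' \<subseteq> U"
    and RF: "\<And>u. u \<in> U \<Longrightarrow> R (?F u) = u"
    by (rule smooth_local_left_inverse[OF F S x0S injF]) (rule that, assumption+)
  define V where "V = {x \<in> fst c. snd c x \<in> U}"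
  define W where "W = {p \<in> fst d. snd d p \<in> W'}"
  define \<rho> where "\<rho> p = chart_inv c (R (snd d p))" for p
  define \<Lambda> where "\<Lambda> x = frechet_derivative R (at (snd d (f x)))" for x
  have V: "open V" unfolding V_def by (rule chart_vimage_open[OF M.is_chart[OF cc(1)] U(1)])
  have W: "open W" unfolding W_def by (rule chart_vimage_open[OF N.is_chart[OF cc(2)] U(4)])
  have Vx: "f x \<in> fst d" "x \<in> N" "snd c x \<in> U" "x \<in> fst c" if "x \<in> V" for x
  proof -
    have x: "x \<in> fst c" "snd c x \<in> U" using that by (auto simp: V_def)
    then obtain q where q: "q \<in> fst c" "f q \<in> fst d" "q \<in> N" "snd c x = snd c q" using U(3) by blast
    then have "x = q" using ch(3) x(1) by metis
    then show "f x \<in> fst d" "x \<in> N" "snd c x \<in> U" "x \<in> fst c" using q x by auto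
  qed
  have UV: "snd c ` V = U"
  proof
    show "snd c ` V \<subseteq> U" by (auto simp: V_def)
    show "U \<subseteq> snd c ` V" using U(3) by (auto simp: V_def)
  qed
  have Fc: "?F (snd c x) = snd d (f x)" if "x \<in> V" for x using ch(3)[OF Vx(4)[OF that]] by simp
  have fV: "f ` V \<subseteq> W"
  proof
    fix p assume "p \<in> f ` V"
    then obtain x where x: "x \<in> V" "p = f x" by blast
    then show "p \<in> W" using Vx[OF x(1)] U(5) Fc[OF x(1)] by (auto simp: W_def)
  qed
  have DRF: "\<Lambda> x (frechet_derivative ?F (at (snd c x)) v) = v" if x: "x \<in> V" for x v
  proof -
    have u: "snd c x \<in> U" using Vx x by blast
    have W'x: "snd d (f x) \<in> W'" using fV x by (auto simp: W_def)
    have "((\<lambda>u. R (?F u)) has_derivative (\<lambda>v. \<Lambda> x (frechet_derivative ?F (at (snd c x)) v))) (at (snd c x))"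
      unfolding \<Lambda>_def
      by (rule has_derivative_compose[OF smooth_on_has_derivative[OF F]])
        (use u U(3) smooth_on_has_derivative[OF U(6) W'x] Fc[OF x] in auto)
    moreover have "((\<lambda>u. R (?F u)) has_derivative (\<lambda>v. v)) (at (snd c x))"
      by (rule has_derivative_transform_within_open[OF has_derivative_ident U(1) u]) (rule RF[symmetric])
    ultimately have "(\<lambda>v. \<Lambda> x (frechet_derivative ?F (at (snd c x)) v)) = (\<lambda>v. v)"
      by (rule has_derivative_unique)
    then show ?thesis by (rule fun_cong)
  qed
  have "retraction c d V W \<rho> \<Lambda>"
    unfolding retraction_def
  proof (intro conjI ballI allI impI c(1) d(1) V W fV)
    show "V \<subseteq> fst c" "W \<subseteq> fst d" by (auto simp: V_def W_def)
    show "\<rho> ` W \<subseteq> V"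
    proof
      fix x assume "x \<in> \<rho> ` W"
      then obtain p where p: "snd d p \<in> W'" "x = \<rho> p" by (auto simp: W_def)
      then have "R (snd d p) \<in> U" using U(7) by blast
      then have "R (snd d p) \<in> snd c ` V" using UV by simp
      then obtain q where "q \<in> V" "R (snd d p) = snd c q" by blast
      then show "x \<in> V" using p ch(3) Vx(4) by (simp add: \<rho>_def)
    qed
    show "\<rho> (f x) = x" if "x \<in> V" for x
      using RF[OF Vx(3)[OF that]] Fc[OF that] ch(3)[OF Vx(4)[OF that]] by (simp add: \<rho>_def)
    show "linear (\<Lambda> x)" if "x \<in> V" for x
      unfolding \<Lambda>_def by (rule smooth_on_linear_derivative[OF U(6)]) (use fV that in \<open>auto simp: W_def\<close>)
    show "fun_smooth B V (\<lambda>x. \<Lambda> x w)" for w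
    proof (rule M.fun_smooth_from_chart[OF _ V _ cc(1)])
      have "smooth_on U (\<lambda>u. frechet_derivative R (at (?F u)) w)"
        by (rule smooth_on_compose[OF U(1,4,5) smooth_on_derivative[OF U(6)] smooth_on_subset[OF F U(3)]])
      then show "smooth_on (snd c ` V) (\<lambda>u. \<Lambda> (chart_inv c u) w)"
        unfolding UV \<Lambda>_def .
    qed (use Vx in blast)
    show "\<Lambda> x (tderiv A (snd d) (f x) (differential B A f x v)) = tderiv B (snd c) x v" if x: "x \<in> V" for x v
      unfolding differential_in_charts[OF c(1) Vx(4)[OF x] d(1) Vx(1)[OF x]] by (rule DRF[OF x])
    fix h :: "'b \<Rightarrow> real" assume h: "fun_smooth B V h"
    show "fun_smooth A W (\<lambda>p. h (\<rho> p))"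
    proof (rule N.fun_smooth_from_chart[OF _ W _ cc(2)])
      have oW: "open (snd d ` W)"
        using chart_image_open[OF N.is_chart[OF cc(2)] W] by (simp add: Int_absorb1 W_def subset_iff)
      have hU: "smooth_on U (\<lambda>u. h (chart_inv c u))"
        using M.fun_smooth_in_chart[OF h V cc(1)] by (rule smooth_on_subset) (use UV Vx(4) in blast)
      have "smooth_on (snd d ` W) (\<lambda>w. h (chart_inv c (R w)))"
        by (rule smooth_on_compose[OF oW U(1) _ hU smooth_on_subset[OF U(6)]]) (use U(7) in \<open>auto simp: W_def\<close>)
      then show "smooth_on (snd d ` W) (\<lambda>u. h (\<rho> (chart_inv d u)))"
        by (rule smooth_on_cong[OF oW, rotated]) (auto simp: \<rho>_def W_def dh(3))
    qed (auto simp: W_def)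
  qed
  then show thesis
  proof (rule that)
    show "x0 \<in> V" using c(2) U(2) unfolding V_def by blast
    show "V \<subseteq> N" using Vx(2) by blast
  qed
qed

lemma differential_comp_smooth:
  assumes c: "c \<in> B" and d: "d \<in> A" and V: "open V" "V \<subseteq> fst c" "f ` V \<subseteq> fst d" and X: "vfield_smooth B V X"
  shows "fun_smooth B V (\<lambda>x. tderiv A (snd d) (f x) (differential B A f x (X x)))"
proof (rule M.fun_smooth_from_chart[OF _ V(1,2) M.compatible[OF c]])
  note cc = M.compatible[OF c]
  note ch = is_chartD[OF M.is_chart[OF cc]]
  have S: "open (snd c ` V)" "snd c ` (fst c \<inter> V) = snd c ` V"
    using chart_image_open[OF M.is_chart[OF cc] V(1)] V(2) by (simp_all add: Int_absorb1)
  have "smooth_on (snd c ` V) (\<lambda>u. frechet_derivative (\<lambda>u. snd d (f (chart_inv c u))) (at u) (tangent_comp B c X u))"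
  proof (rule smooth_on_derivative_apply[OF S(1) smooth_on_subset[OF map_in_charts_smooth[OF c d]]])
    show "snd c ` V \<subseteq> snd c ` (fst c \<inter> f -` fst d)" using V(2,3) by (intro image_mono) blast
    show "smooth_on (snd c ` V) (tangent_comp B c X)"
      using M.vfield_smooth_in_chart[OF X V(1) cc] unfolding S(2) .
  qed
  then show "smooth_on (snd c ` V) (\<lambda>u. tderiv A (snd d) (f (chart_inv c u))
      (differential B A f (chart_inv c u) (X (chart_inv c u))))"
  proof (rule smooth_on_cong[OF S(1), rotated])
    fix u assume "u \<in> snd c ` V"
    then obtain x where x: "x \<in> V" "x \<in> fst c" "f x \<in> fst d" "u = snd c x" using V by blast
    show "frechet_derivative (\<lambda>u. snd d (f (chart_inv c u))) (at u) (tangent_comp B c X u) =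
        tderiv A (snd d) (f (chart_inv c u)) (differential B A f (chart_inv c u) (X (chart_inv c u)))"
      using differential_in_charts[OF c x(2) d x(3)] x ch(3)[OF x(2)] by (simp add: tangent_comp_def)
  qed
qed

text \<open>The components of the pushed forward field are spread over a neighbourhood by composition with the
  retraction, which does not change them along the submanifold.\<close>

lemma related_extension:
  assumes r: "retraction c d V W \<rho> \<Lambda>" and X: "vfield_smooth B V X"
  obtains X' where "vfield_smooth A W X'" "\<And>x. x \<in> V \<Longrightarrow> X' (f x) = differential B A f x (X x)"
proof -
  note c = retractionD(1)[OF r] and d = retractionD(2)[OF r] and V = retractionD(3,4)[OF r]
    and W = retractionD(5,6)[OF r] and fV = retractionD(7)[OF r] and \<rho> = retractionD(9)[OF r]
    and lift = retractionD(10)[OF r]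
  note dc = N.compatible[OF d]
  define \<eta> where "\<eta> b x = tderiv A (snd d) (f x) (differential B A f x (X x)) \<bullet> b" for b x
  have \<eta>: "fun_smooth B V (\<eta> b)" for b
    unfolding \<eta>_def[abs_def]
    by (rule M.fun_smooth_inner[OF V(1) differential_comp_smooth[OF c d V _ X]]) (use fV W in blast)
  let ?X = "\<lambda>p. \<Sum>b\<in>Basis. \<eta> b (\<rho> p) *\<^sub>R coord_field A d b p"
  have "vfield_smooth A W ?X"
    by (rule N.vfield_smooth_sum[OF W(1) N.vfield_smooth_scaleR[OF W(1) lift[OF \<eta>]
          N.vfield_smooth_subset[OF N.coord_field_smooth[OF dc] W(2)]]])
  moreover have "?X (f x) = differential B A f x (X x)" if x: "x \<in> V" for x
  proof -
    have fx: "f x \<in> fst d" using fV W x by blast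
    have "?X (f x) = coord_field A d (tderiv A (snd d) (f x) (differential B A f x (X x))) (f x)"
      using linear_eq_sum_Basis[OF N.coord_field_linear[OF dc fx], of "tderiv A (snd d) (f x) (differential B A f x (X x))"]
      by (simp add: \<eta>_def \<rho>[OF x])
    then show ?thesis using N.coord_field_tderiv[OF dc fx] by simp
  qed
  ultimately show thesis by (rule that)
qed

lemma endo_along_matrix_smooth:
  assumes K: "endo_smooth_along B A f UNIV K" and d: "d \<in> A"
  shows "fun_smooth B (f -` fst d) (\<lambda>x. tderiv A (snd d) (f x) (K x (coord_field A d w (f x))))"
  using K d unfolding endo_smooth_along_def by simp

lemma endo_along_matrix_linear:
  assumes d: "d \<in> A" and fx: "f x \<in> fst d"
  shows "linear (\<lambda>w. tderiv A (snd d) (f x) (blinfun_apply K (coord_field A d w (f x))))"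
  using linear_compose[OF linear_compose[OF N.coord_field_linear[OF N.compatible[OF d] fx]
      bounded_linear.linear[OF blinfun.bounded_linear_right]] N.tderiv_linear[OF N.compatible[OF d] fx], of K]
  by (simp add: o_def)

lemma endo_matrix_smooth:
  assumes K: "endo_smooth A U K" and U: "open U" and d: "d \<in> A"
  shows "fun_smooth B (f -` (U \<inter> fst d)) (\<lambda>x. tderiv A (snd d) (f x) (K (f x) (coord_field A d w (f x))))"
proof -
  have o: "open (U \<inter> fst d)" using U N.chart_domain_open[OF d] by blast
  have "fun_smooth A (U \<inter> fst d) (\<lambda>p. tderiv A (snd d) p (K p (coord_field A d w p)))"
    using K d unfolding endo_smooth_def endo_smooth_along_def by (simp add: Int_ac)
  then show ?thesis by (rule fun_smooth_pullback[OF _ o])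
qed

text \<open>The left inverse \<open>\<Lambda>\<close> of the differential recovers \<open>j X\<close> smoothly from \<open>K (df X)\<close>.\<close>

lemma induced_vfield_smooth:
  assumes r: "retraction c d V W \<rho> \<Lambda>" and K: "endo_smooth_along B A f UNIV K"
    and j: "\<And>x v. differential B A f x (j x v) = K x (differential B A f x v)"
    and O: "open O'" "O' \<subseteq> V" and X: "vfield_smooth B O' X"
  shows "vfield_smooth B O' (\<lambda>x. j x (X x))"
proof -
  note c = retractionD(1)[OF r] and d = retractionD(2)[OF r] and V = retractionD(3,4)[OF r]
    and W = retractionD(5,6)[OF r] and fV = retractionD(7)[OF r] and \<Lambda> = retractionD(11-13)[OF r]
  note cc = M.compatible[OF c] and dc = N.compatible[OF d]
  have fO: "f x \<in> fst d" if "x \<in> O'" for x using that O fV W by blast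
  let ?z = "\<lambda>x. tderiv A (snd d) (f x) (differential B A f x (X x))"
  let ?M = "\<lambda>x w. tderiv A (snd d) (f x) (K x (coord_field A d w (f x)))"
  have z: "fun_smooth B O' ?z"
    by (rule differential_comp_smooth[OF c d O(1) _ _ X]) (use O V fO in auto)
  have "fun_smooth B O' (\<lambda>x. ?M x (?z x))"
    by (rule M.fun_smooth_apply[OF O(1) endo_along_matrix_linear[OF d fO]
          M.fun_smooth_subset[OF endo_along_matrix_smooth[OF K d]] z]) (use fO in auto)
  then have "fun_smooth B O' (\<lambda>x. \<Lambda> x (?M x (?z x)))"
    using M.fun_smooth_apply[OF O(1), where M = \<Lambda>, OF \<Lambda>(1) M.fun_smooth_subset[OF \<Lambda>(2) O(2)]] O(2) by blast
  then have sm: "fun_smooth B O' (\<lambda>x. tderiv B (snd c) x (j x (X x)))"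
  proof (rule M.fun_smooth_cong[OF O(1), rotated])
    fix x assume x: "x \<in> O'"
    have "?M x (?z x) = tderiv A (snd d) (f x) (differential B A f x (j x (X x)))"
      using N.coord_field_tderiv[OF dc fO[OF x]] j by simp
    then show "\<Lambda> x (?M x (?z x)) = tderiv B (snd c) x (j x (X x))"
      using \<Lambda>(3) x O by auto
  qed
  show ?thesis
  proof (rule M.vfield_smooth_from_chart[OF _ O(1) _ cc])
    show "smooth_on (snd c ` O') (tangent_comp B c (\<lambda>x. j x (X x)))"
      using M.fun_smooth_in_chart[OF sm O(1) cc] unfolding tangent_comp_def[abs_def]
      by (rule smooth_on_subset) (use O V in blast)
  qed (use O V in blast)
qed

end

context smooth_manifold
begin

lemma lie_bracket_smooth:
  assumes U: "open U" and X: "vfield_smooth A U X" and Y: "vfield_smooth A U Y"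
  shows "vfield_smooth A U (lie_bracket A X Y)"
  unfolding vfield_smooth_def
proof
  fix c assume c: "c \<in> A"
  note cc = compatible[OF c]
  note ch = is_chartD[OF is_chart[OF cc]]
  have o: "open (U \<inter> fst c)" using U ch(1) by blast
  let ?S = "snd c ` (fst c \<inter> U)"
  have S: "open ?S" by (rule chart_image_open[OF is_chart[OF cc] U])
  note sX = vfield_smooth_in_chart[OF X U cc] and sY = vfield_smooth_in_chart[OF Y U cc]
  have "smooth_on ?S (\<lambda>u. frechet_derivative (tangent_comp A c Y) (at u) (tangent_comp A c X u) -
      frechet_derivative (tangent_comp A c X) (at u) (tangent_comp A c Y u))"
    by (rule smooth_on_diff[OF S smooth_on_derivative_apply[OF S sY sX] smooth_on_derivative_apply[OF S sX sY]])
  then have "smooth_on ?S (\<lambda>u. tderiv A (snd c) (chart_inv c u) (lie_bracket A X Y (chart_inv c u)))"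
    by (rule smooth_on_cong[OF S, rotated])
      (auto simp: ch(3) lie_bracket_in_chart[OF cc _ _ U X Y])
  then show "fun_smooth A (U \<inter> fst c) (\<lambda>p. tderiv A (snd c) p (lie_bracket A X Y p))"
    by (intro fun_smooth_from_chart[OF _ o _ cc]) (auto simp: Int_commute)
qed

text \<open>The points where a smooth vector field does not vanish form an open set.\<close>

lemma vfield_zero_of_dense:
  assumes U: "open U" and Z: "vfield_smooth A U Z" and D: "closure D = UNIV"
    and zero: "\<And>q. q \<in> U \<Longrightarrow> q \<in> D \<Longrightarrow> Z q = 0" and p: "p \<in> U"
  shows "Z p = 0"
proof (rule ccontr)
  assume nz: "Z p \<noteq> 0"
  define c where "c = ref_chart A p"
  have c: "c \<in> A" "p \<in> fst c" using ref_chart[of p] by (auto simp: c_def)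
  note cc = compatible[OF c(1)]
  have o: "open (U \<inter> fst c)" using U chart_domain_open c by blast
  let ?z = "\<lambda>q. tderiv A (snd c) q (Z q)"
  have t0: "?z q = 0 \<longleftrightarrow> Z q = 0" if "q \<in> fst c" for q
    using tderiv_inject[OF cc that, of "Z q" 0] linear_0[OF tderiv_linear[OF cc that]] by simp
  have "continuous_on (U \<inter> fst c) ?z"
    by (rule fun_smooth_continuous[OF o vfield_smooth_chart[OF c(1) Z]])
  then have "open ((U \<inter> fst c) \<inter> ?z -` (- {0}))"
    by (intro continuous_open_preimage o) auto
  moreover have "p \<in> (U \<inter> fst c) \<inter> ?z -` (- {0})"
    using p c nz t0 by simp
  ultimately have "((U \<inter> fst c) \<inter> ?z -` (- {0})) \<inter> D \<noteq> {}"
    using D open_Int_closure_eq_empty[of "(U \<inter> fst c) \<inter> ?z -` (- {0})" D] by blast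
  then obtain q where q: "q \<in> D" "q \<in> U" "q \<in> fst c" "?z q \<noteq> 0" by blast
  show False using zero[OF q(2,1)] t0[OF q(3)] q(4) by blast
qed

end

section \<open>Linear algebra of the obstruction\<close>

definition eigenspace_in :: "('e::euclidean_space \<Rightarrow> 'e) \<Rightarrow> 'e set \<Rightarrow> real \<Rightarrow> 'e set" where
  "eigenspace_in J T s = {v \<in> T. J v = s *\<^sub>R v}"

lemma subspace_eigenspace_in: "linear J \<Longrightarrow> subspace T \<Longrightarrow> subspace (eigenspace_in J T s)"
  unfolding eigenspace_in_def subspace_def
  by (auto simp: linear_0 linear_add linear_scale scaleR_add_right)

lemma dim_eigenspaces:
  assumes J: "linear J" and T: "subspace T" and JT: "J ` T \<subseteq> T" and JJ: "\<And>v. v \<in> T \<Longrightarrow> J (J v) = v"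
  shows "dim T = dim (eigenspace_in J T 1) + dim (eigenspace_in J T (-1))"
proof -
  let ?P = "eigenspace_in J T 1" and ?M = "eigenspace_in J T (-1)"
  have sub: "subspace ?P" "subspace ?M" using subspace_eigenspace_in[OF J T] by auto
  have "?P \<inter> ?M = {0}"
  proof -
    have "v = 0" if "v = - v" for v :: 'a 
    proof -
      have "v + v = 0" using that by (metis add.right_inverse)
      then show ?thesis by (simp flip: scaleR_2)
    qed
    then have "?P \<inter> ?M \<subseteq> {0}" unfolding eigenspace_in_def by auto
    then show ?thesis using subspace_0[OF sub(1)] subspace_0[OF sub(2)] by blast
  qed
  moreover have "{x + y |x y. x \<in> ?P \<and> y \<in> ?M} = T"
  proof
    show "{x + y |x y. x \<in> ?P \<and> y \<in> ?M} \<subseteq> T"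
      using subspace_add[OF T] by (auto simp: eigenspace_in_def)
    show "T \<subseteq> {x + y |x y. x \<in> ?P \<and> y \<in> ?M}"
    proof
      fix v assume v: "v \<in> T"
      let ?x = "(1/2) *\<^sub>R (v + J v)" and ?y = "(1/2) *\<^sub>R (v - J v)"
      have "J v \<in> T" using v JT by blast
      then have "?x \<in> T" "?y \<in> T"
        using v T by (auto intro!: subspace_scale subspace_add subspace_diff)
      then have "?x \<in> ?P" "?y \<in> ?M"
        using J JJ[OF v] by (auto simp: eigenspace_in_def linear_scale linear_add linear_diff algebra_simps)
      moreover have "v = ?x + ?y"
        by (simp add: scaleR_add_right[symmetric] del: scaleR_add_right)
      ultimately show "v \<in> {x + y |x y. x \<in> ?P \<and> y \<in> ?M}" by blast
    qed
  qed
  ultimately show ?thesis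
    using dim_sums_Int[OF sub] by simp
qed

text \<open>A basis \<open>W\<close> of \<open>T\<close> turns the pairing into the injective linear map \<open>v \<mapsto> \<Sum>\<^sub>w h v w w\<close> from \<open>S\<close> to \<open>T\<close>.\<close>

lemma dim_le_of_pairing:
  fixes h :: "'e::euclidean_space \<Rightarrow> 'e \<Rightarrow> real"
  assumes h: "bilinear h" and S: "subspace S" and T: "subspace T"
    and nd: "\<And>v. v \<in> S \<Longrightarrow> (\<And>w. w \<in> T \<Longrightarrow> h v w = 0) \<Longrightarrow> v = 0"
  shows "dim S \<le> dim T"
proof -
  obtain W where W: "W \<subseteq> T" "independent W" "T \<subseteq> span W" "card W = dim T"
    using basis_exists by blast
  have fin: "finite W" using W(2) by (rule independent_imp_finite)
  define \<Phi> where "\<Phi> v = (\<Sum>w\<in>W. h v w *\<^sub>R w)" for v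
  have lin: "linear \<Phi>"
  proof (rule linearI)
    show "\<Phi> (a + b) = \<Phi> a + \<Phi> b" for a b
      by (simp add: \<Phi>_def bilinear_ladd[OF h] scaleR_add_left sum.distrib)
    show "\<Phi> (r *\<^sub>R a) = r *\<^sub>R \<Phi> a" for r a
      by (simp add: \<Phi>_def bilinear_lmul[OF h] scaleR_sum_right)
  qed
  have "inj_on \<Phi> S"
    unfolding linear_inj_on_iff_eq_0[OF lin S]
  proof (intro ballI impI)
    fix v assume v: "v \<in> S" "\<Phi> v = 0"
    have hW: "h v w = 0" if "w \<in> W" for w
      using independentD[OF W(2) fin subset_refl, of "h v" w] v(2) that by (simp add: \<Phi>_def)
    show "v = 0"
    proof (rule nd[OF v(1)])
      fix w assume "w \<in> T"
      then have "w \<in> span W" using W(3) by blast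
      then show "h v w = 0"
        by (induction rule: span_induct_alt) (auto simp: bilinear_rzero[OF h] bilinear_radd[OF h] bilinear_rmul[OF h] hW)
    qed
  qed
  then have "dim (\<Phi> ` S) = dim S"
    using dim_image_eq[OF lin, of S] unfolding span_eq_iff[THEN iffD2, OF S] by blast
  moreover have "\<Phi> ` S \<subseteq> T"
    unfolding \<Phi>_def using T W(1) by (auto intro!: subspace_sum subspace_scale)
  ultimately show ?thesis
    using dim_subset by metis
qed

text \<open>Both eigenspaces of a skew-symmetric involution are isotropic, so a non-degenerate form pairs them
  without kernel.\<close>

lemma dim_eigenspaces_skew:
  fixes h :: "'e::euclidean_space \<Rightarrow> 'e \<Rightarrow> real"
  assumes h: "bilinear h" and J: "linear J" and T: "subspace T" and JT: "J ` T \<subseteq> T"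
    and JJ: "\<And>v. v \<in> T \<Longrightarrow> J (J v) = v"
    and skew: "\<And>v w. h (J v) w = - h v (J w)"
    and nd: "\<And>v. v \<in> T \<Longrightarrow> (\<And>w. w \<in> T \<Longrightarrow> h v w = 0) \<Longrightarrow> v = 0"
  shows "dim (eigenspace_in J T 1) = dim (eigenspace_in J T (-1))"
proof -
  have isotropic: "h v w = 0" if "v \<in> eigenspace_in J T s" "w \<in> eigenspace_in J T s" "s \<noteq> 0" for v w s
  proof -
    have "s * h v w = - (s * h v w)"
      using skew[of v w] that by (simp add: eigenspace_in_def bilinear_lmul[OF h] bilinear_rmul[OF h])
    then show ?thesis using that(3) by simp
  qed
  have le: "dim (eigenspace_in J T s) \<le> dim (eigenspace_in J T (-s))" if s: "s = 1 \<or> s = -1" for s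
  proof (rule dim_le_of_pairing[OF h subspace_eigenspace_in[OF J T] subspace_eigenspace_in[OF J T]])
    fix v assume v: "v \<in> eigenspace_in J T s" "\<And>w. w \<in> eigenspace_in J T (-s) \<Longrightarrow> h v w = 0"
    show "v = 0"
    proof (rule nd)
      show "v \<in> T" using v(1) by (simp add: eigenspace_in_def)
      fix w assume w: "w \<in> T"
      let ?x = "(1/2) *\<^sub>R (w + s *\<^sub>R J w)" and ?y = "(1/2) *\<^sub>R (w - s *\<^sub>R J w)"
      have "J w \<in> T" using w JT by blast
      then have "?x \<in> T" "?y \<in> T"
        using w T by (auto intro!: subspace_scale subspace_add subspace_diff)
      moreover have "s * s = 1" using s by auto
      ultimately have "?x \<in> eigenspace_in J T s" "?y \<in> eigenspace_in J T (-s)"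
        using J JJ[OF w] by (auto simp: eigenspace_in_def linear_scale linear_add linear_diff algebra_simps)
      then have "h v (?x + ?y) = 0"
        using isotropic[OF v(1), of ?x] v(2)[of ?y] s by (auto simp: bilinear_radd[OF h])
      moreover have "?x + ?y = w"
        by (simp add: scaleR_add_right[symmetric] del: scaleR_add_right)
      ultimately show "h v w = 0" by simp
    qed
  qed
  show ?thesis using le[of 1] le[of "-1"] by simp
qed

text \<open>The covector \<open>\<psi>\<close> of an almost \<open>\<epsilon>\<close>-Hermitian submanifold satisfies the hypothesis with \<open>T\<close> the
  tangent space; \<open>S\<close> is the zero space if the structure is integrable at the point, and the maximal
  \<open>Q\<close>-invariant subspace in general.  If \<open>\<psi> X \<noteq> 0\<close>, the hypothesis expresses every \<open>Y \<in> T\<close> modulo \<open>S\<close>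
  through \<open>X\<close> and \<open>J X\<close>, so \<open>S\<close> has codimension at most 2.  For \<open>\<epsilon> = 1\<close> the coefficient of \<open>Y\<close> may fail to
  be invertible and the same argument is applied to the eigenspaces.\<close>

lemma covector_vanishes:
  fixes J :: "'e::euclidean_space \<Rightarrow> 'e" and \<psi> :: "'e \<Rightarrow> real"
  assumes eps: "\<epsilon> \<in> {-1, 1 :: real}" and J: "linear J" and JJ: "\<And>v. J (J v) = \<epsilon> *\<^sub>R v"
    and T: "subspace T" "J ` T \<subseteq> T" and S: "subspace S" "J ` S \<subseteq> S" "S \<subseteq> T"
    and \<psi>: "linear \<psi>"
    and rel: "\<And>X Y. X \<in> T \<Longrightarrow> Y \<in> T \<Longrightarrow>
      \<psi> Y *\<^sub>R X + (\<epsilon> * \<psi> (J Y)) *\<^sub>R J X - \<psi> X *\<^sub>R Y - (\<epsilon> * \<psi> (J X)) *\<^sub>R J Y \<in> S"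
    and dim: "dim T > dim S + 2"
    and eigen: "\<epsilon> = 1 \<Longrightarrow> dim (eigenspace_in J T 1) = dim (eigenspace_in J T (-1))"
      "\<epsilon> = 1 \<Longrightarrow> dim (eigenspace_in J S 1) = dim (eigenspace_in J S (-1))"
    and X: "X \<in> T"
  shows "\<psi> X = 0"
proof (rule ccontr)
  assume nz: "\<psi> X \<noteq> 0"
  show False
  proof (cases "\<epsilon> = 1")
    case False
    then have e: "\<epsilon> = -1" using eps by simp
    let ?a = "\<psi> X" and ?b = "\<psi> (J X)"
    let ?M = "span (insert X (insert (J X) S))"
    have M: "J v \<in> ?M" if "v \<in> ?M" for v
    proof -
      have "J ` ?M = span (J ` insert X (insert (J X) S))" by (rule linear_span_image[OF J, symmetric])
      also have "\<dots> \<subseteq> ?M"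
      proof (rule span_minimal)
        have "J (J X) \<in> ?M" unfolding JJ by (intro span_scale span_base) simp
        moreover have "J ` S \<subseteq> ?M" using S(2) span_superset by fastforce
        ultimately show "J ` insert X (insert (J X) S) \<subseteq> ?M"
          using span_base[of "J X" "insert X (insert (J X) S)"] by auto
      qed simp
      finally show ?thesis using that by blast
    qed
    have "T \<subseteq> ?M"
    proof
      fix Y assume Y: "Y \<in> T"
      let ?P = "\<psi> Y *\<^sub>R X + (\<epsilon> * \<psi> (J Y)) *\<^sub>R J X - \<psi> X *\<^sub>R Y - (\<epsilon> * \<psi> (J X)) *\<^sub>R J Y"
      have P: "?P \<in> ?M" using rel[OF X Y] by (intro span_base) simp
      have "X \<in> ?M" "J X \<in> ?M" by (intro span_base, simp)+
      then have "\<psi> Y *\<^sub>R X + (\<epsilon> * \<psi> (J Y)) *\<^sub>R J X - ?P \<in> ?M"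
        by (intro span_diff[OF _ P] span_add span_scale)
      moreover have "\<psi> Y *\<^sub>R X + (\<epsilon> * \<psi> (J Y)) *\<^sub>R J X - ?P = ?a *\<^sub>R Y - ?b *\<^sub>R J Y"
        by (simp add: e)
      ultimately have Z: "?a *\<^sub>R Y - ?b *\<^sub>R J Y \<in> ?M" by simp
      \<comment> \<open>\<open>(a + b J) (a - b J) = a\<^sup>2 + b\<^sup>2\<close> because \<open>J\<^sup>2 = -1\<close>\<close>
      have "?a *\<^sub>R (?a *\<^sub>R Y - ?b *\<^sub>R J Y) + ?b *\<^sub>R J (?a *\<^sub>R Y - ?b *\<^sub>R J Y) \<in> ?M"
        by (intro span_add span_scale Z M)
      moreover have "?a *\<^sub>R (?a *\<^sub>R Y - ?b *\<^sub>R J Y) + ?b *\<^sub>R J (?a *\<^sub>R Y - ?b *\<^sub>R J Y) = (?a * ?a + ?b * ?b) *\<^sub>R Y"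
        using J JJ[of Y] e by (simp add: linear_diff linear_scale algebra_simps)
      ultimately have "(1 / (?a * ?a + ?b * ?b)) *\<^sub>R ((?a * ?a + ?b * ?b) *\<^sub>R Y) \<in> ?M"
        by (simp only: span_scale)
      moreover have "?a * ?a + ?b * ?b \<noteq> 0" using nz by (simp add: sum_squares_eq_zero_iff)
      then have "(1 / (?a * ?a + ?b * ?b)) *\<^sub>R ((?a * ?a + ?b * ?b) *\<^sub>R Y) = Y"
        by (simp only: scaleR_scaleR) auto
      ultimately show "Y \<in> ?M" by (simp only:)
    qed
    then have "dim T \<le> dim (insert X (insert (J X) S))"
      using dim_subset[of T ?M] dim_span by metis
    also have "\<dots> \<le> dim S + 2" by (simp add: dim_insert)
    finally show False using dim by simp
  next
    case True
    have lin: "\<psi> (a *\<^sub>R v + b *\<^sub>R w) = a * \<psi> v + b * \<psi> w" for a b v w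
      using \<psi> by (simp add: linear_add linear_scale)
    have "\<exists>s Z. s \<in> {1, -1} \<and> Z \<in> eigenspace_in J T s \<and> \<psi> Z \<noteq> 0"
    proof (rule ccontr)
      assume no: "\<not> ?thesis"
      have JX: "J X \<in> T" using X T(2) by blast
      let ?x = "X + J X" and ?y = "X - J X"
      have "?x \<in> eigenspace_in J T 1" "?y \<in> eigenspace_in J T (-1)"
        using X JX T J JJ[of X] True
        by (auto simp: eigenspace_in_def linear_add linear_diff intro: subspace_add subspace_diff)
      then have "\<psi> ?x = 0" "\<psi> ?y = 0" using no by auto
      then have "\<psi> X = 0" using \<psi> by (simp add: linear_add linear_diff)
      then show False using nz by simp
    qed
    then obtain s Z where s: "s \<in> {1, -1}" and Z: "Z \<in> eigenspace_in J T s" "\<psi> Z \<noteq> 0" by blast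
    have ss: "s * s = 1" using s by auto
    have "eigenspace_in J T s \<subseteq> span (insert Z (eigenspace_in J S s))"
    proof
      fix Y assume Y: "Y \<in> eigenspace_in J T s"
      have ZT: "Z \<in> T" "J Z = s *\<^sub>R Z" and YT: "Y \<in> T" "J Y = s *\<^sub>R Y"
        using Z Y by (auto simp: eigenspace_in_def)
      let ?P = "(2 * \<psi> Y) *\<^sub>R Z - (2 * \<psi> Z) *\<^sub>R Y"
      have "\<psi> Y *\<^sub>R Z + (s * \<psi> Y) *\<^sub>R (s *\<^sub>R Z) - \<psi> Z *\<^sub>R Y - (s * \<psi> Z) *\<^sub>R (s *\<^sub>R Y) \<in> S"
        using rel[OF ZT(1) YT(1)] \<psi> by (simp add: ZT(2) YT(2) True linear_scale)
      moreover have "\<psi> Y *\<^sub>R Z + (s * \<psi> Y) *\<^sub>R (s *\<^sub>R Z) - \<psi> Z *\<^sub>R Y - (s * \<psi> Z) *\<^sub>R (s *\<^sub>R Y) = ?P"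
      proof -
        have "(s * a) *\<^sub>R (s *\<^sub>R v) = a *\<^sub>R v" for a and v :: 'e
        proof -
          have "s * a * s = (s * s) * a" by (simp only: ac_simps)
          then show ?thesis by (simp add: ss)
        qed
        then show ?thesis by (simp only: mult_2 scaleR_left_distrib) (simp only: algebra_simps)
      qed
      ultimately have P: "?P \<in> S" by simp
      have "?P \<in> eigenspace_in J S s"
        using P J by (simp add: eigenspace_in_def linear_diff linear_scale ZT(2) YT(2) scaleR_diff_right mult.commute)
      then have "(\<psi> Y / \<psi> Z) *\<^sub>R Z - (1 / (2 * \<psi> Z)) *\<^sub>R ?P \<in> span (insert Z (eigenspace_in J S s))"
        by (intro span_diff span_scale span_base) auto
      moreover have "(\<psi> Y / \<psi> Z) *\<^sub>R Z - (1 / (2 * \<psi> Z)) *\<^sub>R ?P = Y"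
        using Z(2) by (simp add: scaleR_diff_right)
      ultimately show "Y \<in> span (insert Z (eigenspace_in J S s))" by simp
    qed
    then have "dim (eigenspace_in J T s) \<le> dim (insert Z (eigenspace_in J S s))"
      using dim_subset dim_span by metis
    also have "\<dots> \<le> dim (eigenspace_in J S s) + 1" by (simp add: dim_insert)
    finally have "dim (eigenspace_in J T s) \<le> dim (eigenspace_in J S s) + 1" .
    moreover have "dim T = 2 * dim (eigenspace_in J T s)" "dim S = 2 * dim (eigenspace_in J S s)"
      using dim_eigenspaces[OF J T] dim_eigenspaces[OF J S(1,2)] JJ True eigen[OF True] s by auto
    ultimately show False using dim by simp
  qed
qed

section \<open>Real analytic functions along segments\<close>

text \<open>The radius 2 leaves room around the unit interval, so that the identity theorem carries the vanishing
  of such a function near 0 over to 1.\<close>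

definition extends_to_disc :: "(real \<Rightarrow> real) \<Rightarrow> bool" where
  "extends_to_disc q \<longleftrightarrow> (\<exists>h. h holomorphic_on ball 0 2 \<and> (\<forall>t. \<bar>t\<bar> < 2 \<longrightarrow> h (of_real t) = of_real (q t)))"

lemma extends_to_disc_add: "extends_to_disc q \<Longrightarrow> extends_to_disc q' \<Longrightarrow> extends_to_disc (\<lambda>t. q t + q' t)"
proof -
  assume "extends_to_disc q" "extends_to_disc q'"
  then obtain h h' where "h holomorphic_on ball 0 2" "\<And>t. \<bar>t\<bar> < 2 \<Longrightarrow> h (of_real t) = of_real (q t)"
    "h' holomorphic_on ball 0 2" "\<And>t. \<bar>t\<bar> < 2 \<Longrightarrow> h' (of_real t) = of_real (q' t)"
    unfolding extends_to_disc_def by auto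
  then show "extends_to_disc (\<lambda>t. q t + q' t)"
    unfolding extends_to_disc_def
    by (intro exI[of _ "\<lambda>z. h z + h' z"] conjI allI impI holomorphic_on_add) simp_all
qed

lemma extends_to_disc_diff: "extends_to_disc q \<Longrightarrow> extends_to_disc q' \<Longrightarrow> extends_to_disc (\<lambda>t. q t - q' t)"
proof -
  assume "extends_to_disc q" "extends_to_disc q'"
  then obtain h h' where "h holomorphic_on ball 0 2" "\<And>t. \<bar>t\<bar> < 2 \<Longrightarrow> h (of_real t) = of_real (q t)"
    "h' holomorphic_on ball 0 2" "\<And>t. \<bar>t\<bar> < 2 \<Longrightarrow> h' (of_real t) = of_real (q' t)"
    unfolding extends_to_disc_def by auto
  then show "extends_to_disc (\<lambda>t. q t - q' t)"
    unfolding extends_to_disc_def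
    by (intro exI[of _ "\<lambda>z. h z - h' z"] conjI allI impI holomorphic_on_diff) simp_all
qed

lemma extends_to_disc_mult: "extends_to_disc q \<Longrightarrow> extends_to_disc q' \<Longrightarrow> extends_to_disc (\<lambda>t. q t * q' t)"
proof -
  assume "extends_to_disc q" "extends_to_disc q'"
  then obtain h h' where "h holomorphic_on ball 0 2" "\<And>t. \<bar>t\<bar> < 2 \<Longrightarrow> h (of_real t) = of_real (q t)"
    "h' holomorphic_on ball 0 2" "\<And>t. \<bar>t\<bar> < 2 \<Longrightarrow> h' (of_real t) = of_real (q' t)"
    unfolding extends_to_disc_def by auto
  then show "extends_to_disc (\<lambda>t. q t * q' t)"
    unfolding extends_to_disc_def
    by (intro exI[of _ "\<lambda>z. h z * h' z"] conjI allI impI holomorphic_on_mult) simp_all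
qed

lemma extends_to_disc_zero: "extends_to_disc (\<lambda>t. 0)"
  unfolding extends_to_disc_def by (intro exI[of _ "\<lambda>t. 0"]) simp

lemma extends_to_disc_sum:
  "finite I \<Longrightarrow> (\<And>i. i \<in> I \<Longrightarrow> extends_to_disc (q i)) \<Longrightarrow> extends_to_disc (\<lambda>t. \<Sum>i\<in>I. q i t)"
  by (induction I rule: finite_induct) (simp_all add: extends_to_disc_zero extends_to_disc_add)

lemma extends_to_disc_cong:
  "extends_to_disc q \<Longrightarrow> (\<And>t. \<bar>t\<bar> < 2 \<Longrightarrow> q t = q' t) \<Longrightarrow> extends_to_disc q'"
  unfolding extends_to_disc_def by simp

lemma extends_to_disc_identity:
  assumes q: "extends_to_disc q" and d: "d > 0" "\<And>t. \<bar>t\<bar> < d \<Longrightarrow> q t = 0"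
  shows "q 1 = 0"
proof -
  obtain h where h: "h holomorphic_on ball 0 2" "\<And>t. \<bar>t\<bar> < 2 \<Longrightarrow> h (of_real t) = of_real (q t)"
    using q unfolding extends_to_disc_def by blast
  let ?U = "(of_real :: real \<Rightarrow> complex) ` {t. \<bar>t\<bar> < min d 2}"
  have "h 1 = 0"
  proof (rule analytic_continuation[OF h(1) open_ball connected_ball, of ?U 0])
    show "?U \<subseteq> ball 0 2" by auto
    show "(0::complex) islimpt ?U"
      unfolding islimpt_approachable
    proof (intro allI impI)
      fix e :: real assume e: "e > 0"
      define t where "t = min (min d 2) e / 2"
      have t: "0 < t" "t < d" "t < 2" "t < e" using d(1) e by (auto simp: t_def)
      then have "complex_of_real t \<in> ?U" by (intro imageI) simp
      moreover have "complex_of_real t \<noteq> 0" "dist (complex_of_real t) 0 < e" using t by simp_all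
      ultimately show "\<exists>x'\<in>?U. x' \<noteq> 0 \<and> dist x' 0 < e" by blast
    qed
    show "h z = 0" if "z \<in> ?U" for z
      using that h(2) d(2) by auto
  qed auto
  then show ?thesis using h(2)[of 1] by simp
qed

text \<open>Near the centre of a power series, its restriction to a segment and the directional
  derivatives along the segment extend to the disc: substitute a complex parameter into the series
  and use locally uniform convergence.\<close>

lemma power_series_extends_to_disc:
  fixes A :: "('e::euclidean_space \<Rightarrow> nat) \<Rightarrow> real" and \<phi> :: "'e \<Rightarrow> real"
  assumes \<rho>: "\<rho> > 0"
    and sum: "\<And>y. y \<in> U \<Longrightarrow> ((\<lambda>\<alpha>. A \<alpha> * (\<Prod>b\<in>Basis. ((y - x) \<bullet> b) ^ \<alpha> b)) has_sum \<phi> y) (PiE Basis (\<lambda>_. UNIV))"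
    and M: "(\<lambda>\<alpha>. \<bar>A \<alpha>\<bar> * (\<Prod>b\<in>Basis. \<rho> ^ \<alpha> b)) summable_on (PiE Basis (\<lambda>_. UNIV))"
    and U: "open U"
    and p: "\<And>b. b \<in> Basis \<Longrightarrow> \<bar>(p - x) \<bullet> b\<bar> \<le> \<rho> / 8" and v: "\<And>b. b \<in> Basis \<Longrightarrow> \<bar>v \<bullet> b\<bar> \<le> \<rho> / 4"
    and seg: "\<And>t. \<bar>t\<bar> < 2 \<Longrightarrow> p + t *\<^sub>R v \<in> U"
  shows "extends_to_disc (\<lambda>t. \<phi> (p + t *\<^sub>R v))"
    and "\<lbrakk>\<And>t. \<bar>t\<bar> < 2 \<Longrightarrow> (\<phi> has_derivative D t) (at (p + t *\<^sub>R v))\<rbrakk> \<Longrightarrow> extends_to_disc (\<lambda>t. D t d)"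
proof -
  let ?I = "PiE Basis (\<lambda>_. UNIV) :: ('e \<Rightarrow> nat) set"
  let ?F = "finite_subsets_at_top ?I"
  let ?M = "\<lambda>\<alpha>. \<bar>A \<alpha>\<bar> * (\<Prod>b\<in>Basis. \<rho> ^ \<alpha> b)"
  define lin where "lin w t s b = of_real ((p - x) \<bullet> b) + t * of_real (v \<bullet> b) + s * of_real (w \<bullet> b)"
    for w :: 'e and t s :: complex and b
  define summand where "summand w \<alpha> t s = of_real (A \<alpha>) * (\<Prod>b\<in>Basis. lin w t s b ^ \<alpha> b)" for w \<alpha> t s
  have norm_lin: "norm (lin w t s b) \<le> \<rho>"
    if "norm t \<le> 2" "norm s * \<bar>w \<bullet> b\<bar> \<le> \<rho> / 8" "b \<in> Basis" for w t s b
  proof -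
    have "norm (lin w t s b) \<le> \<bar>(p - x) \<bullet> b\<bar> + norm t * \<bar>v \<bullet> b\<bar> + norm s * \<bar>w \<bullet> b\<bar>"
      unfolding lin_def by (intro norm_triangle_le add_mono) (auto simp: norm_mult)
    also have "\<dots> \<le> \<rho> / 8 + 2 * (\<rho> / 4) + \<rho> / 8"
      using that p[OF that(3)] v[OF that(3)] by (intro add_mono mult_mono) auto
    finally show ?thesis using \<rho> by simp
  qed
  have norm_term: "norm (summand w \<alpha> t s) \<le> ?M \<alpha>"
    if "norm t \<le> 2" "\<And>b. b \<in> Basis \<Longrightarrow> norm s * \<bar>w \<bullet> b\<bar> \<le> \<rho> / 8" for w \<alpha> t s
    unfolding summand_def norm_mult prod_norm[symmetric] norm_power norm_of_real
    using norm_lin[OF that(1) that(2)]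
    by (intro mult_left_mono prod_mono conjI power_mono) auto
  have ntF: "?F \<noteq> bot" by (rule finite_subsets_at_top_neq_bot)
  have term_real: "((\<lambda>\<alpha>. summand w \<alpha> (of_real t) (of_real s)) has_sum of_real (\<phi> (p + t *\<^sub>R v + s *\<^sub>R w))) ?I"
    if "p + t *\<^sub>R v + s *\<^sub>R w \<in> U" for w t s
  proof -
    have "summand w \<alpha> (of_real t) (of_real s) =
        of_real (A \<alpha> * (\<Prod>b\<in>Basis. ((p + t *\<^sub>R v + s *\<^sub>R w - x) \<bullet> b) ^ \<alpha> b))" for \<alpha>
      by (simp add: summand_def lin_def inner_diff_left inner_add_left algebra_simps)
    note eq = this
    show ?thesis
      using has_sum_of_real[OF sum[OF that], where 'a = complex] by (simp only: eq)
  qed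
  have hol_term: "(\<lambda>t. summand w \<alpha> t s) holomorphic_on S" "(\<lambda>s. summand w \<alpha> t s) holomorphic_on S" for w \<alpha> t s S
    unfolding summand_def lin_def by (intro holomorphic_intros)+
  show "extends_to_disc (\<lambda>t. \<phi> (p + t *\<^sub>R v))"
    unfolding extends_to_disc_def
  proof (intro exI[of _ "\<lambda>t. \<Sum>\<^sub>\<infinity>\<alpha>\<in>?I. summand 0 \<alpha> t 0"] conjI allI impI)
    have ul: "uniform_limit (cball 0 2) (\<lambda>X t. \<Sum>\<alpha>\<in>X. summand 0 \<alpha> t 0) (\<lambda>t. \<Sum>\<^sub>\<infinity>\<alpha>\<in>?I. summand 0 \<alpha> t 0) ?F"
      by (rule Weierstrass_m_test_general[OF norm_term M]) (use \<rho> in auto)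
    have ev: "\<forall>\<^sub>F X in ?F. continuous_on (cball 0 2) (\<lambda>t. \<Sum>\<alpha>\<in>X. summand 0 \<alpha> t 0) \<and>
        (\<lambda>t. \<Sum>\<alpha>\<in>X. summand 0 \<alpha> t 0) holomorphic_on ball 0 2"
      by (intro always_eventually allI conjI holomorphic_on_sum hol_term holomorphic_on_imp_continuous_on)
    show "(\<lambda>t. \<Sum>\<^sub>\<infinity>\<alpha>\<in>?I. summand 0 \<alpha> t 0) holomorphic_on ball 0 2"
      by (rule holomorphic_uniform_limit[OF ev ul ntF])
    fix t :: real assume "\<bar>t\<bar> < 2"
    then show "(\<Sum>\<^sub>\<infinity>\<alpha>\<in>?I. summand 0 \<alpha> (of_real t) 0) = of_real (\<phi> (p + t *\<^sub>R v))"
      using infsumI[OF term_real[of t 0 0]] seg by simp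
  qed
  assume D: "\<And>t. \<bar>t\<bar> < 2 \<Longrightarrow> (\<phi> has_derivative D t) (at (p + t *\<^sub>R v))"
  \<comment> \<open>a radius for which the parameter in the direction \<open>d\<close> does not leave the polydisc\<close>
  define \<sigma> where "\<sigma> = \<rho> / (8 * (norm d + 1))"
  have \<sigma>: "\<sigma> > 0" using \<rho> by (simp add: \<sigma>_def add_nonneg_pos)
  have \<sigma>d: "r * \<bar>d \<bullet> b\<bar> \<le> \<rho> / 8" if "r \<le> \<sigma>" "0 \<le> r" "b \<in> Basis" for r b
  proof -
    have "r * \<bar>d \<bullet> b\<bar> \<le> \<sigma> * (norm d + 1)"
      using that Basis_le_norm[OF that(3), of d] \<sigma> by (intro mult_mono) auto
    also have "\<dots> = \<rho> / 8" using add_nonneg_pos[OF norm_ge_zero[of d], of 1] by (simp add: \<sigma>_def field_simps)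
    finally show ?thesis .
  qed
  define dterm where "dterm \<alpha> t s = of_real (A \<alpha>) * (\<Sum>b\<in>Basis. (of_nat (\<alpha> b) * lin d t s b ^ (\<alpha> b - 1) * of_real (d \<bullet> b)) *
      (\<Prod>c\<in>Basis - {b}. lin d t s c ^ \<alpha> c))" for \<alpha> t s
  have dterm: "((\<lambda>s. summand d \<alpha> t s) has_field_derivative dterm \<alpha> t s) (at s)" for \<alpha> t s
  proof -
    have "((\<lambda>s. lin d t s b ^ \<alpha> b) has_field_derivative (of_nat (\<alpha> b) * lin d t s b ^ (\<alpha> b - 1) * of_real (d \<bullet> b))) (at s)" for b
      unfolding lin_def by (auto intro!: derivative_eq_intros)
    then show ?thesis
      unfolding summand_def dterm_def by (intro DERIV_cmult has_field_derivative_prod)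
  qed
  \<comment> \<open>the differentiated series is dominated as well, by the Cauchy inequality on the circle of radius \<open>\<sigma>\<close>\<close>
  have norm_dterm: "norm (dterm \<alpha> t 0) \<le> ?M \<alpha> * (1 / \<sigma>)" if t: "norm t \<le> 2" for \<alpha> t
  proof -
    have "norm ((deriv ^^ 1) (\<lambda>s. summand d \<alpha> t s) 0) \<le> fact 1 * ?M \<alpha> / \<sigma> ^ 1"
    proof (rule Cauchy_inequality[OF hol_term(2) holomorphic_on_imp_continuous_on[OF hol_term(2)] \<sigma>])
      fix s :: complex assume "norm (0 - s) = \<sigma>"
      then show "norm (summand d \<alpha> t s) \<le> ?M \<alpha>"
        by (intro norm_term t \<sigma>d) auto
    qed
    then show ?thesis using DERIV_imp_deriv[OF dterm] by simp
  qed
  show "extends_to_disc (\<lambda>t. D t d)"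
    unfolding extends_to_disc_def
  proof (intro exI[of _ "\<lambda>t. \<Sum>\<^sub>\<infinity>\<alpha>\<in>?I. dterm \<alpha> t 0"] conjI allI impI)
    have Md: "(\<lambda>\<alpha>. ?M \<alpha> * (1 / \<sigma>)) summable_on ?I"
      using M by (rule summable_on_cmult_left)
    have ul: "uniform_limit (cball 0 2) (\<lambda>X t. \<Sum>\<alpha>\<in>X. dterm \<alpha> t 0) (\<lambda>t. \<Sum>\<^sub>\<infinity>\<alpha>\<in>?I. dterm \<alpha> t 0) ?F"
      by (rule Weierstrass_m_test_general[OF norm_dterm Md]) auto
    have "(\<lambda>t. dterm \<alpha> t 0) holomorphic_on S" for \<alpha> S
      unfolding dterm_def lin_def by (intro holomorphic_intros)
    then have ev: "\<forall>\<^sub>F X in ?F. continuous_on (cball 0 2) (\<lambda>t. \<Sum>\<alpha>\<in>X. dterm \<alpha> t 0) \<and>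
        (\<lambda>t. \<Sum>\<alpha>\<in>X. dterm \<alpha> t 0) holomorphic_on ball 0 2"
      by (intro always_eventually allI conjI holomorphic_on_sum holomorphic_on_imp_continuous_on)
    show "(\<lambda>t. \<Sum>\<^sub>\<infinity>\<alpha>\<in>?I. dterm \<alpha> t 0) holomorphic_on ball 0 2"
      by (rule holomorphic_uniform_limit[OF ev ul ntF])
    fix t :: real assume t: "\<bar>t\<bar> < 2"
    let ?z = "of_real t :: complex"
    let ?G = "\<lambda>s. \<Sum>\<^sub>\<infinity>\<alpha>\<in>?I. summand d \<alpha> ?z s"
    have lim: "((\<lambda>X. \<Sum>\<alpha>\<in>X. dterm \<alpha> ?z 0) \<longlongrightarrow> (\<Sum>\<^sub>\<infinity>\<alpha>\<in>?I. dterm \<alpha> ?z 0)) ?F"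
      by (rule tendsto_uniform_limitI[OF ul]) (use t in auto)
    have ulG: "uniform_limit (cball 0 \<sigma>) (\<lambda>X s. \<Sum>\<alpha>\<in>X. summand d \<alpha> ?z s) ?G ?F"
      by (rule Weierstrass_m_test_general[OF norm_term M]) (use t \<sigma>d in auto)
    have evG: "\<forall>\<^sub>F X in ?F. continuous_on (cball 0 \<sigma>) (\<lambda>s. \<Sum>\<alpha>\<in>X. summand d \<alpha> ?z s) \<and>
        (\<forall>w\<in>ball 0 \<sigma>. ((\<lambda>s. \<Sum>\<alpha>\<in>X. summand d \<alpha> ?z s) has_field_derivative (\<Sum>\<alpha>\<in>X. dterm \<alpha> ?z w)) (at w))"
      by (intro always_eventually allI conjI ballI DERIV_sum dterm holomorphic_on_imp_continuous_on holomorphic_on_sum hol_term)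
    obtain G' where G': "\<And>w. w \<in> ball 0 \<sigma> \<Longrightarrow>
        (?G has_field_derivative G' w) (at w) \<and> ((\<lambda>X. \<Sum>\<alpha>\<in>X. dterm \<alpha> ?z w) \<longlongrightarrow> G' w) ?F"
      using has_complex_derivative_uniform_limit[OF evG ulG ntF \<sigma>] by metis
    have G0: "G' 0 = (\<Sum>\<^sub>\<infinity>\<alpha>\<in>?I. dterm \<alpha> ?z 0)"
      using tendsto_unique[OF ntF _ lim, of "G' 0"] G'[of 0] \<sigma> by simp
    have "((\<lambda>s. ?G (of_real s)) has_vector_derivative 1 * G' 0) (at (0::real))"
      using field_vector_diff_chain_at[of of_real 1 "0::real" ?G "G' 0"] G'[of 0] \<sigma>
      by (simp add: o_def has_vector_derivative_def scaleR_conv_of_real bounded_linear_imp_has_derivative bounded_linear_of_real)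
    then have 1: "((\<lambda>s. ?G (of_real s)) has_vector_derivative G' 0) (at (0::real))" by simp
    let ?V = "{s. p + t *\<^sub>R v + s *\<^sub>R d \<in> U}"
    have V: "open ?V" "0 \<in> ?V"
    proof -
      have "open ((\<lambda>s. p + t *\<^sub>R v + s *\<^sub>R d) -` U)"
        by (rule open_vimage[OF U]) (intro continuous_intros)
      then show "open ?V" by (simp add: vimage_def)
    qed (use seg[OF t] in simp)
    have "((\<lambda>s. of_real (\<phi> (p + t *\<^sub>R v + s *\<^sub>R d)) :: complex) has_vector_derivative G' 0) (at 0)"
      by (rule has_vector_derivative_transform_within_open[OF 1 V])
        (use infsumI[OF term_real] in simp)
    moreover have "((\<lambda>s. of_real (\<phi> (p + t *\<^sub>R v + s *\<^sub>R d)) :: complex) has_vector_derivative of_real (D t d)) (at 0)"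
    proof -
      have a: "((\<lambda>s. p + t *\<^sub>R v + s *\<^sub>R d) has_derivative (\<lambda>h. h *\<^sub>R d)) (at 0)"
        by (auto intro!: derivative_eq_intros)
      have "((\<lambda>s. \<phi> (p + t *\<^sub>R v + s *\<^sub>R d)) has_derivative (\<lambda>h. D t (h *\<^sub>R d))) (at 0)"
        by (rule has_derivative_compose[OF a]) (use D[OF t] in simp)
      then have "((\<lambda>s. of_real (\<phi> (p + t *\<^sub>R v + s *\<^sub>R d)) :: complex) has_derivative (\<lambda>h. of_real (D t (h *\<^sub>R d)))) (at 0)"
        by (rule has_derivative_of_real)
      moreover have "D t (h *\<^sub>R d) = h * D t d" for h
        using has_derivative_bounded_linear[OF D[OF t]] bounded_linear.linear linear_scale[of "D t"] by fastforce
      ultimately show ?thesis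
        unfolding has_vector_derivative_def by (simp add: scaleR_conv_of_real)
    qed
    ultimately have "G' 0 = of_real (D t d)"
      by (rule vector_derivative_unique_at)
    then show "(\<Sum>\<^sub>\<infinity>\<alpha>\<in>?I. dterm \<alpha> (of_real t) 0) = of_real (D t d)"
      using G0 by simp
  qed
qed

text \<open>Absolute convergence at a point all of whose coordinates equal \<open>\<rho>\<close> dominates the series on a complex
  polydisc, which contains the short segments near the centre even for complex parameters of modulus 2.\<close>

lemma real_analytic_extends_to_disc:
  fixes \<phi> :: "'e::euclidean_space \<Rightarrow> 'r::euclidean_space"
  assumes \<phi>: "real_analytic_on S \<phi>" and x: "x \<in> S"
  shows "\<exists>\<delta>>0. \<forall>p\<in>ball x \<delta>. \<forall>u\<in>ball x \<delta>. \<forall>k. extends_to_disc (\<lambda>t. \<phi> (p + t *\<^sub>R (u - p)) \<bullet> k) \<and>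
    (\<forall>D d. (\<forall>t. \<bar>t\<bar> < 2 \<longrightarrow> (\<phi> has_derivative D t) (at (p + t *\<^sub>R (u - p)))) \<longrightarrow> extends_to_disc (\<lambda>t. D t d \<bullet> k))"
proof -
  let ?I = "PiE Basis (\<lambda>_. UNIV) :: ('e \<Rightarrow> nat) set"
  obtain r a where r: "r > 0" and a: "\<And>y. y \<in> ball x r \<Longrightarrow>
      ((\<lambda>\<alpha>. (\<Prod>b\<in>Basis. ((y - x) \<bullet> b) ^ \<alpha> b) *\<^sub>R a \<alpha>) has_sum \<phi> y) ?I"
    using \<phi> x unfolding real_analytic_on_def by blast
  define \<rho> where "\<rho> = r / (2 * real DIM('e))"
  have \<rho>: "\<rho> > 0" using r by (simp add: \<rho>_def)
  have sum: "((\<lambda>\<alpha>. (a \<alpha> \<bullet> k) * (\<Prod>b\<in>Basis. ((y - x) \<bullet> b) ^ \<alpha> b)) has_sum \<phi> y \<bullet> k) ?I" if "y \<in> ball x r" for y k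
    using has_sum_bounded_linear[OF bounded_linear_inner_left a[OF that], of k] by (simp add: mult.commute)
  have "(\<lambda>\<alpha>. \<bar>a \<alpha> \<bullet> k\<bar> * (\<Prod>b\<in>Basis. \<rho> ^ \<alpha> b)) summable_on ?I" for k
  proof -
    let ?y = "x + (\<Sum>b\<in>Basis. \<rho> *\<^sub>R b)"
    have "norm (\<Sum>b\<in>Basis. \<rho> *\<^sub>R b :: 'e) \<le> (\<Sum>b\<in>(Basis::'e set). \<rho>)"
      using \<rho> by (intro sum_norm_le) simp
    also have "\<dots> = r / 2" by (simp add: \<rho>_def)
    also have "\<dots> < r" using r by simp
    finally have "?y \<in> ball x r" by (simp add: dist_norm)
    from sum[OF this, of k] have "(\<lambda>\<alpha>. (a \<alpha> \<bullet> k) * (\<Prod>b\<in>Basis. ((?y - x) \<bullet> b) ^ \<alpha> b)) summable_on ?I"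
      by (rule has_sum_imp_summable)
    then have "(\<lambda>\<alpha>. norm ((a \<alpha> \<bullet> k) * (\<Prod>b\<in>Basis. ((?y - x) \<bullet> b) ^ \<alpha> b))) summable_on ?I"
      by (rule summable_on_iff_abs_summable_on_real[THEN iffD1])
    moreover have "norm ((a \<alpha> \<bullet> k) * (\<Prod>b\<in>Basis. ((?y - x) \<bullet> b) ^ \<alpha> b)) = \<bar>a \<alpha> \<bullet> k\<bar> * (\<Prod>b\<in>Basis. \<rho> ^ \<alpha> b)" for \<alpha>
    proof -
      have "(?y - x) \<bullet> b = \<rho>" if "b \<in> Basis" for b :: 'e
        using inner_sum_left_Basis[OF that, of "\<lambda>_. \<rho>"] by simp
      moreover have "(\<Prod>b\<in>(Basis::'e set). \<rho> ^ \<alpha> b) \<ge> 0"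
        using \<rho> by (intro prod_nonneg) simp
      ultimately show ?thesis by (simp add: abs_mult)
    qed
    ultimately show ?thesis by simp
  qed
  note M = this
  define \<delta> where "\<delta> = min (\<rho> / 8) (r / 8)"
  have \<delta>: "\<delta> > 0" using \<rho> r by (simp add: \<delta>_def)
  show ?thesis
  proof (intro exI[of _ \<delta>] conjI ballI allI impI \<delta>)
    fix p u k assume pu: "p \<in> ball x \<delta>" "u \<in> ball x \<delta>"
    have 1: "\<bar>(p - x) \<bullet> b\<bar> \<le> \<rho> / 8" if "b \<in> Basis" for b
      using Basis_le_norm[OF that, of "p - x"] pu(1) by (simp add: \<delta>_def dist_norm norm_minus_commute)
    have nu: "norm (u - p) < 2 * \<delta>"
      using dist_triangle_half_l[of x p "2 * \<delta>" u] pu dist_triangle[of u p x] by (simp add: dist_norm norm_minus_commute)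
    have 2: "\<bar>(u - p) \<bullet> b\<bar> \<le> \<rho> / 4" if "b \<in> Basis" for b
      using Basis_le_norm[OF that, of "u - p"] nu by (simp add: \<delta>_def)
    have 3: "p + t *\<^sub>R (u - p) \<in> ball x r" if "\<bar>t\<bar> < 2" for t
    proof -
      have "norm (p - x + t *\<^sub>R (u - p)) \<le> norm (p - x) + \<bar>t\<bar> * norm (u - p)"
        using norm_triangle_ineq[of "p - x" "t *\<^sub>R (u - p)"] by simp
      also have "\<dots> \<le> \<delta> + 2 * (2 * \<delta>)"
        using pu(1) nu that by (intro add_mono mult_mono) (auto simp: dist_norm norm_minus_commute)
      also have "\<dots> < r" using \<delta> r by (auto simp: \<delta>_def)
      finally show ?thesis by (simp add: dist_norm norm_minus_commute algebra_simps)
    qed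
    show "extends_to_disc (\<lambda>t. \<phi> (p + t *\<^sub>R (u - p)) \<bullet> k)"
      by (rule power_series_extends_to_disc(1)[OF \<rho> sum M open_ball 1 2 3])
    fix D d assume D: "\<forall>t. \<bar>t\<bar> < 2 \<longrightarrow> (\<phi> has_derivative D t) (at (p + t *\<^sub>R (u - p)))"
    show "extends_to_disc (\<lambda>t. D t d \<bullet> k)"
      by (rule power_series_extends_to_disc(2)[OF \<rho> sum M open_ball 1 2 3, where D = "\<lambda>t d. D t d \<bullet> k"])
        (use D in \<open>auto intro: has_derivative_inner_left\<close>)
  qed
qed

section \<open>Triples and adapted bases\<close>

text \<open>Triples are indexed by numerals, so 1 must not be rewritten to \<open>Suc 0\<close>.\<close>

declare One_nat_def [simp del]

definition comb3 :: "(nat \<Rightarrow> 'v::real_vector) \<Rightarrow> (nat \<Rightarrow> real) \<Rightarrow> 'v" where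
  "comb3 J a = a 1 *\<^sub>R J 1 + a 2 *\<^sub>R J 2 + a 3 *\<^sub>R J 3"

text \<open>The bilinear form of signature \<open>(2, 1)\<close> that describes the anticommutators of linear combinations of a
  triple; the square of \<open>comb3 J a\<close> is \<open>form3 eps a a\<close> times the identity.\<close>

definition form3 :: "(nat \<Rightarrow> real) \<Rightarrow> (nat \<Rightarrow> real) \<Rightarrow> (nat \<Rightarrow> real) \<Rightarrow> real" where
  "form3 eps a b = eps 1 * a 1 * b 1 + eps 2 * a 2 * b 2 + eps 3 * a 3 * b 3"

definition unit3 :: "nat \<Rightarrow> nat \<Rightarrow> real" where
  "unit3 k i = (if i = k then 1 else 0)"

lemma comb3_unit: "k \<in> {1, 2, 3} \<Longrightarrow> comb3 J (unit3 k) = J k"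
  by (auto simp: comb3_def unit3_def)

lemma form3_unit: "k \<in> {1, 2, 3} \<Longrightarrow> form3 eps a (unit3 k) = eps k * a k"
  by (auto simp: form3_def unit3_def)

lemma span3_iff: "K \<in> span {J 1, J 2, J (3::nat)} \<longleftrightarrow> (\<exists>a. K = comb3 J a)"
proof
  assume "K \<in> span {J 1, J 2, J 3}"
  then obtain a b c where "K = a *\<^sub>R J 1 + b *\<^sub>R J 2 + c *\<^sub>R J 3"
    by (auto simp: span_insert algebra_simps)
  then show "\<exists>a. K = comb3 J a"
    by (intro exI[of _ "\<lambda>i. if i = 1 then a else if i = 2 then b else c"]) (simp add: comb3_def)
next
  assume "\<exists>a. K = comb3 J a"
  then show "K \<in> span {J 1, J 2, J 3}"
    by (auto simp: comb3_def intro!: span_add span_scale intro: span_base)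
qed

lemma pq_tripleD:
  assumes "pq_triple eps J"
  shows "J 1 (J 1 v) = eps 1 *\<^sub>R v" "J 2 (J 2 v) = eps 2 *\<^sub>R v" "J 3 (J 3 v) = eps 3 *\<^sub>R v"
    and "J 2 (J 1 v) = - J 1 (J 2 v)" "J 3 (J 1 v) = - J 1 (J 3 v)" "J 3 (J 2 v) = - J 2 (J 3 v)"
    and "J 1 (J 2 v) = J 3 v" "J 1 (J 3 v) = eps 1 *\<^sub>R J 2 v" "J 2 (J 3 v) = - eps 2 *\<^sub>R J 1 v"
    and "eps 1 * eps 1 = 1" "eps 2 * eps 2 = 1" "eps 3 * eps 3 = 1"
proof -
  have sq: "J i o\<^sub>L J i = eps i *\<^sub>R id_blinfun" if "i \<in> {1, 2, 3}" for i
    using assms that unfolding pq_triple_def by blast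
  have anti: "J i o\<^sub>L J j = - (J j o\<^sub>L J i)" if "i \<in> {1, 2, 3}" "j \<in> {1, 2, 3}" "i \<noteq> j" for i j
    using assms that unfolding pq_triple_def by blast
  have prod: "J 3 = J 1 o\<^sub>L J 2" using assms unfolding pq_triple_def by blast
  have sq': "J i (J i v) = eps i *\<^sub>R v" if "i \<in> {1, 2, 3}" for i v
    using arg_cong[OF sq[OF that], of "\<lambda>L. blinfun_apply L v"] by (simp add: blinfun.scaleR_left)
  have anti': "J i (J j v) = - J j (J i v)" if "i \<in> {1, 2, 3}" "j \<in> {1, 2, 3}" "i \<noteq> j" for i j v
    using arg_cong[OF anti[OF that], of "\<lambda>L. blinfun_apply L v"] by (simp add: blinfun.minus_left)
  show "J 1 (J 1 v) = eps 1 *\<^sub>R v" "J 2 (J 2 v) = eps 2 *\<^sub>R v" "J 3 (J 3 v) = eps 3 *\<^sub>R v"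
    by (simp_all add: sq')
  show "J 2 (J 1 v) = - J 1 (J 2 v)" "J 3 (J 1 v) = - J 1 (J 3 v)" "J 3 (J 2 v) = - J 2 (J 3 v)"
    using anti'[of 2 1] anti'[of 3 1] anti'[of 3 2] by simp_all
  have p: "J 3 v = J 1 (J 2 v)" for v using prod by simp
  show "J 1 (J 2 v) = J 3 v" by (simp add: p)
  show "J 1 (J 3 v) = eps 1 *\<^sub>R J 2 v" unfolding p using sq'[of 1 "J 2 v"] by simp
  have "J 2 (J 1 (J 2 v)) = - J 1 (J 2 (J 2 v))" using anti'[of 2 1 "J 2 v"] by simp
  then show "J 2 (J 3 v) = - eps 2 *\<^sub>R J 1 v" unfolding p using sq'[of 2 v] by (simp add: blinfun.scaleR_right)
  show "eps 1 * eps 1 = 1" "eps 2 * eps 2 = 1" "eps 3 * eps 3 = 1"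
  proof -
    have "(eps 1, eps 2, eps 3) \<in> {(-1, 1, 1), (1, -1, 1), (1, 1, -1)}"
      using assms unfolding pq_triple_def by (rule conjunct1)
    then show "eps 1 * eps 1 = 1" "eps 2 * eps 2 = 1" "eps 3 * eps 3 = 1" by auto
  qed
qed

lemma comb3_product:
  assumes "pq_triple eps J"
  shows "comb3 J a (comb3 J b v) = form3 eps a b *\<^sub>R v +
    comb3 J (\<lambda>i. if i = 1 then - eps 2 * (a 2 * b 3 - a 3 * b 2) else if i = 2 then eps 1 * (a 1 * b 3 - a 3 * b 1)
      else a 1 * b 2 - a 2 * b 1) v"
  unfolding comb3_def form3_def
  by (simp add: blinfun.add_left blinfun.add_right blinfun.diff_left blinfun.scaleR_left blinfun.scaleR_right
      blinfun.minus_left pq_tripleD[OF assms] algebra_simps)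

lemma comb3_anticommutator:
  assumes "pq_triple eps J"
  shows "comb3 J a (comb3 J b v) + comb3 J b (comb3 J a v) = (2 * form3 eps a b) *\<^sub>R v"
  unfolding comb3_product[OF assms] mult_2 scaleR_left_distrib
  by (simp add: comb3_def form3_def blinfun.add_left blinfun.diff_left blinfun.scaleR_left algebra_simps)

text \<open>The anticommutator with \<open>J k\<close> isolates the coefficient of \<open>J k\<close>.\<close>

lemma comb3_eqD:
  fixes J :: "nat \<Rightarrow> 'e::euclidean_space \<Rightarrow>\<^sub>L 'e"
  assumes J: "pq_triple eps J" and eq: "comb3 J a = comb3 J b" and k: "k \<in> {1, 2, 3}"
  shows "a k = b k"
proof -
  obtain v :: 'e where v: "v \<noteq> 0" using nonzero_Basis by blast
  have "(2 * form3 eps a (unit3 k)) *\<^sub>R v = (2 * form3 eps b (unit3 k)) *\<^sub>R v"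
    unfolding comb3_anticommutator[OF J, symmetric] eq ..
  then have "eps k * a k = eps k * b k"
    using v form3_unit[OF k] by simp
  moreover have "eps k \<noteq> 0" using pq_tripleD(10-12)[OF J] k by auto
  ultimately show ?thesis by simp
qed

lemma pq_triple_independent:
  fixes J :: "nat \<Rightarrow> 'e::euclidean_space \<Rightarrow>\<^sub>L 'e"
  assumes J: "pq_triple eps J"
  shows "independent {J 1, J 2, J 3}" "card {J 1, J 2, J 3} = 3"
proof -
  have ne: "J i \<noteq> J j" if "i \<in> {1, 2, 3}" "j \<in> {1, 2, 3}" "i \<noteq> j" for i j
    using comb3_eqD[OF J, of "unit3 i" "unit3 j" i] comb3_unit[OF that(1), of J] comb3_unit[OF that(2), of J] that
    by (auto simp: unit3_def)
  then have d: "J 1 \<noteq> J 2" "J 1 \<noteq> J 3" "J 2 \<noteq> J 3" by simp_all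
  then show "card {J 1, J 2, J 3} = 3" by simp
  show "independent {J 1, J 2, J 3}"
  proof
    assume "dependent {J 1, J 2, J 3}"
    then obtain u where u: "\<exists>v\<in>{J 1, J 2, J 3}. u v \<noteq> 0" "(\<Sum>v\<in>{J 1, J 2, J 3}. u v *\<^sub>R v) = 0"
      using dependent_finite[of "{J 1, J 2, J 3}"] by auto
    then have "comb3 J (\<lambda>i. u (J i)) = comb3 J (\<lambda>i. 0)"
      using d by (simp add: comb3_def add.assoc)
    then have "u (J k) = 0" if "k \<in> {1, 2, 3}" for k
      using comb3_eqD[OF J] that by fastforce
    then show False using u(1) by auto
  qed
qed

text \<open>A fourth independent element would contradict that three elements span.\<close>

lemma span_pq_triples:
  fixes J J' :: "nat \<Rightarrow> 'e::euclidean_space \<Rightarrow>\<^sub>L 'e"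
  assumes J: "pq_triple eps J" and J': "pq_triple eps' J'"
    and sub: "J' 1 \<in> span {J 1, J 2, J 3}" "J' 2 \<in> span {J 1, J 2, J 3}" "J' 3 \<in> span {J 1, J 2, J 3}"
  shows "span {J' 1, J' 2, J' 3} = span {J 1, J 2, J 3}"
proof
  let ?S = "{J' 1, J' 2, J' 3}" and ?T = "{J 1, J 2, J 3}"
  have S: "?S \<subseteq> span ?T" using sub by simp
  then show "span ?S \<subseteq> span ?T" by (intro span_minimal) simp_all
  show "span ?T \<subseteq> span ?S"
  proof (rule ccontr)
    assume "\<not> span ?T \<subseteq> span ?S"
    then obtain x where x: "x \<in> span ?T" "x \<notin> span ?S" by blast
    have nx: "x \<notin> ?S" using x(2) span_base by metis
    have "independent (insert x ?S)"
      using independent_insert[of x ?S] nx x(2) pq_triple_independent(1)[OF J'] by simp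
    moreover have "insert x ?S \<subseteq> span ?T" using x(1) S by simp
    ultimately have "card (insert x ?S) \<le> card ?T"
      using independent_span_bound[of ?T "insert x ?S"] by simp
    moreover have "card (insert x ?S) = Suc (card ?S)"
      by (rule card_insert_disjoint) (use nx in simp_all)
    ultimately show False
      using pq_triple_independent(2)[OF J] pq_triple_independent(2)[OF J'] by simp
  qed
qed

lemma pq_triple_of_pair:
  fixes K L :: "'e::euclidean_space \<Rightarrow>\<^sub>L 'e"
  assumes eps: "\<epsilon> \<in> {-1, 1}" and K: "\<And>v. K (K v) = \<epsilon> *\<^sub>R v" and L: "\<And>v. L (L v) = v"
    and KL: "\<And>v. L (K v) = - K (L v)"
  shows "pq_triple (adapted_signs \<epsilon>) (\<lambda>i. if i = 1 then K else if i = 2 then L else K o\<^sub>L L)"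
  unfolding pq_triple_def
proof (intro conjI)
  show "(adapted_signs \<epsilon> 1, adapted_signs \<epsilon> 2, adapted_signs \<epsilon> 3) \<in> {(- 1, 1, 1), (1, - 1, 1), (1, 1, - 1)}"
    using eps by (auto simp: adapted_signs_def)
  show "\<forall>i\<in>{1, 2, 3}. (if i = 1 then K else if i = 2 then L else K o\<^sub>L L) o\<^sub>L (if i = 1 then K else if i = 2 then L else K o\<^sub>L L)
      = adapted_signs \<epsilon> i *\<^sub>R id_blinfun"
    by (auto intro!: blinfun_eqI simp: adapted_signs_def blinfun.scaleR_left blinfun.minus_left blinfun.minus_right K L KL)
  show "\<forall>i\<in>{1, 2, 3}. \<forall>j\<in>{1, 2, 3}. i \<noteq> j \<longrightarrow>
      (if i = 1 then K else if i = 2 then L else K o\<^sub>L L) o\<^sub>L (if j = 1 then K else if j = 2 then L else K o\<^sub>L L) =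
      - ((if j = 1 then K else if j = 2 then L else K o\<^sub>L L) o\<^sub>L (if i = 1 then K else if i = 2 then L else K o\<^sub>L L))"
    by (auto intro!: blinfun_eqI simp: blinfun.minus_left blinfun.minus_right K L KL)
qed simp

text \<open>The form has signature \<open>(2, 1)\<close>, so the orthogonal complement of a unit vector of either sign
  contains vectors with positive square; \<open>b\<close> has such a vector as its orthogonal projection.\<close>

lemma form3_positive_direction:
  assumes J: "pq_triple eps J" and \<epsilon>: "\<epsilon> \<in> {-1, 1}" and a: "form3 eps a a = \<epsilon>"
  shows "\<exists>b. form3 eps b b - \<epsilon> * (form3 eps a b)\<^sup>2 > 0"
proof -
  have sg: "(eps 1, eps 2, eps 3) \<in> {(-1, 1, 1), (1, -1, 1), (1, 1, -1)}"
    using J unfolding pq_triple_def by (rule conjunct1)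
  show ?thesis
  proof (cases "\<epsilon> = 1")
    case True
    have *: "form3 eps b b - \<epsilon> * (form3 eps a b)\<^sup>2 > 0" if "form3 eps a b = 0" "form3 eps b b = 1 + c * c" for b c
      using that by (simp add: add_pos_nonneg)
    \<comment> \<open>the witness is the rotated projection of \<open>a\<close> to the positive plane\<close>
    consider "eps 1 = -1" "eps 2 = 1" "eps 3 = 1" | "eps 1 = 1" "eps 2 = -1" "eps 3 = 1" | "eps 1 = 1" "eps 2 = 1" "eps 3 = -1"
      using sg by auto
    then show ?thesis
    proof cases
      case 1
      show ?thesis
        by (rule exI, rule *[where b = "\<lambda>i. if i = 1 then 0 else if i = 2 then - a 3 else a 2" and c = "a 1"])
          (use a True 1 in \<open>auto simp: form3_def\<close>)
    next
      case 2
      show ?thesis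
        by (rule exI, rule *[where b = "\<lambda>i. if i = 1 then - a 3 else if i = 2 then 0 else a 1" and c = "a 2"])
          (use a True 2 in \<open>auto simp: form3_def\<close>)
    next
      case 3
      show ?thesis
        by (rule exI, rule *[where b = "\<lambda>i. if i = 1 then - a 2 else if i = 2 then a 1 else 0" and c = "a 3"])
          (use a True 3 in \<open>auto simp: form3_def\<close>)
    qed
  next
    case False
    then have e: "\<epsilon> = -1" using \<epsilon> by simp
    have "\<exists>k\<in>{1, 2, 3}. eps k = 1" using sg by auto
    then obtain k where k: "k \<in> {1, 2, 3}" "eps k = 1" by blast
    have "form3 eps (unit3 k) (unit3 k) = 1" using form3_unit[OF k(1), of eps "unit3 k"] k(2) by (simp add: unit3_def)
    then have "form3 eps (unit3 k) (unit3 k) - \<epsilon> * (form3 eps a (unit3 k))\<^sup>2 > 0" unfolding e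
      by (simp add: add_pos_nonneg)
    then show ?thesis by blast
  qed
qed

lemma form3_symmetric: "form3 eps a b = form3 eps b a"
  by (simp add: form3_def)

lemma form3_scale: "form3 eps (\<lambda>i. r * a i) b = r * form3 eps a b"
  by (simp add: form3_def algebra_simps)

lemma form3_projection:
  assumes \<epsilon>: "\<epsilon> \<in> {-1, 1}" and a: "form3 eps a a = \<epsilon>"
  shows "form3 eps a (\<lambda>i. b i - \<epsilon> * form3 eps a b * a i) = 0"
    and "form3 eps (\<lambda>i. b i - \<epsilon> * form3 eps a b * a i) (\<lambda>i. b i - \<epsilon> * form3 eps a b * a i) =
      form3 eps b b - \<epsilon> * (form3 eps a b)\<^sup>2"
proof -
  have lin: "form3 eps c (\<lambda>i. b i - r * a i) = form3 eps c b - r * form3 eps c a" for c r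
    by (simp add: form3_def algebra_simps)
  have ee: "\<epsilon> * \<epsilon> = 1" using \<epsilon> by auto
  show 1: "form3 eps a (\<lambda>i. b i - \<epsilon> * form3 eps a b * a i) = 0"
    unfolding lin a using ee by (simp add: mult.assoc mult.left_commute[of \<epsilon>])
  have "form3 eps (\<lambda>i. b i - \<epsilon> * form3 eps a b * a i) (\<lambda>i. b i - \<epsilon> * form3 eps a b * a i) =
      form3 eps (\<lambda>i. b i - \<epsilon> * form3 eps a b * a i) b - \<epsilon> * form3 eps a b * form3 eps (\<lambda>i. b i - \<epsilon> * form3 eps a b * a i) a"
    by (rule lin)
  also have "\<dots> = form3 eps b (\<lambda>i. b i - \<epsilon> * form3 eps a b * a i)"
    unfolding form3_symmetric[of eps "\<lambda>i. b i - \<epsilon> * form3 eps a b * a i" a] 1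
      form3_symmetric[of eps "\<lambda>i. b i - \<epsilon> * form3 eps a b * a i" b] by simp
  also have "\<dots> = form3 eps b b - \<epsilon> * (form3 eps a b)\<^sup>2"
    unfolding lin by (simp add: form3_symmetric[of _ b a] power2_eq_square)
  finally show "form3 eps (\<lambda>i. b i - \<epsilon> * form3 eps a b * a i) (\<lambda>i. b i - \<epsilon> * form3 eps a b * a i) =
      form3 eps b b - \<epsilon> * (form3 eps a b)\<^sup>2" .
qed

context smooth_manifold
begin

lemma endo_smooth_comb3:
  fixes J :: "nat \<Rightarrow> 'a \<Rightarrow> 'e \<Rightarrow>\<^sub>L 'e"
  assumes U: "open U" and J: "\<And>i. i \<in> {1, 2, 3} \<Longrightarrow> endo_smooth A U (J i)"
    and a: "\<And>i. i \<in> {1, 2, 3} \<Longrightarrow> fun_smooth A U (a i)"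
  shows "endo_smooth A U (\<lambda>p. comb3 (\<lambda>i. J i p) (\<lambda>i. a i p))"
  unfolding comb3_def
  by (intro endo_smooth_add[OF U] endo_smooth_scaleR[OF U]) (simp_all add: J a)

lemma fun_smooth_form3:
  assumes U: "open U" and a: "\<And>i. i \<in> {1, 2, 3} \<Longrightarrow> fun_smooth A U (a i)" and b: "\<And>i. i \<in> {1, 2, 3} \<Longrightarrow> fun_smooth A U (b i)"
  shows "fun_smooth A U (\<lambda>p. form3 eps (\<lambda>i. a i p) (\<lambda>i. b i p))"
  unfolding form3_def
  by (intro fun_smooth_add[OF U] fun_smooth_mult[OF U]) (simp_all add: a b)

end

context smooth_manifold_map
begin

text \<open>The anticommutator of \<open>K\<close> with \<open>J i\<close> is \<open>2 eps i\<close> times the coefficient of \<open>J i\<close>, as a multiple of the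
  identity.  Evaluating it on a single basis vector exhibits the coefficient as a smooth function.\<close>

lemma frame_coefficients_smooth:
  assumes fr: "local_frame A Q U eps J" and K: "endo_smooth_along B A f UNIV K" and d: "d \<in> A"
    and V: "open V" "f ` V \<subseteq> fst d" "f ` V \<subseteq> U" and KQ: "\<And>x. x \<in> V \<Longrightarrow> K x \<in> Q (f x)"
  shows "\<exists>\<alpha> :: nat \<Rightarrow> 'b \<Rightarrow> real. (\<forall>i\<in>{1, 2, 3}. fun_smooth B V (\<alpha> i)) \<and>
    (\<forall>x\<in>V. K x = comb3 (\<lambda>i. J i (f x)) (\<lambda>i. \<alpha> i x))"
proof -
  have U: "open U" and J: "\<And>i. i \<in> {1, 2, 3} \<Longrightarrow> endo_smooth A U (J i)"
    and tr: "\<And>p. p \<in> U \<Longrightarrow> pq_triple eps (\<lambda>i. J i p)" and Qs: "\<And>p. p \<in> U \<Longrightarrow> Q p = span {J 1 p, J 2 p, J 3 p}"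
    using fr unfolding local_frame_def by blast+
  note dc = N.compatible[OF d]
  obtain e :: 'e where e: "e \<in> Basis" using nonempty_Basis by blast
  let ?m = "\<lambda>L p w. tderiv A (snd d) p (blinfun_apply L (coord_field A d w p))"
  have fx: "f x \<in> fst d" "f x \<in> U" if "x \<in> V" for x using that V by auto
  have MK: "fun_smooth B V (\<lambda>x. ?m (K x) (f x) w)" for w
    by (rule M.fun_smooth_subset[OF endo_along_matrix_smooth[OF K d]]) (use V in blast)
  have MJ: "fun_smooth B V (\<lambda>x. ?m (J i (f x)) (f x) w)" if "i \<in> {1, 2, 3}" for i w
    by (rule M.fun_smooth_subset[OF endo_matrix_smooth[OF J[OF that] U d]]) (use V in blast)
  define \<alpha> where "\<alpha> i x = eps i / 2 *
    ((?m (J i (f x)) (f x) (?m (K x) (f x) e) + ?m (K x) (f x) (?m (J i (f x)) (f x) e)) \<bullet> e)" for i x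
  have "fun_smooth B V (\<alpha> i)" if i: "i \<in> {1, 2, 3}" for i
  proof -
    have 1: "fun_smooth B V (\<lambda>x. ?m (J i (f x)) (f x) (?m (K x) (f x) e))"
      by (rule M.fun_smooth_apply[OF V(1) endo_along_matrix_linear[OF d fx(1)] MJ[OF i] MK])
    have 2: "fun_smooth B V (\<lambda>x. ?m (K x) (f x) (?m (J i (f x)) (f x) e))"
      by (rule M.fun_smooth_apply[OF V(1) endo_along_matrix_linear[OF d fx(1)] MK MJ[OF i]])
    show ?thesis
      unfolding \<alpha>_def[abs_def]
      by (rule M.fun_smooth_mult[OF V(1) M.fun_smooth_const M.fun_smooth_inner[OF V(1) M.fun_smooth_add[OF V(1) 1 2]]])
  qed
  moreover have "K x = comb3 (\<lambda>i. J i (f x)) (\<lambda>i. \<alpha> i x)" if x: "x \<in> V" for x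
  proof -
    note t = tr[OF fx(2)[OF x]]
    obtain a where a: "K x = comb3 (\<lambda>i. J i (f x)) a"
      using KQ[OF x] Qs[OF fx(2)[OF x]] span3_iff[of "K x" "\<lambda>i. J i (f x)"] by auto
    have "\<alpha> i x = a i" if i: "i \<in> {1, 2, 3}" for i
    proof -
      let ?v = "coord_field A d e (f x)"
      have lin: "linear (tderiv A (snd d) (f x))" by (rule N.tderiv_linear[OF dc fx(1)[OF x]])
      have "J i (f x) (K x ?v) + K x (J i (f x) ?v) = (2 * form3 eps a (unit3 i)) *\<^sub>R ?v"
        using comb3_anticommutator[OF t, of a "unit3 i" ?v] comb3_unit[OF i, of "\<lambda>i. J i (f x)"] a by (simp add: add.commute)
      then have "tderiv A (snd d) (f x) (J i (f x) (K x ?v)) + tderiv A (snd d) (f x) (K x (J i (f x) ?v)) = (2 * (eps i * a i)) *\<^sub>R e"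
        using N.tderiv_coord_field[OF dc fx(1)[OF x], of e] lin form3_unit[OF i, of eps a]
        by (simp only: linear_add[OF lin, symmetric]) (simp add: linear_scale[OF lin])
      then have "\<alpha> i x = eps i / 2 * (((2 * (eps i * a i)) *\<^sub>R e) \<bullet> e)"
        unfolding \<alpha>_def using N.coord_field_tderiv[OF dc fx(1)[OF x]] by simp
      moreover have "eps i * eps i = 1" using pq_tripleD(10-12)[OF t] i by auto
      ultimately show ?thesis using e by (simp add: inner_Basis mult.assoc[symmetric])
    qed
    then show ?thesis using a by (simp add: comb3_def)
  qed
  ultimately show ?thesis by blast
qed

text \<open>The structure \<open>K\<close> extends to a neighbourhood in the ambient manifold by composing its coefficients
  in a local frame with a local retraction; the extension still has square \<open>\<epsilon>\<close> because the square only
  depends on the coefficients.  Projecting a constant combination orthogonally to it and normalising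
  gives the second structure.\<close>

lemma adapted_basis_exists:
  assumes Q: "almost_para_quaternionic A Q" and \<epsilon>: "\<epsilon> \<in> {-1, 1}"
    and K: "endo_smooth_along B A f UNIV K" and KQ: "\<And>x. K x \<in> Q (f x)"
    and KK: "\<And>x. K x o\<^sub>L K x = \<epsilon> *\<^sub>R id_blinfun" and inj: "inj (differential B A f x0)"
  shows "\<exists>V U J. x0 \<in> V \<and> adapted_basis A Q \<epsilon> f K V U J"
proof -
  obtain U0 eps J' where U0: "f x0 \<in> U0" and fr: "local_frame A Q U0 eps J'"
    using Q unfolding almost_para_quaternionic_def by blast
  have oU: "open U0" and sJ: "\<And>i. i \<in> {1, 2, 3} \<Longrightarrow> endo_smooth A U0 (J' i)"
    and tr: "\<And>p. p \<in> U0 \<Longrightarrow> pq_triple eps (\<lambda>i. J' i p)" and Qs: "\<And>p. p \<in> U0 \<Longrightarrow> Q p = span {J' 1 p, J' 2 p, J' 3 p}"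
    using fr unfolding local_frame_def by blast+
  obtain c d V W \<rho> \<Lambda> where r: "retraction c d V W \<rho> \<Lambda>" and x0: "x0 \<in> V" and VU: "V \<subseteq> f -` U0"
  proof (rule retraction_exists[OF inj open_vimage_map[OF oU]])
    show "x0 \<in> f -` U0" using U0 by simp
  qed (rule that)
  note rD = retractionD[OF r]
  have fV: "f ` V \<subseteq> fst d" "f ` V \<subseteq> U0" using rD(6,7) VU by blast+
  obtain \<alpha> :: "nat \<Rightarrow> 'b \<Rightarrow> real" where \<alpha>': "\<forall>i\<in>{1, 2, 3}. fun_smooth B V (\<alpha> i)"
    "\<forall>x\<in>V. K x = comb3 (\<lambda>i. J' i (f x)) (\<lambda>i. \<alpha> i x)"
    using frame_coefficients_smooth[OF fr K rD(2,3) fV KQ] by (elim exE conjE) (rule that)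
  note \<alpha> = bspec[OF \<alpha>'(1)] and K\<alpha> = bspec[OF \<alpha>'(2)]
  have \<alpha>\<alpha>: "form3 eps (\<lambda>i. \<alpha> i x) (\<lambda>i. \<alpha> i x) = \<epsilon>" if x: "x \<in> V" for x
  proof -
    obtain v :: 'e where v: "v \<noteq> 0" using nonzero_Basis by blast
    have "K x (K x v) = \<epsilon> *\<^sub>R v"
      using arg_cong[OF KK[of x], of "\<lambda>L. blinfun_apply L v"] by (simp add: blinfun.scaleR_left)
    then have "\<epsilon> *\<^sub>R v + \<epsilon> *\<^sub>R v = (2 * form3 eps (\<lambda>i. \<alpha> i x) (\<lambda>i. \<alpha> i x)) *\<^sub>R v"
      using comb3_anticommutator[OF tr, of "f x" "\<lambda>i. \<alpha> i x" "\<lambda>i. \<alpha> i x" v] K\<alpha>[OF x] VU x by auto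
    then have "(2 * \<epsilon>) *\<^sub>R v = (2 * form3 eps (\<lambda>i. \<alpha> i x) (\<lambda>i. \<alpha> i x)) *\<^sub>R v"
      by (simp only: mult_2 scaleR_left_distrib)
    then show ?thesis using v by simp
  qed
  define a where "a i p = \<alpha> i (\<rho> p)" for i p
  define W1 where "W1 = W \<inter> U0"
  have W1: "open W1" "W1 \<subseteq> U0" using rD(5) oU by (auto simp: W1_def)
  have a: "fun_smooth A W1 (a i)" if "i \<in> {1, 2, 3}" for i
    unfolding a_def[abs_def]
    by (rule N.fun_smooth_subset[OF rD(10)[OF \<alpha>[OF that]]]) (simp add: W1_def)
  have aa: "form3 eps (\<lambda>i. a i p) (\<lambda>i. a i p) = \<epsilon>" if "p \<in> W1" for p
    unfolding a_def by (rule \<alpha>\<alpha>) (use rD(8) that in \<open>auto simp: W1_def\<close>)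
  have fx0: "f x0 \<in> W1" using rD(7) x0 U0 by (auto simp: W1_def)
  obtain b where b: "form3 eps b b - \<epsilon> * (form3 eps (\<lambda>i. a i (f x0)) b)\<^sup>2 > 0"
    using form3_positive_direction[OF tr[OF U0] \<epsilon> aa[OF fx0]] by blast
  define \<beta>' where "\<beta>' i p = b i - \<epsilon> * form3 eps (\<lambda>i. a i p) b * a i p" for i p
  define s where "s p = form3 eps (\<lambda>i. \<beta>' i p) (\<lambda>i. \<beta>' i p)" for p
  have \<beta>': "fun_smooth A W1 (\<beta>' i)" if i: "i \<in> {1, 2, 3}" for i
  proof -
    have 1: "fun_smooth A W1 (\<lambda>p. form3 eps (\<lambda>i. a i p) b)"
      by (rule N.fun_smooth_form3[OF W1(1) a N.fun_smooth_const])
    have 2: "fun_smooth A W1 (\<lambda>p. b i + (- \<epsilon>) * (form3 eps (\<lambda>i. a i p) b * a i p))"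
      by (intro N.fun_smooth_add[OF W1(1)] N.fun_smooth_mult[OF W1(1)] N.fun_smooth_const 1 a[OF i])
    show ?thesis
      by (rule N.fun_smooth_cong[OF W1(1) _ 2]) (simp add: \<beta>'_def)
  qed
  have s: "fun_smooth A W1 s"
    unfolding s_def[abs_def] by (rule N.fun_smooth_form3[OF W1(1) \<beta>' \<beta>'])
  define W2 where "W2 = W1 \<inter> s -` {0<..}"
  have W2: "open W2" "W2 \<subseteq> W1"
    unfolding W2_def using continuous_open_preimage[OF N.fun_smooth_continuous[OF W1(1) s] W1(1), of "{0<..}"] by auto
  have fx02: "f x0 \<in> W2"
    using b fx0 form3_projection(2)[OF \<epsilon> aa[OF fx0], of b] by (simp add: W2_def s_def \<beta>'_def)
  define \<beta> where "\<beta> i p = (1 / sqrt (s p)) * \<beta>' i p" for i p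
  have \<beta>: "fun_smooth A W2 (\<beta> i)" if i: "i \<in> {1, 2, 3}" for i
    unfolding \<beta>_def[abs_def]
    by (intro N.fun_smooth_mult[OF W2(1)] N.fun_smooth_divide[OF W2(1)] N.fun_smooth_sqrt[OF W2(1)] N.fun_smooth_const
        N.fun_smooth_subset[OF s W2(2)] N.fun_smooth_subset[OF \<beta>'[OF i] W2(2)]) (auto simp: W2_def)
  have \<beta>\<beta>: "form3 eps (\<lambda>i. \<beta> i p) (\<lambda>i. \<beta> i p) = 1" and a\<beta>: "form3 eps (\<lambda>i. a i p) (\<lambda>i. \<beta> i p) = 0" if p: "p \<in> W2" for p
  proof -
    have sp: "s p > 0" using p by (simp add: W2_def)
    have "form3 eps (\<lambda>i. \<beta> i p) (\<lambda>i. \<beta> i p) = (1 / sqrt (s p)) * ((1 / sqrt (s p)) * s p)"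
      unfolding \<beta>_def form3_scale s_def form3_symmetric[of eps "\<lambda>i. \<beta>' i p" "\<lambda>i. _ * \<beta>' i p"] by simp
    also have "\<dots> = s p / (sqrt (s p) * sqrt (s p))" by simp
    also have "\<dots> = 1" using sp by simp
    finally show "form3 eps (\<lambda>i. \<beta> i p) (\<lambda>i. \<beta> i p) = 1" .
    have "form3 eps (\<lambda>i. \<beta> i p) (\<lambda>i. a i p) = (1 / sqrt (s p)) * form3 eps (\<lambda>i. \<beta>' i p) (\<lambda>i. a i p)"
      unfolding \<beta>_def form3_scale ..
    also have "\<dots> = 0"
      using form3_projection(1)[OF \<epsilon> aa, of p b] p W2(2) form3_symmetric[of eps "\<lambda>i. \<beta>' i p" "\<lambda>i. a i p"]
      by (auto simp: \<beta>'_def)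
    finally show "form3 eps (\<lambda>i. a i p) (\<lambda>i. \<beta> i p) = 0"
      using form3_symmetric[of eps "\<lambda>i. a i p"] by simp
  qed
  define J1 where "J1 p = comb3 (\<lambda>i. J' i p) (\<lambda>i. a i p)" for p
  define J2 where "J2 p = comb3 (\<lambda>i. J' i p) (\<lambda>i. \<beta> i p)" for p
  define J where "J i p = (if i = 1 then J1 p else if i = 2 then J2 p else J1 p o\<^sub>L J2 p)" for i :: nat and p
  have sJ2: "endo_smooth A W2 (J' i)" if "i \<in> {1, 2, 3}" for i
    by (rule N.endo_smooth_subset[OF sJ[OF that] W2(1)]) (use W1 W2 in blast)
  have s1: "endo_smooth A W2 J1"
    unfolding J1_def[abs_def] by (rule N.endo_smooth_comb3[OF W2(1) sJ2 N.fun_smooth_subset[OF a W2(2)]])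
  have s2: "endo_smooth A W2 J2"
    unfolding J2_def[abs_def] by (rule N.endo_smooth_comb3[OF W2(1) sJ2 \<beta>])
  have s3: "endo_smooth A W2 (\<lambda>p. J1 p o\<^sub>L J2 p)"
    by (rule N.endo_smooth_compose[OF W2(1) s1 s2])
  have triple: "pq_triple (adapted_signs \<epsilon>) (\<lambda>i. J i p)" and span: "Q p = span {J 1 p, J 2 p, J 3 p}" if p: "p \<in> W2" for p
  proof -
    have p1: "p \<in> W1" "p \<in> U0" using p W1 W2 by auto
    note t = tr[OF p1(2)]
    have half: "v = w" if "v + v = (2 * r) *\<^sub>R u" "w = r *\<^sub>R u" for v w u :: 'e and r
    proof -
      have "2 *\<^sub>R v = 2 *\<^sub>R w" using that by (simp add: scaleR_2)
      then show ?thesis by simp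
    qed
    have 1: "J1 p (J1 p v) = \<epsilon> *\<^sub>R v" for v
      using half[OF comb3_anticommutator[OF t, of "\<lambda>i. a i p" "\<lambda>i. a i p" v] refl] aa[OF p1(1)] by (simp add: J1_def)
    have 2: "J2 p (J2 p v) = v" for v
      using half[OF comb3_anticommutator[OF t, of "\<lambda>i. \<beta> i p" "\<lambda>i. \<beta> i p" v] refl] \<beta>\<beta>[OF p] by (simp add: J2_def)
    have 3: "J2 p (J1 p v) = - J1 p (J2 p v)" for v
      using comb3_anticommutator[OF t, of "\<lambda>i. a i p" "\<lambda>i. \<beta> i p" v] a\<beta>[OF p]
      by (simp add: J1_def J2_def eq_neg_iff_add_eq_0 add.commute)
    show T: "pq_triple (adapted_signs \<epsilon>) (\<lambda>i. J i p)"
      unfolding J_def by (rule pq_triple_of_pair[OF \<epsilon> 1 2 3])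
    have "J1 p o\<^sub>L J2 p = comb3 (\<lambda>i. J' i p) (\<lambda>i. if i = 1 then - eps 2 * (a 2 p * \<beta> 3 p - a 3 p * \<beta> 2 p)
        else if i = 2 then eps 1 * (a 1 p * \<beta> 3 p - a 3 p * \<beta> 1 p) else a 1 p * \<beta> 2 p - a 2 p * \<beta> 1 p)"
      by (rule blinfun_eqI) (use comb3_product[OF t, of "\<lambda>i. a i p" "\<lambda>i. \<beta> i p"] a\<beta>[OF p] in \<open>simp add: J1_def J2_def\<close>)
    then have "span {J 1 p, J 2 p, J 3 p} = span {J' 1 p, J' 2 p, J' 3 p}"
      by (intro span_pq_triples[OF t T]) (auto simp: span3_iff[of _ "\<lambda>i. J' i p"] J_def J1_def J2_def)
    then show "Q p = span {J 1 p, J 2 p, J 3 p}" using Qs[OF p1(2)] by simp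
  qed
  have ab: "adapted_basis A Q \<epsilon> f K (V \<inter> f -` W2) W2 J"
    unfolding adapted_basis_def local_frame_def
  proof (intro conjI ballI)
    show "open (V \<inter> f -` W2)" using rD(3) open_vimage_map[OF W2(1)] by blast
    show "endo_smooth A W2 (J i)" if "i \<in> {1, 2, 3}" for i
      using that s1 s2 s3 by (auto simp: J_def[abs_def])
    show "J 1 (f x) = K x" if "x \<in> V \<inter> f -` W2" for x
      using K\<alpha>[of x] rD(9)[of x] that by (simp add: J_def J1_def a_def)
    show "f ` (V \<inter> f -` W2) \<subseteq> W2" by blast
    show "open W2" by (rule W2(1))
    show "pq_triple (adapted_signs \<epsilon>) (\<lambda>i. J i p)" "Q p = span {J 1 p, J 2 p, J 3 p}" if "p \<in> W2" for p
      using triple[OF that] span[OF that] .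
  qed
  have "x0 \<in> V \<inter> f -` W2" using x0 fx02 by blast
  with ab show ?thesis by (intro exI[of _ "V \<inter> f -` W2"] exI[of _ W2] exI[of _ J] conjI)
qed

end

context affine_manifold
begin

text \<open>Differentiating the relations \<open>J\<^sub>i J\<^sub>j + J\<^sub>j J\<^sub>i = const\<close> shows that the matrix of coefficients of the
  covariant derivatives is skew for the form of the triple, so three of its entries determine it.\<close>

lemma connection_forms_exist:
  assumes par: "parallel_structure A nabla Q" and fr: "local_frame A Q U eps J"
  shows "\<exists>\<omega>. connection_forms A nabla U eps J \<omega>"
proof -
  have U: "open U" and J: "\<And>i. i \<in> {1, 2, 3} \<Longrightarrow> endo_smooth A U (J i)"
    and tr: "\<And>p. p \<in> U \<Longrightarrow> pq_triple eps (\<lambda>i. J i p)" and Qs: "\<And>p. p \<in> U \<Longrightarrow> Q p = span {J 1 p, J 2 p, J 3 p}"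
    using fr unfolding local_frame_def by blast+
  let ?P = "\<lambda>p v w. cov_endo A nabla (J 1) p v = - (eps 2 * w 3) *\<^sub>R J 2 p + (eps 3 * w 2) *\<^sub>R J 3 p \<and>
    cov_endo A nabla (J 2) p v = - (eps 3 * w 1) *\<^sub>R J 3 p + (eps 1 * w 3) *\<^sub>R J 1 p \<and>
    cov_endo A nabla (J 3) p v = - (eps 1 * w 2) *\<^sub>R J 1 p + (eps 2 * w 1) *\<^sub>R J 2 p"
  have ex: "\<exists>w :: nat \<Rightarrow> real. ?P p v w" if p: "p \<in> U" for p v
  proof -
    note t = tr[OF p]
    have "\<exists>c. cov_endo A nabla (J i) p v = comb3 (\<lambda>i. J i p) c" if i: "i \<in> {1, 2, 3}" for i
    proof -
      have "J i q \<in> Q q" if "q \<in> U" for q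
        using Qs[OF that] i by (auto intro: span_base)
      then have "cov_endo A nabla (J i) p v \<in> Q p"
        using par U J[OF i] p unfolding parallel_structure_def by blast
      then show ?thesis using Qs[OF p] span3_iff[of _ "\<lambda>i. J i p"] by simp
    qed
    then obtain C where C: "\<And>i. i \<in> {1, 2, 3} \<Longrightarrow> cov_endo A nabla (J i) p v = comb3 (\<lambda>i. J i p) (C i)"
      by metis
    obtain u :: 'e where u: "u \<noteq> 0" using nonzero_Basis by blast
    have leib: "cov_endo A nabla (\<lambda>q. J i q o\<^sub>L J j q) p v u =
        comb3 (\<lambda>i. J i p) (C i) (J j p u) + J i p (comb3 (\<lambda>i. J i p) (C j) u)" if "i \<in> {1, 2, 3}" "j \<in> {1, 2, 3}" for i j
      using cov_endo_compose[OF U p J[OF that(1)] J[OF that(2)], of v] C that by (simp add: blinfun.add_left)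
    have ac: "comb3 (\<lambda>i. J i p) (C i) (J j p u) + J j p (comb3 (\<lambda>i. J i p) (C i) u) = (2 * (eps j * C i j)) *\<^sub>R u"
      if "j \<in> {1, 2, 3}" for i j
      using comb3_anticommutator[OF t, of "C i" "unit3 j" u] comb3_unit[OF that, of "\<lambda>i. J i p"] form3_unit[OF that]
      by simp
    have diag: "C i i = 0" if i: "i \<in> {1, 2, 3}" for i
    proof -
      have "J i q o\<^sub>L J i q = eps i *\<^sub>R id_blinfun" if "q \<in> U" for q
        using tr[OF that] i unfolding pq_triple_def by blast
      then have "cov_endo A nabla (\<lambda>q. J i q o\<^sub>L J i q) p v = 0"
        using cov_endo_local[OF U p endo_smooth_compose[OF U J[OF i] J[OF i]], of "\<lambda>q. eps i *\<^sub>R id_blinfun" v]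
          cov_endo_const_id by simp
      then have "(2 * (eps i * C i i)) *\<^sub>R u = 0" using leib[OF i i] ac[OF i, of i] by simp
      moreover have "eps i \<noteq> 0" using pq_tripleD(10-12)[OF t] i by auto
      ultimately show ?thesis using u by simp
    qed
    have off: "eps j * C i j + eps i * C j i = 0" if ij: "i \<in> {1, 2, 3}" "j \<in> {1, 2, 3}" "i \<noteq> j" for i j
    proof -
      have "J i q o\<^sub>L J j q = - (J j q o\<^sub>L J i q)" if "q \<in> U" for q
        using tr[OF that] ij unfolding pq_triple_def by blast
      then have "cov_endo A nabla (\<lambda>q. J i q o\<^sub>L J j q) p v = - cov_endo A nabla (\<lambda>q. J j q o\<^sub>L J i q) p v"
        using cov_endo_local[OF U p endo_smooth_compose[OF U J[OF ij(1)] J[OF ij(2)]], of "\<lambda>q. - (J j q o\<^sub>L J i q)" v]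
          cov_endo_minus[OF U p endo_smooth_compose[OF U J[OF ij(2)] J[OF ij(1)]], of v] by simp
      then have "cov_endo A nabla (\<lambda>q. J i q o\<^sub>L J j q) p v u + cov_endo A nabla (\<lambda>q. J j q o\<^sub>L J i q) p v u = 0"
        by (simp add: blinfun.minus_left)
      then have "comb3 (\<lambda>i. J i p) (C i) (J j p u) + J i p (comb3 (\<lambda>i. J i p) (C j) u) +
          (comb3 (\<lambda>i. J i p) (C j) (J i p u) + J j p (comb3 (\<lambda>i. J i p) (C i) u)) = 0"
        unfolding leib[OF ij(1,2)] leib[OF ij(2,1)] .
      then have "(2 * (eps j * C i j)) *\<^sub>R u + (2 * (eps i * C j i)) *\<^sub>R u = 0"
        unfolding ac[OF ij(2), of i, symmetric] ac[OF ij(1), of j, symmetric] by (simp only: ac_simps)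
      then have "(2 * (eps j * C i j) + 2 * (eps i * C j i)) *\<^sub>R u = 0" by (simp only: scaleR_left_distrib)
      then have "2 * (eps j * C i j) + 2 * (eps i * C j i) = 0"
        using u scaleR_eq_0_iff by blast
      then show ?thesis by linarith
    qed
    note e = pq_tripleD(10-12)[OF t]
    define w :: "nat \<Rightarrow> real" where "w i = (if i = 1 then - eps 3 * C 2 3 else if i = 2 then eps 3 * C 1 3 else - eps 2 * C 1 2)" for i
    have w: "w 1 = - eps 3 * C 2 3" "w 2 = eps 3 * C 1 3" "w 3 = - eps 2 * C 1 2" by (simp_all add: w_def)
    have solve: "y = - a * b * x" if "b * x + a * y = 0" "a * a = 1" for a b x y :: real
    proof -
      have "a * (b * x + a * y) = a * b * x + (a * a) * y" by (simp add: algebra_simps)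
      then show ?thesis using that by simp
    qed
    have c: "C 2 1 = - eps 1 * eps 2 * C 1 2" "C 3 1 = - eps 1 * eps 3 * C 1 3" "C 3 2 = - eps 2 * eps 3 * C 2 3"
      using solve[OF off[of 1 2] e(1)] solve[OF off[of 1 3] e(1)] solve[OF off[of 2 3] e(2)] by simp_all
    have cancel: "a * (a * x) = x" if "a * a = 1" for a x :: real
      using that by (simp add: mult.assoc[symmetric])
    have "?P p v w"
      unfolding w using C[of 1] C[of 2] C[of 3] diag[of 1] diag[of 2] diag[of 3]
      by (simp add: comb3_def c cancel[OF e(1)] cancel[OF e(2)] cancel[OF e(3)] mult.assoc mult.left_commute[of "eps 2" "eps 1"])
    then show ?thesis by blast
  qed
  define w where "w p v = (SOME w :: nat \<Rightarrow> real. ?P p v w)" for p v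
  have w: "?P p v (w p v)" if "p \<in> U" for p v
    unfolding w_def by (rule someI_ex[OF ex[OF that]])
  have "connection_forms A nabla U eps J (\<lambda>i p v. w p v i)"
    unfolding connection_forms_def
  proof (intro ballI allI)
    fix p v x assume p: "p \<in> U" and x: "x \<in> {(1::nat, 2::nat, 3::nat), (2, 3, 1), (3, 1, 2)}"
    show "case x of (\<alpha>, \<beta>, \<gamma>) \<Rightarrow> cov_endo A nabla (J \<alpha>) p v =
        - (eps \<beta> * w p v \<gamma>) *\<^sub>R J \<beta> p + (eps \<gamma> * w p v \<beta>) *\<^sub>R J \<gamma> p"
      using x w[OF p, of v] by (elim insertE emptyE) simp_all
  qed
  then show ?thesis by blast
qed

text \<open>The forms are the coefficients of \<open>\<nabla> J\<^sub>1\<close>, which are unique and therefore linear in the direction.\<close>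

lemma connection_forms_linear:
  assumes fr: "local_frame A Q U eps J" and \<omega>: "connection_forms A nabla U eps J \<omega>" and p: "p \<in> U"
  shows "linear (\<omega> 2 p)" "linear (\<omega> 3 p)"
proof -
  have U: "open U" and J: "endo_smooth A U (J 1)" and t: "pq_triple eps (\<lambda>i. J i p)"
    using fr p unfolding local_frame_def by blast+
  let ?c = "\<lambda>v (i :: nat). if i = 1 then 0 else if i = 2 then - (eps 2 * \<omega> 3 p v) else eps 3 * \<omega> 2 p v"
  have cov: "cov_endo A nabla (J 1) p v = comb3 (\<lambda>i. J i p) (?c v)" for v
  proof -
    have "case (1::nat, 2::nat, 3::nat) of (\<alpha>, \<beta>, \<gamma>) \<Rightarrow> cov_endo A nabla (J \<alpha>) p v =
        - (eps \<beta> * \<omega> \<gamma> p v) *\<^sub>R J \<beta> p + (eps \<gamma> * \<omega> \<beta> p v) *\<^sub>R J \<gamma> p"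
      using \<omega> p unfolding connection_forms_def by blast
    then show ?thesis by (simp add: comb3_def)
  qed
  note lin = cov_endo_linear[OF U p J]
  have e: "eps 2 \<noteq> 0" "eps 3 \<noteq> 0" using pq_tripleD(11,12)[OF t] by auto
  have add: "?c (v + w) k = ?c v k + ?c w k" if "k \<in> {1, 2, 3}" for v w k
  proof (rule comb3_eqD[OF t _ that])
    show "comb3 (\<lambda>i. J i p) (?c (v + w)) = comb3 (\<lambda>i. J i p) (\<lambda>k. ?c v k + ?c w k)"
      using cov[of "v + w"] cov[of v] cov[of w] linear_add[OF lin, of v w] by (simp add: comb3_def algebra_simps)
  qed
  have scale: "?c (r *\<^sub>R v) k = r * ?c v k" if "k \<in> {1, 2, 3}" for v r k
  proof (rule comb3_eqD[OF t _ that])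
    show "comb3 (\<lambda>i. J i p) (?c (r *\<^sub>R v)) = comb3 (\<lambda>i. J i p) (\<lambda>k. r * ?c v k)"
      using cov[of "r *\<^sub>R v"] cov[of v] linear_scale[OF lin, of r v] by (simp add: comb3_def algebra_simps)
  qed
  have a2: "- (eps 2 * \<omega> 3 p (v + w)) = - (eps 2 * \<omega> 3 p v) + - (eps 2 * \<omega> 3 p w)"
    and s2: "- (eps 2 * \<omega> 3 p (r *\<^sub>R v)) = r * - (eps 2 * \<omega> 3 p v)"
    and a3: "eps 3 * \<omega> 2 p (v + w) = eps 3 * \<omega> 2 p v + eps 3 * \<omega> 2 p w"
    and s3: "eps 3 * \<omega> 2 p (r *\<^sub>R v) = r * (eps 3 * \<omega> 2 p v)" for v w r
    using add[of 2 v w] scale[of 2 r v] add[of 3 v w] scale[of 3 r v] by simp_all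
  show "linear (\<omega> 3 p)"
  proof (rule linearI)
    fix v w and r
    have "eps 2 * \<omega> 3 p (v + w) = eps 2 * (\<omega> 3 p v + \<omega> 3 p w)" using a2[of v w] by (simp add: algebra_simps)
    then show "\<omega> 3 p (v + w) = \<omega> 3 p v + \<omega> 3 p w" using e by simp
    have "eps 2 * \<omega> 3 p (r *\<^sub>R v) = eps 2 * (r * \<omega> 3 p v)" using s2[of r v] by (simp add: algebra_simps)
    then show "\<omega> 3 p (r *\<^sub>R v) = r *\<^sub>R \<omega> 3 p v" using e by simp
  qed
  show "linear (\<omega> 2 p)"
  proof (rule linearI)
    fix v w and r
    have "eps 3 * \<omega> 2 p (v + w) = eps 3 * (\<omega> 2 p v + \<omega> 2 p w)" using a3[of v w] by (simp add: algebra_simps)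
    then show "\<omega> 2 p (v + w) = \<omega> 2 p v + \<omega> 2 p w" using e by simp
    have "eps 3 * \<omega> 2 p (r *\<^sub>R v) = eps 3 * (r * \<omega> 2 p v)" using s3[of r v] by (simp add: algebra_simps)
    then show "\<omega> 2 p (r *\<^sub>R v) = r *\<^sub>R \<omega> 2 p v" using e by simp
  qed
qed

end

section \<open>The Nijenhuis tensor of an almost Hermitian submanifold\<close>

locale eps_hermitian = smooth_manifold_map B A f + P: affine_manifold A nabla
  for B :: "('b::topological_space, 'f::euclidean_space) chart set"
    and A :: "('a::topological_space, 'e::euclidean_space) chart set"
    and f nabla +
  fixes g :: "'a \<Rightarrow> 'e \<Rightarrow> 'e \<Rightarrow> real" and Q :: "'a \<Rightarrow> ('e \<Rightarrow>\<^sub>L 'e) set" and \<epsilon> :: real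
    and Je :: "'b \<Rightarrow> 'e \<Rightarrow>\<^sub>L 'e" and n :: nat
  assumes pqk: "para_quaternionic_kaehler n A g nabla Q" and eps: "\<epsilon> \<in> {-1, 1}"
    and sub: "almost_eps_hermitian_submanifold A g Q \<epsilon> B f Je"
begin

abbreviation df :: "'b \<Rightarrow> 'f \<Rightarrow> 'e" where "df \<equiv> differential B A f"
abbreviation jM :: "'b \<Rightarrow> 'f \<Rightarrow> 'f" where "jM \<equiv> induced_structure A B f Je"
abbreviation nij :: "('b \<Rightarrow> 'f) \<Rightarrow> ('b \<Rightarrow> 'f) \<Rightarrow> 'b \<Rightarrow> 'f" where "nij \<equiv> nijenhuis B \<epsilon> jM"

lemma inj_df: "inj (df x)"
  using sub unfolding almost_eps_hermitian_submanifold_def submanifold_def by blast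

lemma df_eq_iff [simp]: "df x v = df x w \<longleftrightarrow> v = w"
  using inj_df by (rule inj_eq)

lemma df_eq_0_iff [simp]: "df x v = 0 \<longleftrightarrow> v = 0"
  using df_eq_iff[of x v 0] linear_0[OF differential_linear, of x] by simp

lemma Je_smooth: "endo_smooth_along B A f UNIV Je"
  and Je_Q: "Je x \<in> Q (f x)"
  and Je_compose: "Je x o\<^sub>L Je x = \<epsilon> *\<^sub>R id_blinfun"
  and Je_range: "Je x ` range (df x) = range (df x)"
  using sub unfolding almost_eps_hermitian_submanifold_def by blast+

lemma Je_Je [simp]: "Je x (Je x v) = \<epsilon> *\<^sub>R v"
  using arg_cong[OF Je_compose, of "\<lambda>L. blinfun_apply L v"] by (simp add: blinfun.scaleR_left)

lemma df_jM [simp]: "df x (jM x v) = Je x (df x v)"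
  unfolding induced_structure_def
  by (rule f_inv_into_f) (use Je_range in blast)

lemma eps_square: "\<epsilon> * \<epsilon> = 1"
  using eps by auto

lemma torsion_free:
  assumes "open V" "vfield_smooth A V X" "vfield_smooth A V Y" "p \<in> V"
  shows "lie_bracket A X Y p = nabla p (X p) Y - nabla p (Y p) X"
proof -
  have lc: "levi_civita A g nabla" using pqk unfolding para_quaternionic_kaehler_def by blast
  note rules = conjunct2[OF lc[unfolded levi_civita_def], rule_format]
  show ?thesis using conjunct1[OF rules[OF assms]] by simp
qed

lemma jM_linear: "linear (jM x)"
proof (rule linearI)
  show "jM x (v + w) = jM x v + jM x w" for v w
    by (rule df_eq_iff[of x, THEN iffD1]) (simp add: linear_add[OF differential_linear] blinfun.add_right)
  show "jM x (r *\<^sub>R v) = r *\<^sub>R jM x v" for r v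
    by (rule df_eq_iff[of x, THEN iffD1]) (simp add: linear_scale[OF differential_linear] blinfun.scaleR_right)
qed

lemma adapted_basis_at: obtains V U J \<omega> where "x \<in> V" "adapted_basis A Q \<epsilon> f Je V U J"
  "connection_forms A nabla U (adapted_signs \<epsilon>) J \<omega>"
proof -
  have Q: "almost_para_quaternionic A Q" and par: "parallel_structure A nabla Q"
    using pqk unfolding para_quaternionic_kaehler_def by blast+
  obtain V U J where 1: "x \<in> V" "adapted_basis A Q \<epsilon> f Je V U J"
    using adapted_basis_exists[OF Q eps Je_smooth Je_Q Je_compose inj_df] by blast
  then have "local_frame A Q U (adapted_signs \<epsilon>) J" unfolding adapted_basis_def by blast
  then obtain \<omega> where "connection_forms A nabla U (adapted_signs \<epsilon>) J \<omega>"
    using P.connection_forms_exist[OF par] by blast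
  then show thesis using that 1 by blast
qed

lemma retraction_at:
  assumes "open N" "x \<in> N"
  obtains c d V W \<rho> \<Lambda> where "retraction c d V W \<rho> \<Lambda>" "x \<in> V" "V \<subseteq> N"
  using retraction_exists[OF inj_df assms] .

text \<open>The 1-form \<open>\<psi>\<close> at \<open>x\<close>, defined on the whole ambient tangent space so that preimages under the
  differential do not enter.\<close>

definition covector :: "(nat \<Rightarrow> 'a \<Rightarrow> 'e \<Rightarrow> real) \<Rightarrow> 'b \<Rightarrow> 'e \<Rightarrow> real" where
  "covector \<omega> x v = \<omega> 3 (f x) (Je x v) - \<omega> 2 (f x) v"

definition obstruction :: "(nat \<Rightarrow> 'a \<Rightarrow> 'e \<Rightarrow> real) \<Rightarrow> 'b \<Rightarrow> 'e \<Rightarrow> 'e \<Rightarrow> 'e" where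
  "obstruction \<omega> x v w = covector \<omega> x w *\<^sub>R v + (\<epsilon> * covector \<omega> x (Je x w)) *\<^sub>R Je x v
     - covector \<omega> x v *\<^sub>R w - (\<epsilon> * covector \<omega> x (Je x v)) *\<^sub>R Je x w"

lemma psi_eq_covector: "psi A B f Je \<omega> x v = covector \<omega> x (df x v)"
  by (simp add: psi_def covector_def)

text \<open>The fields are extended to \<open>f\<close>-related fields of the ambient manifold, where the bracket can be
  expressed by the torsion-free connection and \<open>\<nabla> J\<^sub>1\<close> by the connection forms.\<close>

proposition nijenhuis_formula:
  assumes ab: "adapted_basis A Q \<epsilon> f Je V U J" and \<omega>: "connection_forms A nabla U (adapted_signs \<epsilon>) J \<omega>"
    and x: "x \<in> V" and O: "open O'" "x \<in> O'" and X: "vfield_smooth B O' X" and Y: "vfield_smooth B O' Y"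
  shows "df x (nij X Y x) = J 2 (f x) (obstruction \<omega> x (df x (X x)) (df x (Y x)))"
proof -
  have V: "open V" "f ` V \<subseteq> U" and fr: "local_frame A Q U (adapted_signs \<epsilon>) J" and J1: "\<And>y. y \<in> V \<Longrightarrow> J 1 (f y) = Je y"
    using ab unfolding adapted_basis_def by blast+
  have U: "open U" and sJ: "endo_smooth A U (J 1)" and tr: "\<And>p. p \<in> U \<Longrightarrow> pq_triple (adapted_signs \<epsilon>) (\<lambda>i. J i p)"
    using fr unfolding local_frame_def by blast+
  have fx: "f x \<in> U" using V x by blast
  obtain c d V' W \<rho> \<Lambda> where r: "retraction c d V' W \<rho> \<Lambda>" and xV: "x \<in> V'" and V'N: "V' \<subseteq> V \<inter> O'"
    by (rule retraction_at[of "V \<inter> O'" x]) (use V O x in auto)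
  note rD = retractionD[OF r]
  have V': "open V'" "V' \<subseteq> V" "V' \<subseteq> O'" using rD(3) V'N by auto
  have X': "vfield_smooth B V' X" and Y': "vfield_smooth B V' Y"
    using M.vfield_smooth_subset[OF X V'(3)] M.vfield_smooth_subset[OF Y V'(3)] .
  have jX: "vfield_smooth B V' (\<lambda>y. jM y (X y))" and jY: "vfield_smooth B V' (\<lambda>y. jM y (Y y))"
    using induced_vfield_smooth[OF r Je_smooth df_jM V'(1) subset_refl X']
      induced_vfield_smooth[OF r Je_smooth df_jM V'(1) subset_refl Y'] .
  obtain Xa where Xa: "vfield_smooth A W Xa" "\<And>y. y \<in> V' \<Longrightarrow> Xa (f y) = df y (X y)"
    by (rule related_extension[OF r X']) (rule that, assumption+)
  obtain Ya where Ya: "vfield_smooth A W Ya" "\<And>y. y \<in> V' \<Longrightarrow> Ya (f y) = df y (Y y)"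
    by (rule related_extension[OF r Y']) (rule that, assumption+)
  define W' where "W' = W \<inter> U"
  have W': "open W'" "f x \<in> W'" "W' \<subseteq> W" "W' \<subseteq> U" using rD(5,7) U xV fx by (auto simp: W'_def)
  have sXa: "vfield_smooth A W' Xa" and sYa: "vfield_smooth A W' Ya"
    using N.vfield_smooth_subset[OF Xa(1) W'(3)] N.vfield_smooth_subset[OF Ya(1) W'(3)] .
  have sK: "endo_smooth A W' (J 1)" by (rule N.endo_smooth_subset[OF sJ W'(1,4)])
  have sKX: "vfield_smooth A W' (\<lambda>q. J 1 q (Xa q))" and sKY: "vfield_smooth A W' (\<lambda>q. J 1 q (Ya q))"
    using N.endo_smooth_apply[OF sK W'(1) subset_refl sXa] N.endo_smooth_apply[OF sK W'(1) subset_refl sYa] .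
  have rKX: "J 1 (f y) (Xa (f y)) = df y (jM y (X y))" and rKY: "J 1 (f y) (Ya (f y)) = df y (jM y (Y y))" if "y \<in> V'" for y
    using that Xa(2) Ya(2) J1 V'(2) by auto
  note rel = lie_bracket_related[OF V'(1) xV W'(1,2)]
  have b1: "df x (lie_bracket B (\<lambda>y. jM y (X y)) (\<lambda>y. jM y (Y y)) x) = lie_bracket A (\<lambda>q. J 1 q (Xa q)) (\<lambda>q. J 1 q (Ya q)) (f x)"
    by (rule rel[OF jX jY sKX sKY rKX rKY, symmetric])
  have b2: "df x (lie_bracket B (\<lambda>y. jM y (X y)) Y x) = lie_bracket A (\<lambda>q. J 1 q (Xa q)) Ya (f x)"
    by (rule rel[OF jX Y' sKX sYa rKX Ya(2), symmetric])
  have b3: "df x (lie_bracket B X (\<lambda>y. jM y (Y y)) x) = lie_bracket A Xa (\<lambda>q. J 1 q (Ya q)) (f x)"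
    by (rule rel[OF X' jY sXa sKY Xa(2) rKY, symmetric])
  have b4: "df x (lie_bracket B X Y x) = lie_bracket A Xa Ya (f x)"
    by (rule rel[OF X' Y' sXa sYa Xa(2) Ya(2), symmetric])
  have J1x: "J 1 (f x) = Je x" by (rule J1[OF x])
  have "df x (nij X Y x) =
      lie_bracket A (\<lambda>q. J 1 q (Xa q)) (\<lambda>q. J 1 q (Ya q)) (f x)
      - J 1 (f x) (lie_bracket A (\<lambda>q. J 1 q (Xa q)) Ya (f x)) - J 1 (f x) (lie_bracket A Xa (\<lambda>q. J 1 q (Ya q)) (f x))
      + \<epsilon> *\<^sub>R lie_bracket A Xa Ya (f x)"
    unfolding nijenhuis_def b1[symmetric] b2[symmetric] b3[symmetric] b4[symmetric] J1x
    by (simp add: linear_add[OF differential_linear] linear_diff[OF differential_linear] linear_scale[OF differential_linear])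
  also have "\<dots> = cov_endo A nabla (J 1) (f x) (J 1 (f x) (Xa (f x))) (Ya (f x)) - cov_endo A nabla (J 1) (f x) (J 1 (f x) (Ya (f x))) (Xa (f x))
      + J 1 (f x) (cov_endo A nabla (J 1) (f x) (Ya (f x)) (Xa (f x))) - J 1 (f x) (cov_endo A nabla (J 1) (f x) (Xa (f x)) (Ya (f x)))"
    by (rule P.nijenhuis_torsion_free[OF torsion_free W'(1,2) sK _ sXa sYa]) (simp_all add: J1x Je_compose)
  also have "\<dots> = J 2 (f x) (obstruction \<omega> x (df x (X x)) (df x (Y x)))"
  proof -
    have "case (1::nat, 2::nat, 3::nat) of (\<alpha>, \<beta>, \<gamma>) \<Rightarrow> cov_endo A nabla (J \<alpha>) (f x) v =
        - (adapted_signs \<epsilon> \<beta> * \<omega> \<gamma> (f x) v) *\<^sub>R J \<beta> (f x) + (adapted_signs \<epsilon> \<gamma> * \<omega> \<beta> (f x) v) *\<^sub>R J \<gamma> (f x)" for v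
      using \<omega> fx unfolding connection_forms_def by blast
    then have cov: "cov_endo A nabla (J 1) (f x) v = - (\<omega> 3 (f x) v) *\<^sub>R J 2 (f x) - (\<epsilon> * \<omega> 2 (f x) v) *\<^sub>R J 3 (f x)" for v
      by (simp add: adapted_signs_def)
    note t = pq_tripleD[OF tr[OF fx], unfolded adapted_signs_def]
    have t1: "Je x (J 2 (f x) w) = J 3 (f x) w" "Je x (J 3 (f x) w) = \<epsilon> *\<^sub>R J 2 (f x) w" "J 2 (f x) (Je x w) = - J 3 (f x) w" for w
      using t(7)[of w] t(8)[of w] t(4)[of w] by (simp_all add: J1x)
    note lin = P.connection_forms_linear[OF fr \<omega> fx]
    let ?X = "df x (X x)" and ?Y = "df x (Y x)" and ?w2 = "\<omega> 2 (f x)" and ?w3 = "\<omega> 3 (f x)"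
    have c2: "covector \<omega> x (Je x v) = \<epsilon> * ?w3 v - ?w2 (Je x v)" for v
      unfolding covector_def by (simp add: linear_scale[OF lin(2)])
    have ee: "\<epsilon> * (\<epsilon> * r) = r" for r using eps_square by (simp add: mult.assoc[symmetric])
    show ?thesis
      unfolding cov J1x Xa(2)[OF xV] Ya(2)[OF xV] obstruction_def c2
      by (simp add: covector_def blinfun.diff_left blinfun.diff_right blinfun.add_right blinfun.add_left blinfun.scaleR_left
          blinfun.scaleR_right blinfun.minus_left blinfun.minus_right t1 algebra_simps ee)
  qed
  finally show ?thesis .
qed

definition nij_zero :: "'b \<Rightarrow> bool" where
  "nij_zero x \<longleftrightarrow> (\<forall>O' X Y. open O' \<longrightarrow> x \<in> O' \<longrightarrow> vfield_smooth B O' X \<longrightarrow> vfield_smooth B O' Y \<longrightarrow> nij X Y x = 0)"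

lemma integrable_iff: "integrable_structure B \<epsilon> jM \<longleftrightarrow> (\<forall>x. nij_zero x)"
  unfolding integrable_structure_def nij_zero_def by blast

text \<open>By the formula the value of the Nijenhuis expression at \<open>x\<close> only depends on the values of the fields at
  \<open>x\<close>, all of which are attained by coordinate fields.\<close>

lemma nij_zeroI:
  assumes c: "compatible_chart B c" and x: "x \<in> fst c"
    and z: "\<And>a b. nij (coord_field B c a) (coord_field B c b) x = 0"
  shows "nij_zero x"
  unfolding nij_zero_def
proof (intro allI impI)
  fix O' X Y assume O: "open O'" "x \<in> O'" and X: "vfield_smooth B O' X" and Y: "vfield_smooth B O' Y"
  obtain V U J \<omega> where x': "x \<in> V" and ab: "adapted_basis A Q \<epsilon> f Je V U J"
    and \<omega>: "connection_forms A nabla U (adapted_signs \<epsilon>) J \<omega>" by (rule adapted_basis_at)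
  let ?a = "tderiv B (snd c) x (X x)" and ?b = "tderiv B (snd c) x (Y x)"
  have "df x (nij X Y x) = df x (nij (coord_field B c ?a) (coord_field B c ?b) x)"
    unfolding nijenhuis_formula[OF ab \<omega> x' O X Y]
      nijenhuis_formula[OF ab \<omega> x' is_chartD(1)[OF M.is_chart[OF c]] x M.coord_field_smooth[OF c] M.coord_field_smooth[OF c]]
    using M.coord_field_tderiv[OF c x] by simp
  then show "nij X Y x = 0" using z by simp
qed

text \<open>Tangent vectors extend to coordinate fields, to which the formula applies; its left-hand side is
  tangent, and \<open>J\<^sub>2\<close> is an involution.\<close>

lemma obstruction_of_tangent_vectors:
  assumes ab: "adapted_basis A Q \<epsilon> f Je V U J" and \<omega>: "connection_forms A nabla U (adapted_signs \<epsilon>) J \<omega>" and x: "x \<in> V"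
  shows "\<exists>X. J 2 (f x) (obstruction \<omega> x (df x v) (df x w)) = df x X" "nij_zero x \<Longrightarrow> obstruction \<omega> x (df x v) (df x w) = 0"
proof -
  let ?c = "ref_chart B x"
  have c: "compatible_chart B ?c" "x \<in> fst ?c" using M.ref_chart[of x] by auto
  note o = is_chartD(1)[OF M.is_chart[OF c(1)]]
  let ?X = "extend_vec B x v" and ?Y = "extend_vec B x w"
  have eq: "df x (nij ?X ?Y x) = J 2 (f x) (obstruction \<omega> x (df x v) (df x w))"
    using nijenhuis_formula[OF ab \<omega> x o c(2) M.extend_vec_smooth M.extend_vec_smooth, of v w] by simp
  then show "\<exists>X. J 2 (f x) (obstruction \<omega> x (df x v) (df x w)) = df x X" by metis
  assume "nij_zero x"
  then have "nij ?X ?Y x = 0"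
    unfolding nij_zero_def using o c(2) M.extend_vec_smooth by blast
  then have 0: "J 2 (f x) (obstruction \<omega> x (df x v) (df x w)) = 0"
    using eq by (simp add: linear_0[OF differential_linear])
  have t: "pq_triple (adapted_signs \<epsilon>) (\<lambda>i. J i (f x))"
    using ab x unfolding adapted_basis_def local_frame_def by blast
  have "J 2 (f x) (J 2 (f x) u) = u" for u
    using pq_tripleD(2)[OF t, of u] by (simp add: adapted_signs_def)
  then show "obstruction \<omega> x (df x v) (df x w) = 0"
    using 0 by (metis blinfun.zero_right)
qed

lemma nij_zero_of_covector:
  assumes ab: "adapted_basis A Q \<epsilon> f Je V U J" and \<omega>: "connection_forms A nabla U (adapted_signs \<epsilon>) J \<omega>" and x: "x \<in> V"
    and 0: "\<And>v. covector \<omega> x (df x v) = 0"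
  shows "nij_zero x"
  unfolding nij_zero_def
proof (intro allI impI)
  fix O' X Y assume O: "open O'" "x \<in> O'" and X: "vfield_smooth B O' X" and Y: "vfield_smooth B O' Y"
  have "covector \<omega> x (Je x (df x v)) = 0" for v using 0[of "jM x v"] by simp
  then have "df x (nij X Y x) = 0"
    using nijenhuis_formula[OF ab \<omega> x O X Y] 0 by (simp add: obstruction_def)
  then show "nij X Y x = 0" by simp
qed

lemma tangent_space:
  shows "subspace (range (df x))" "dim (range (df x)) = DIM('f)" "Je x ` range (df x) \<subseteq> range (df x)"
    and "\<epsilon> = 1 \<Longrightarrow> dim (eigenspace_in (Je x) (range (df x)) 1) = dim (eigenspace_in (Je x) (range (df x)) (-1))"
proof -
  show sT: "subspace (range (df x))" by (rule linear_subspace_image[OF differential_linear subspace_UNIV])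
  show "dim (range (df x)) = DIM('f)"
    using dim_image_eq[OF differential_linear, of x UNIV] inj_df by simp
  show JT: "Je x ` range (df x) \<subseteq> range (df x)" using Je_range by simp
  assume e: "\<epsilon> = 1"
  have bil: "bilinear (g (f x))" and skw: "skew_symmetric_structure g Q"
    using pqk unfolding para_quaternionic_kaehler_def pseudo_riemannian_def by blast+
  show "dim (eigenspace_in (Je x) (range (df x)) 1) = dim (eigenspace_in (Je x) (range (df x)) (-1))"
  proof (rule dim_eigenspaces_skew[OF bil bounded_linear.linear[OF blinfun.bounded_linear_right] sT JT])
    show "Je x (Je x v) = v" for v using e by simp
    show "g (f x) (Je x v) w = - g (f x) v (Je x w)" for v w
      using skw Je_Q unfolding skew_symmetric_structure_def by blast
    fix v assume v: "v \<in> range (df x)" "\<And>w. w \<in> range (df x) \<Longrightarrow> g (f x) v w = 0"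
    then obtain u where u: "v = df x u" by blast
    have "\<forall>w. g (f x) (df x u) (df x w) = 0" using v(2) u by blast
    then have "u = 0" using sub unfolding almost_eps_hermitian_submanifold_def by blast
    then show "v = 0" using u by simp
  qed
qed

lemma covector_linear:
  assumes ab: "adapted_basis A Q \<epsilon> f Je V U J" and \<omega>: "connection_forms A nabla U (adapted_signs \<epsilon>) J \<omega>" and x: "x \<in> V"
  shows "linear (covector \<omega> x)"
proof -
  have fr: "local_frame A Q U (adapted_signs \<epsilon>) J" and fx: "f x \<in> U"
    using ab x unfolding adapted_basis_def by blast+
  note lin = P.connection_forms_linear[OF fr \<omega> fx]
  show ?thesis
    by (rule linearI) (simp_all add: covector_def blinfun.add_right blinfun.scaleR_right linear_add[OF lin(1)] linear_add[OF lin(2)]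
        linear_scale[OF lin(1)] linear_scale[OF lin(2)] algebra_simps)
qed

text \<open>Here the obstruction vanishes for all pairs of tangent vectors.\<close>

lemma covector_of_nij_zero:
  assumes ab: "adapted_basis A Q \<epsilon> f Je V U J" and \<omega>: "connection_forms A nabla U (adapted_signs \<epsilon>) J \<omega>" and x: "x \<in> V"
    and nz: "nij_zero x" and dim: "DIM('f) > 2"
  shows "covector \<omega> x (df x v) = 0"
proof (rule covector_vanishes[OF eps bounded_linear.linear[OF blinfun.bounded_linear_right] Je_Je tangent_space(1,3)
      subspace_single_0 _ _ covector_linear[OF ab \<omega> x]])
  show "Je x ` {0} \<subseteq> {0}" by simp
  show "{0} \<subseteq> range (df x)" using subspace_0[OF tangent_space(1)] by simp
  show "dim {0 :: 'e} + 2 < dim (range (df x))" using dim tangent_space(2) by simp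
  show "dim (eigenspace_in (Je x) {0} 1) = dim (eigenspace_in (Je x) {0} (-1))"
  proof -
    have "eigenspace_in (Je x) {0} s = {0}" for s by (auto simp: eigenspace_in_def)
    then show ?thesis by simp
  qed
  fix X Y assume "X \<in> range (df x)" "Y \<in> range (df x)"
  then obtain v w where "X = df x v" "Y = df x w" by blast
  then show "covector \<omega> x Y *\<^sub>R X + (\<epsilon> * covector \<omega> x (Je x Y)) *\<^sub>R Je x X - covector \<omega> x X *\<^sub>R Y -
      (\<epsilon> * covector \<omega> x (Je x X)) *\<^sub>R Je x Y \<in> {0}"
    using obstruction_of_tangent_vectors(2)[OF ab \<omega> x nz, of v w] by (simp add: obstruction_def)
qed (use tangent_space(4) in auto)

text \<open>The tangent vectors that \<open>J\<^sub>2\<close> maps to tangent vectors form the maximal \<open>Q\<close>-invariant subspace, and the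
  last condition says that \<open>E\<close> meets it trivially.  In contrast to the dimension of a pure complement
  this condition is visibly stable under small changes of the point.\<close>

definition transversal :: "(nat \<Rightarrow> 'a \<Rightarrow> 'e \<Rightarrow>\<^sub>L 'e) \<Rightarrow> 'b \<Rightarrow> 'f set \<Rightarrow> bool" where
  "transversal J x E \<longleftrightarrow> subspace E \<and> dim E > 2 \<and> (\<forall>w\<in>E. \<forall>v. J 2 (f x) (df x w) = df x v \<longrightarrow> w = 0)"

text \<open>The Nijenhuis tensor takes tangent values, so the obstruction lies in the maximal invariant subspace
  \<open>S\<close>.  The space \<open>E\<close> shows that \<open>S\<close> has codimension greater than 2, and \<open>J\<^sub>2\<close> exchanges the eigenspaces of the
  structure on \<open>S\<close>.\<close>

lemma covector_of_transversal:
  assumes ab: "adapted_basis A Q \<epsilon> f Je V U J" and \<omega>: "connection_forms A nabla U (adapted_signs \<epsilon>) J \<omega>" and x: "x \<in> V"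
    and E: "transversal J x E"
  shows "covector \<omega> x (df x v) = 0"
proof -
  let ?T = "range (df x)"
  define S where "S = {u \<in> ?T. J 2 (f x) u \<in> ?T}"
  have t: "pq_triple (adapted_signs \<epsilon>) (\<lambda>i. J i (f x))" and J1: "J 1 (f x) = Je x"
    using ab x unfolding adapted_basis_def local_frame_def by blast+
  have J22: "J 2 (f x) (J 2 (f x) u) = u" and J21: "J 2 (f x) (Je x u) = - Je x (J 2 (f x) u)" for u
    using pq_tripleD(2,4)[OF t, of u] by (simp_all add: adapted_signs_def J1)
  note T = tangent_space[of x]
  have S: "subspace S" "S \<subseteq> ?T"
    unfolding S_def subspace_def
    using T(1) by (auto simp: blinfun.add_right blinfun.scaleR_right subspace_0 subspace_add subspace_scale simp del: range_eqI)
  have JS: "Je x ` S \<subseteq> S"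
  proof
    fix u assume "u \<in> Je x ` S"
    then obtain s where s: "s \<in> ?T" "J 2 (f x) s \<in> ?T" "u = Je x s" by (auto simp: S_def)
    have "u \<in> ?T" "Je x (J 2 (f x) s) \<in> ?T" using s T(3) by blast+
    then show "u \<in> S" using s J21 subspace_neg[OF T(1)] by (simp add: S_def)
  qed
  have ES: "dim ?T \<ge> dim S + dim E"
  proof -
    have E': "subspace E" "dim E > 2" "\<And>w v. w \<in> E \<Longrightarrow> J 2 (f x) (df x w) = df x v \<Longrightarrow> w = 0"
      using E unfolding transversal_def by blast+
    have sE: "subspace (df x ` E)" by (rule linear_subspace_image[OF differential_linear E'(1)])
    have dE: "dim (df x ` E) = dim E"
      by (rule dim_image_eq[OF differential_linear]) (rule inj_on_subset[OF inj_df subset_UNIV])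
    have "S \<inter> df x ` E \<subseteq> {0}"
    proof
      fix u assume u: "u \<in> S \<inter> df x ` E"
      then obtain w where w: "w \<in> E" "u = df x w" by blast
      have "J 2 (f x) u \<in> ?T" using u by (simp add: S_def)
      then obtain v where "J 2 (f x) u = df x v" by blast
      then show "u \<in> {0}" using E'(3) w by simp
    qed
    then have "S \<inter> df x ` E = {0}" using subspace_0[OF S(1)] subspace_0[OF sE] by blast
    then have "dim {a + b |a b. a \<in> S \<and> b \<in> df x ` E} = dim S + dim E"
      using dim_sums_Int[OF S(1) sE] dE by simp
    moreover have "{a + b |a b. a \<in> S \<and> b \<in> df x ` E} \<subseteq> ?T"
      using S(2) subspace_add[OF T(1)] by blast
    ultimately show ?thesis using dim_subset[of "{a + b |a b. a \<in> S \<and> b \<in> df x ` E}" ?T] by linarith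
  qed
  show ?thesis
  proof (rule covector_vanishes[OF eps bounded_linear.linear[OF blinfun.bounded_linear_right] Je_Je T(1,3)
        S(1) JS S(2) covector_linear[OF ab \<omega> x]])
    show "dim S + 2 < dim ?T" using ES E unfolding transversal_def by linarith
    show "dim (eigenspace_in (Je x) S 1) = dim (eigenspace_in (Je x) S (-1))"
    proof -
      let ?E = "eigenspace_in (Je x) S"
      have le: "dim (?E s) \<le> dim (?E (- s))" for s
      proof -
        have inj: "inj (J 2 (f x))" by (rule inj_on_inverseI[of _ "J 2 (f x)"]) (rule J22)
        have "dim (J 2 (f x) ` ?E s) = dim (?E s)"
          by (rule dim_image_eq[OF bounded_linear.linear[OF blinfun.bounded_linear_right]]) (rule inj_on_subset[OF inj subset_UNIV])
        moreover have "J 2 (f x) ` ?E s \<subseteq> ?E (- s)"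
        proof
          fix u assume "u \<in> J 2 (f x) ` ?E s"
          then obtain w where w: "w \<in> ?T" "J 2 (f x) w \<in> ?T" "Je x w = s *\<^sub>R w" "u = J 2 (f x) w"
            by (auto simp: eigenspace_in_def S_def)
          have "Je x u = - J 2 (f x) (Je x w)" using J21[of w] w(4) by simp
          then show "u \<in> ?E (- s)"
            using w J22[of w] by (simp add: eigenspace_in_def S_def blinfun.scaleR_right)
        qed
        ultimately show ?thesis using dim_subset[of "J 2 (f x) ` ?E s" "?E (- s)"] by linarith
      qed
      show ?thesis using le[of 1] le[of "-1"] by simp
    qed
    fix X Y assume "X \<in> ?T" "Y \<in> ?T"
    then obtain v w where vw: "X = df x v" "Y = df x w" by blast
    have "obstruction \<omega> x X Y \<in> ?T"
    proof -
      have "obstruction \<omega> x X Y = df x (covector \<omega> x Y *\<^sub>R v + (\<epsilon> * covector \<omega> x (Je x Y)) *\<^sub>R jM x v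
          - covector \<omega> x X *\<^sub>R w - (\<epsilon> * covector \<omega> x (Je x X)) *\<^sub>R jM x w)"
        by (simp add: obstruction_def vw linear_add[OF differential_linear] linear_diff[OF differential_linear] linear_scale[OF differential_linear])
      then show ?thesis by blast
    qed
    moreover have "J 2 (f x) (obstruction \<omega> x X Y) \<in> ?T"
      using obstruction_of_tangent_vectors(1)[OF ab \<omega> x, of v w] vw by auto
    ultimately show "covector \<omega> x Y *\<^sub>R X + (\<epsilon> * covector \<omega> x (Je x Y)) *\<^sub>R Je x X - covector \<omega> x X *\<^sub>R Y -
        (\<epsilon> * covector \<omega> x (Je x X)) *\<^sub>R Je x Y \<in> S"
      by (simp add: S_def obstruction_def)
  qed (use T(4) in auto)
qed

lemma nij_zero_of_transversal:
  assumes ab: "adapted_basis A Q \<epsilon> f Je V U J" and x: "x \<in> V" and E: "transversal J x E"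
  shows "nij_zero x"
proof -
  have par: "parallel_structure A nabla Q" and fr: "local_frame A Q U (adapted_signs \<epsilon>) J"
    using pqk ab unfolding para_quaternionic_kaehler_def adapted_basis_def by blast+
  obtain \<omega> where "connection_forms A nabla U (adapted_signs \<epsilon>) J \<omega>"
    using P.connection_forms_exist[OF par fr] by blast
  then show ?thesis using nij_zero_of_covector[OF ab _ x] covector_of_transversal[OF ab _ x E] by blast
qed

text \<open>As \<open>J\<^sub>3 = J\<^sub>1 J\<^sub>2\<close> and the tangent space is invariant under \<open>J\<^sub>1\<close>, invariance only has to be tested with
  \<open>J\<^sub>2\<close>.\<close>

lemma max_Q_invariant_eq:
  assumes ab: "adapted_basis A Q \<epsilon> f Je V U J" and x: "x \<in> V"
  shows "max_Q_invariant (Q (f x)) (range (df x)) = {u \<in> range (df x). J 2 (f x) u \<in> range (df x)}"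
  unfolding max_Q_invariant_def
proof (rule Greatest_equality)
  let ?T = "range (df x)" and ?S = "{u \<in> range (df x). J 2 (f x) u \<in> range (df x)}"
  have t: "pq_triple (adapted_signs \<epsilon>) (\<lambda>i. J i (f x))" and J1: "J 1 (f x) = Je x" and Qs: "Q (f x) = span {J 1 (f x), J 2 (f x), J 3 (f x)}"
    using ab x unfolding adapted_basis_def local_frame_def by blast+
  note T = tangent_space[of x]
  have J2: "J 2 (f x) (J 2 (f x) u) = u" "J 2 (f x) (Je x u) = - Je x (J 2 (f x) u)" "J 3 (f x) u = Je x (J 2 (f x) u)" for u
    using pq_tripleD(2,4)[OF t, of u] pq_tripleD(7)[OF t, of u] by (simp_all add: adapted_signs_def J1)
  have S: "subspace ?S"
    unfolding subspace_def
    using T(1) by (auto simp: blinfun.add_right blinfun.scaleR_right subspace_0 subspace_add subspace_scale simp del: range_eqI)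
  have 1: "Je x u \<in> ?S" if "u \<in> ?S" for u
  proof -
    have "Je x u \<in> ?T" "Je x (J 2 (f x) u) \<in> ?T" using that T(3) by blast+
    then show ?thesis using J2(2)[of u] subspace_neg[OF T(1), of "Je x (J 2 (f x) u)"] by simp
  qed
  have 2: "J 2 (f x) u \<in> ?S" if "u \<in> ?S" for u
    using that J2(1)[of u] by auto
  have "K u \<in> ?S" if K: "K \<in> Q (f x)" and u: "u \<in> ?S" for K u
  proof -
    obtain a where "K = comb3 (\<lambda>i. J i (f x)) a"
      using K Qs span3_iff[of K "\<lambda>i. J i (f x)"] by auto
    then have "K u = a 1 *\<^sub>R Je x u + a 2 *\<^sub>R J 2 (f x) u + a 3 *\<^sub>R Je x (J 2 (f x) u)"
      by (simp add: comb3_def J1 blinfun.add_left blinfun.scaleR_left J2(3))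
    then show ?thesis
      using subspace_add[OF S subspace_add[OF S subspace_scale[OF S 1[OF u]] subspace_scale[OF S 2[OF u]]] subspace_scale[OF S 1[OF 2[OF u]]]]
      by simp
  qed
  then show "subspace ?S \<and> ?S \<subseteq> ?T \<and> Q_invariant (Q (f x)) ?S"
    using S unfolding Q_invariant_def by blast
  fix S' assume S': "subspace S' \<and> S' \<subseteq> ?T \<and> Q_invariant (Q (f x)) S'"
  have "J 2 (f x) \<in> Q (f x)" unfolding Qs by (rule span_base) simp
  then have "J 2 (f x) u \<in> S'" if "u \<in> S'" for u using S' that unfolding Q_invariant_def by blast
  then show "S' \<le> ?S" using S' by blast
qed

lemma transversal_of_pure_complement:
  assumes ab: "adapted_basis A Q \<epsilon> f Je V U J" and x: "x \<in> V"
    and D: "pure_complement (Q (f x)) (Je x) (range (df x)) D" and dim: "dim D > 2"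
  shows "transversal J x (df x -` D)"
proof -
  let ?S = "{u \<in> range (df x). J 2 (f x) u \<in> range (df x)}"
  have D': "subspace D" "?S \<inter> D = {0}" "{u + v | u v. u \<in> ?S \<and> v \<in> D} = range (df x)"
    using D unfolding pure_complement_def max_Q_invariant_eq[OF ab x] by blast+
  have "0 \<in> ?S" using D'(2) by blast
  have DT: "D \<subseteq> range (df x)"
  proof
    fix v assume "v \<in> D"
    then have "0 + v \<in> {u + v | u v. u \<in> ?S \<and> v \<in> D}" using \<open>0 \<in> ?S\<close> by blast
    then show "v \<in> range (df x)" unfolding D'(3) by simp
  qed
  have sub: "subspace (df x -` D)" by (rule linear_subspace_vimage[OF differential_linear D'(1)])
  have "df x ` (df x -` D) = D" using DT by auto
  moreover have "dim (df x ` (df x -` D)) = dim (df x -` D)"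
    by (rule dim_image_eq[OF differential_linear]) (rule inj_on_subset[OF inj_df subset_UNIV])
  ultimately have dE: "dim (df x -` D) = dim D" by simp
  have inj: "w = 0" if w: "w \<in> df x -` D" "J 2 (f x) (df x w) = df x v" for w v
  proof -
    have "df x w \<in> ?S \<inter> D" using w by auto
    then show ?thesis unfolding D'(2) by simp
  qed
  show ?thesis
    unfolding transversal_def dE using sub dim inj by blast
qed

end

section \<open>Propagation of integrability\<close>

context smooth_manifold
begin

lemma vfield_smooth_local:
  assumes "\<And>p. p \<in> U \<Longrightarrow> \<exists>V. open V \<and> p \<in> V \<and> vfield_smooth A V X"
  shows "vfield_smooth A U X"
  unfolding vfield_smooth_def fun_smooth_def
proof (intro ballI)
  fix c d assume c: "c \<in> A" and d: "d \<in> A"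
  show "smooth_on (snd d ` (fst d \<inter> (U \<inter> fst c))) ((\<lambda>p. tderiv A (snd c) p (X p)) \<circ> chart_inv d)"
  proof (rule smooth_on_local)
    fix u assume "u \<in> snd d ` (fst d \<inter> (U \<inter> fst c))"
    then obtain p where p: "p \<in> fst d" "p \<in> U" "p \<in> fst c" "u = snd d p" by blast
    obtain V where V: "open V" "p \<in> V" "vfield_smooth A V X" using assms[OF p(2)] by blast
    have "open (V \<inter> fst c)" using V(1) chart_domain_open[OF c] by blast
    then have "open (snd d ` (fst d \<inter> (V \<inter> fst c)))"
      by (rule chart_image_open[OF is_chart[OF compatible[OF d]]])
    moreover have "u \<in> snd d ` (fst d \<inter> (V \<inter> fst c))" using p V(2) by blast
    moreover have "smooth_on (snd d ` (fst d \<inter> (V \<inter> fst c))) ((\<lambda>p. tderiv A (snd c) p (X p)) \<circ> chart_inv d)"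
      using vfield_smooth_chart[OF c V(3)] d unfolding fun_smooth_def by blast
    ultimately show "\<exists>W. open W \<and> u \<in> W \<and> smooth_on W ((\<lambda>p. tderiv A (snd c) p (X p)) \<circ> chart_inv d)"
      by (intro exI conjI)
  qed
qed

end

text \<open>An injective linear map is bounded below on a finite-dimensional space, and the bound survives small
  perturbations.\<close>

lemma injective_family_open:
  fixes \<Phi> :: "'b::topological_space \<Rightarrow> 'h::euclidean_space \<Rightarrow> 'e::euclidean_space"
  assumes N: "open N" "x \<in> N" and lin: "\<And>y. y \<in> N \<Longrightarrow> linear (\<Phi> y)"
    and cont: "\<And>h. continuous_on N (\<lambda>y. \<Phi> y h)" and H: "subspace H"
    and inj: "\<And>h. h \<in> H \<Longrightarrow> \<Phi> x h = 0 \<Longrightarrow> h = 0"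
  obtains N' where "open N'" "x \<in> N'" "N' \<subseteq> N" "\<And>y h. y \<in> N' \<Longrightarrow> h \<in> H \<Longrightarrow> \<Phi> y h = 0 \<Longrightarrow> h = 0"
proof -
  have bl: "bounded_linear (\<Phi> x)" using lin[OF N(2)] linear_conv_bounded_linear by blast
  obtain e where e: "e > 0" "\<And>h. h \<in> H \<Longrightarrow> e * norm h \<le> norm (\<Phi> x h)"
    using injective_imp_isometric[OF closed_subspace[OF H] H bl] inj by blast
  define c where "c y = (\<Sum>b\<in>Basis. norm (\<Phi> y b - \<Phi> x b))" for y
  have "continuous_on N c"
    unfolding c_def by (intro continuous_intros cont)
  then have o: "open (N \<inter> c -` {..<e})"
    by (rule continuous_open_preimage[OF _ N(1) open_lessThan])
  have est: "norm (\<Phi> y h - \<Phi> x h) \<le> c y * norm h" if "y \<in> N" for y h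
  proof -
    have "\<Phi> y h - \<Phi> x h = (\<Sum>b\<in>Basis. (h \<bullet> b) *\<^sub>R (\<Phi> y b - \<Phi> x b))"
      using linear_eq_sum_Basis[OF lin[OF that], of h] linear_eq_sum_Basis[OF lin[OF N(2)], of h]
      by (simp add: sum_subtractf scaleR_diff_right)
    also have "norm \<dots> \<le> (\<Sum>b\<in>Basis. norm ((h \<bullet> b) *\<^sub>R (\<Phi> y b - \<Phi> x b)))" by (rule norm_sum)
    also have "\<dots> \<le> (\<Sum>b\<in>Basis. norm (\<Phi> y b - \<Phi> x b) * norm h)"
    proof (rule sum_mono)
      fix b :: 'h assume "b \<in> Basis"
      then show "norm ((h \<bullet> b) *\<^sub>R (\<Phi> y b - \<Phi> x b)) \<le> norm (\<Phi> y b - \<Phi> x b) * norm h"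
        using mult_right_mono[OF Basis_le_norm[of b h], of "norm (\<Phi> y b - \<Phi> x b)"] by (simp add: mult.commute)
    qed
    finally show ?thesis by (simp add: c_def sum_distrib_right)
  qed
  show thesis
  proof (rule that[OF o])
    show "x \<in> N \<inter> c -` {..<e}" using N e by (simp add: c_def)
    fix y h assume y: "y \<in> N \<inter> c -` {..<e}" and h: "h \<in> H" and 0: "\<Phi> y h = 0"
    have "e * norm h \<le> norm (\<Phi> x h)" by (rule e(2)[OF h])
    also have "\<dots> \<le> c y * norm h" using est[of y h] y 0 by simp
    finally have "(e - c y) * norm h \<le> 0" by (simp add: algebra_simps)
    moreover have "e - c y > 0" using y by simp
    ultimately show "h = 0" by (simp add: mult_le_0_iff)
  qed simp
qed

context eps_hermitian
begin

lemma jM_smooth: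
  assumes O: "open O'" and X: "vfield_smooth B O' X"
  shows "vfield_smooth B O' (\<lambda>x. jM x (X x))"
proof (rule M.vfield_smooth_local)
  fix x assume x: "x \<in> O'"
  obtain c d V W \<rho> \<Lambda> where r: "retraction c d V W \<rho> \<Lambda>" and xV: "x \<in> V" and VO: "V \<subseteq> O'"
    by (rule retraction_at[OF O x])
  have "open V" by (rule retractionD(3)[OF r])
  then show "\<exists>V. open V \<and> x \<in> V \<and> vfield_smooth B V (\<lambda>x. jM x (X x))"
    using xV induced_vfield_smooth[OF r Je_smooth df_jM \<open>open V\<close> subset_refl M.vfield_smooth_subset[OF X VO]] by blast
qed

lemma nij_smooth:
  assumes O: "open O'" and X: "vfield_smooth B O' X" and Y: "vfield_smooth B O' Y"
  shows "vfield_smooth B O' (nij X Y)"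
proof -
  note jX = jM_smooth[OF O X] and jY = jM_smooth[OF O Y]
  note lie = M.lie_bracket_smooth[OF O]
  have "vfield_smooth B O' (\<lambda>x. (lie_bracket B (\<lambda>y. jM y (X y)) (\<lambda>y. jM y (Y y)) x
      + - jM x (lie_bracket B (\<lambda>y. jM y (X y)) Y x)) + - jM x (lie_bracket B X (\<lambda>y. jM y (Y y)) x)
      + \<epsilon> *\<^sub>R lie_bracket B X Y x)"
    by (rule M.vfield_smooth_add[OF O M.vfield_smooth_add[OF O M.vfield_smooth_add[OF O lie[OF jX jY]
        M.vfield_smooth_minus[OF O jM_smooth[OF O lie[OF jX Y]]]] M.vfield_smooth_minus[OF O jM_smooth[OF O lie[OF X jY]]]]
        M.vfield_smooth_scaleR[OF O M.fun_smooth_const lie[OF X Y]]])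
  then show ?thesis
    unfolding nijenhuis_def[abs_def] by simp
qed

lemma nij_zero_of_dense:
  assumes D: "closure D = UNIV" and zero: "\<And>x. x \<in> D \<Longrightarrow> nij_zero x"
  shows "nij_zero x"
  unfolding nij_zero_def
proof (intro allI impI)
  fix O' X Y assume O: "open O'" "x \<in> O'" and X: "vfield_smooth B O' X" and Y: "vfield_smooth B O' Y"
  show "nij X Y x = 0"
  proof (rule M.vfield_zero_of_dense[OF O(1) nij_smooth[OF O(1) X Y] D _ O(2)])
    show "nij X Y q = 0" if "q \<in> O'" "q \<in> D" for q
      using zero[OF that(2)] that(1) O(1) X Y unfolding nij_zero_def by blast
  qed
qed

text \<open>The condition means that \<open>(v, w) \<mapsto> df v + J\<^sub>2 (df w)\<close> is injective for arbitrary \<open>v\<close> and \<open>w \<in> E\<close>.  In charts these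
  maps form a continuous family.\<close>

lemma transversal_open:
  assumes ab: "adapted_basis A Q \<epsilon> f Je V U J" and x: "x \<in> V" and E: "transversal J x E"
  obtains N' where "open N'" "x \<in> N'" "N' \<subseteq> V" "\<And>y. y \<in> N' \<Longrightarrow> \<exists>E'. transversal J y E'"
proof -
  have V: "open V" "f ` V \<subseteq> U" and fr: "local_frame A Q U (adapted_signs \<epsilon>) J"
    using ab unfolding adapted_basis_def by blast+
  have U: "open U" and sJ: "endo_smooth A U (J 2)"
    using fr unfolding local_frame_def by blast+
  define c d where "c = ref_chart B x" and "d = ref_chart A (f x)"
  have c: "c \<in> B" "x \<in> fst c" and d: "d \<in> A" "f x \<in> fst d"
    using M.ref_chart[of x] N.ref_chart[of "f x"] by (auto simp: c_def d_def)
  note cc = M.compatible[OF c(1)] and dc = N.compatible[OF d(1)]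
  define N0 where "N0 = V \<inter> fst c \<inter> f -` fst d"
  have N0: "open N0" "x \<in> N0" "N0 \<subseteq> V" "N0 \<subseteq> fst c" "f ` N0 \<subseteq> fst d"
    unfolding N0_def using V(1) M.chart_domain_open[OF c(1)] open_vimage_map[OF N.chart_domain_open[OF d(1)]] x c d by auto
  have fU: "f y \<in> U" "f y \<in> fst d" "y \<in> fst c" if "y \<in> N0" for y
  proof -
    have "y \<in> V" using that N0(3) by blast
    then show "f y \<in> U" "f y \<in> fst d" "y \<in> fst c" using that N0(4,5) V(2) by blast+
  qed
  let ?z = "\<lambda>w y. tderiv A (snd d) (f y) (df y (coord_field B c w y))"
  let ?M = "\<lambda>y w. tderiv A (snd d) (f y) (J 2 (f y) (coord_field A d w (f y)))"
  define \<Phi> where "\<Phi> y h = ?z (fst h) y + ?M y (?z (snd h) y)" for y and h :: "'f \<times> 'f"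
  have z_lin: "linear (\<lambda>w. ?z w y)" if "y \<in> N0" for y
    using linear_compose[OF linear_compose[OF M.coord_field_linear[OF cc fU(3)[OF that]] differential_linear]
        N.tderiv_linear[OF dc fU(2)[OF that]]] by (simp add: o_def)
  have M_lin: "linear (?M y)" if "y \<in> N0" for y
    by (rule endo_along_matrix_linear[OF d(1) fU(2)[OF that]])
  have z: "fun_smooth B N0 (?z w)" for w
    by (rule differential_comp_smooth[OF c(1) d(1) N0(1,4,5) M.vfield_smooth_subset[OF M.coord_field_smooth[OF cc] N0(4)]])
  have MM: "fun_smooth B N0 (\<lambda>y. ?M y w)" for w
    by (rule M.fun_smooth_subset[OF endo_matrix_smooth[OF sJ U d(1)]]) (use fU in blast)
  have cont: "continuous_on N0 (\<lambda>y. \<Phi> y h)" for h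
    unfolding \<Phi>_def
    by (rule M.fun_smooth_continuous[OF N0(1) M.fun_smooth_add[OF N0(1) z M.fun_smooth_apply[OF N0(1) M_lin MM z]]])
  have lin: "linear (\<Phi> y)" if "y \<in> N0" for y
    by (rule linearI)
      (simp_all add: \<Phi>_def linear_add[OF z_lin[OF that]] linear_add[OF M_lin[OF that]]
        linear_scale[OF z_lin[OF that]] linear_scale[OF M_lin[OF that]] scaleR_add_right)
  have \<Phi>0: "J 2 (f y) (df y (coord_field B c (snd h) y)) = df y (- coord_field B c (fst h) y)"
    if y: "y \<in> N0" and 0: "\<Phi> y h = 0" for y h
  proof -
    note tl = N.tderiv_linear[OF dc fU(2)[OF y]]
    have "\<Phi> y h = tderiv A (snd d) (f y) (df y (coord_field B c (fst h) y) + J 2 (f y) (df y (coord_field B c (snd h) y)))"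
      using N.coord_field_tderiv[OF dc fU(2)[OF y]] by (simp add: \<Phi>_def linear_add[OF tl])
    then have "df y (coord_field B c (fst h) y) + J 2 (f y) (df y (coord_field B c (snd h) y)) = 0"
      using 0 N.tderiv_inject[OF dc fU(2)[OF y], of _ 0] linear_0[OF tl] by simp
    then show ?thesis
      by (simp add: linear_neg[OF differential_linear] add.commute eq_neg_iff_add_eq_0)
  qed
  have E': "subspace E" "dim E > 2" "\<And>w v. w \<in> E \<Longrightarrow> J 2 (f x) (df x w) = df x v \<Longrightarrow> w = 0"
    using E unfolding transversal_def by blast+
  define E0 where "E0 = tderiv B (snd c) x ` E"
  note tlx = M.tderiv_linear[OF cc c(2)]
  have E0: "subspace E0" unfolding E0_def by (rule linear_subspace_image[OF tlx E'(1)])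
  have dE0: "dim E0 = dim E"
    unfolding E0_def
    by (rule dim_image_eq[OF tlx]) (rule inj_on_subset[OF bij_is_inj[OF M.tderiv_bij[OF cc c(2)]] subset_UNIV])
  have H: "subspace (UNIV \<times> E0 :: ('f \<times> 'f) set)"
    by (rule subspace_Times[OF subspace_UNIV E0])
  have cf0: "coord_field B c w y = 0 \<longleftrightarrow> w = 0" if "y \<in> fst c" for w y
    using M.tderiv_coord_field[OF cc that, of w] linear_0[OF M.tderiv_linear[OF cc that]]
      linear_0[OF M.coord_field_linear[OF cc that]] by auto
  have inj: "h = 0" if h: "h \<in> UNIV \<times> E0" and 0: "\<Phi> x h = 0" for h
  proof -
    obtain w where w: "w \<in> E" "snd h = tderiv B (snd c) x w" using h unfolding E0_def by auto
    have "coord_field B c (snd h) x = w" unfolding w(2) by (rule M.coord_field_tderiv[OF cc c(2)])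
    then have "coord_field B c (snd h) x = 0"
      using E'(3)[OF w(1)] \<Phi>0[OF N0(2) 0] by simp
    moreover from this have "df x (- coord_field B c (fst h) x) = 0"
      using \<Phi>0[OF N0(2) 0] by (simp add: linear_0[OF differential_linear])
    ultimately show "h = 0"
      using cf0[OF c(2)] by (simp add: prod_eq_iff)
  qed
  obtain N' where N': "open N'" "x \<in> N'" "N' \<subseteq> N0" "\<And>y h. y \<in> N' \<Longrightarrow> h \<in> UNIV \<times> E0 \<Longrightarrow> \<Phi> y h = 0 \<Longrightarrow> h = 0"
    by (rule injective_family_open[OF N0(1,2) lin cont H inj]) (assumption | rule that)+
  show thesis
  proof (rule that[OF N'(1,2)])
    show "N' \<subseteq> V" using N'(3) N0(3) by blast
    fix y assume y: "y \<in> N'"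
    have yN: "y \<in> N0" using y N'(3) by blast
    note yc = fU(3)[OF yN]
    note cl = M.coord_field_linear[OF cc yc]
    have "transversal J y ((\<lambda>w. coord_field B c w y) ` E0)"
      unfolding transversal_def
    proof (intro conjI ballI allI impI)
      show "subspace ((\<lambda>w. coord_field B c w y) ` E0)" by (rule linear_subspace_image[OF cl E0])
      have "inj (\<lambda>w. coord_field B c w y)"
        by (rule inj_on_inverseI[of _ "tderiv B (snd c) y"]) (rule M.tderiv_coord_field[OF cc yc])
      then have "dim ((\<lambda>w. coord_field B c w y) ` E0) = dim E0"
        by (intro dim_image_eq[OF cl]) (rule inj_on_subset[OF _ subset_UNIV])
      then show "2 < dim ((\<lambda>w. coord_field B c w y) ` E0)" using dE0 E'(2) by simp
      fix w' v assume "w' \<in> (\<lambda>w. coord_field B c w y) ` E0" and eq: "J 2 (f y) (df y w') = df y v"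
      then obtain w where w: "w \<in> E0" "w' = coord_field B c w y" by blast
      let ?h = "(- tderiv B (snd c) y v, w)"
      have "\<Phi> y ?h = - tderiv A (snd d) (f y) (df y v) + tderiv A (snd d) (f y) (J 2 (f y) (df y w'))"
        using N.coord_field_tderiv[OF dc fU(2)[OF yN]] w(2) M.coord_field_tderiv[OF cc yc]
        by (simp add: \<Phi>_def linear_neg[OF cl] linear_neg[OF differential_linear] linear_neg[OF N.tderiv_linear[OF dc fU(2)[OF yN]]])
      then have "\<Phi> y ?h = 0" using eq by simp
      then have "?h = 0" by (intro N'(4)[OF y]) (use w in auto)
      then show "w' = 0" using w(2) cf0[OF yc] by (simp add: prod_eq_iff)
    qed
    then show "\<exists>E'. transversal J y E'" by blast
  qed
qed

text \<open>Coordinate fields have constant components, so only derivatives of the components of the structure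
  remain; the result is analytic where those components are.\<close>

lemma nijenhuis_in_chart:
  assumes c: "compatible_chart B c" and u: "u \<in> snd c ` fst c"
  defines "Jc \<equiv> \<lambda>w. tangent_comp B c (\<lambda>x. jM x (coord_field B c w x))"
  shows "smooth_on (snd c ` fst c) (Jc w)" "linear (\<lambda>w. Jc w u)"
    and "tangent_comp B c (nij (coord_field B c a) (coord_field B c b)) u =
      frechet_derivative (Jc b) (at u) (Jc a u) - frechet_derivative (Jc a) (at u) (Jc b u)
      + Jc (frechet_derivative (Jc a) (at u) b) u - Jc (frechet_derivative (Jc b) (at u) a) u"
proof -
  note ch = is_chartD[OF M.is_chart[OF c]]
  obtain x where x: "x \<in> fst c" "u = snd c x" using u by blast
  have inv: "chart_inv c u = x" using ch(3) x by simp
  note cf = M.coord_field_smooth[OF c]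
  note jcf = jM_smooth[OF ch(1) cf]
  show "smooth_on (snd c ` fst c) (Jc w)" for w
    using M.vfield_smooth_in_chart[OF jcf ch(1) c] by (simp add: Jc_def)
  have Jc: "tderiv B (snd c) x (jM x z) = Jc (tderiv B (snd c) x z) u" for z
    using M.coord_field_tderiv[OF c x(1)] by (simp add: Jc_def tangent_comp_def inv)
  show lin: "linear (\<lambda>w. Jc w u)"
    using linear_compose[OF linear_compose[OF M.coord_field_linear[OF c x(1)] jM_linear] M.tderiv_linear[OF c x(1)]]
    by (simp add: Jc_def tangent_comp_def inv o_def)
  have cv: "tangent_comp B c (coord_field B c w) u' = w" if "u' \<in> snd c ` fst c" for w u'
    using that ch(3) M.tderiv_coord_field[OF c] by (auto simp: tangent_comp_def)
  have cd: "frechet_derivative (tangent_comp B c (coord_field B c w)) (at u) v = 0" for w v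
  proof -
    have "(tangent_comp B c (coord_field B c w) has_derivative (\<lambda>v. 0)) (at u)"
      by (rule has_derivative_transform_within_open[OF has_derivative_const[of w] ch(2) u]) (rule cv[symmetric])
    from fun_cong[OF frechet_derivative_at[OF this], of v] show ?thesis by simp
  qed
  note br = M.lie_bracket_in_chart[OF c x(1) x(1) ch(1), folded x(2)]
  have b1: "tderiv B (snd c) x (lie_bracket B (\<lambda>y. jM y (coord_field B c a y)) (\<lambda>y. jM y (coord_field B c b y)) x) =
      frechet_derivative (Jc b) (at u) (Jc a u) - frechet_derivative (Jc a) (at u) (Jc b u)"
    unfolding br[OF jcf jcf] Jc_def ..
  have b2: "tderiv B (snd c) x (lie_bracket B (\<lambda>y. jM y (coord_field B c a y)) (coord_field B c b) x) =
      - frechet_derivative (Jc a) (at u) b"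
    unfolding br[OF jcf cf] cd cv[OF u] Jc_def by simp
  have b3: "tderiv B (snd c) x (lie_bracket B (coord_field B c a) (\<lambda>y. jM y (coord_field B c b y)) x) =
      frechet_derivative (Jc b) (at u) a"
    unfolding br[OF cf jcf] cd cv[OF u] Jc_def by simp
  have b4: "tderiv B (snd c) x (lie_bracket B (coord_field B c a) (coord_field B c b) x) = 0"
    unfolding br[OF cf cf] cd by simp
  note tl = M.tderiv_linear[OF c x(1)]
  show "tangent_comp B c (nij (coord_field B c a) (coord_field B c b)) u =
      frechet_derivative (Jc b) (at u) (Jc a u) - frechet_derivative (Jc a) (at u) (Jc b u)
      + Jc (frechet_derivative (Jc a) (at u) b) u - Jc (frechet_derivative (Jc b) (at u) a) u"
    unfolding tangent_comp_def[of B c "nij (coord_field B c a) (coord_field B c b)"] inv nijenhuis_def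
      linear_add[OF tl] linear_diff[OF tl] linear_scale[OF tl] Jc b1 b2 b3 b4
    by (simp add: linear_neg[OF lin])
qed

text \<open>In a chart around a boundary point of the set where the Nijenhuis tensor vanishes, every nearby point
  is the end of a segment that starts inside the set.  The components of the tensor along the segment
  extend to the disc and vanish near the start, hence also at the end.\<close>

lemma nij_zero_propagates:
  assumes C: "atlas real_analytic_on C" "atlas smooth_on (B \<union> C)"
    and an: "\<And>c w. c \<in> C \<Longrightarrow> real_analytic_on (snd c ` fst c)
      ((\<lambda>x. tderiv B (snd c) x (jM x (coord_field B c w x))) \<circ> chart_inv c)"
    and x0: "x0 \<in> closure (interior {x. nij_zero x})"
  shows "x0 \<in> interior {x. nij_zero x}"
proof -
  let ?I = "interior {x. nij_zero x}"
  obtain c where c: "c \<in> C" "x0 \<in> fst c" using C(1) unfolding atlas_def by blast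
  have cc: "compatible_chart B c" by (rule atlas_compatible[OF C(2)]) (use c in auto)
  note ch = is_chartD[OF M.is_chart[OF cc]]
  let ?S = "snd c ` fst c" and ?u0 = "snd c x0"
  define Jc where "Jc w = tangent_comp B c (\<lambda>x. jM x (coord_field B c w x))" for w
  note chart = nijenhuis_in_chart[OF cc, folded Jc_def]
  let ?D = "\<lambda>w u. frechet_derivative (Jc w) (at u)"
  have u0: "?u0 \<in> ?S" using c by blast
  have D: "(Jc w has_derivative ?D w u) (at u)" if "u \<in> ?S" for w u
    by (rule smooth_on_has_derivative[OF chart(1)[OF u0] that])
  obtain R where R: "R > 0" "ball ?u0 R \<subseteq> ?S" using ch(2) u0 open_contains_ball by blast
  have ana: "real_analytic_on ?S (Jc w)" for w
    using an[OF c(1), of w] by (simp add: Jc_def tangent_comp_def[abs_def] o_def)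
  have "\<exists>\<delta>>0. \<forall>p\<in>ball ?u0 \<delta>. \<forall>u\<in>ball ?u0 \<delta>. \<forall>k. extends_to_disc (\<lambda>t. Jc w (p + t *\<^sub>R (u - p)) \<bullet> k) \<and>
    (\<forall>D d. (\<forall>t. \<bar>t\<bar> < 2 \<longrightarrow> (Jc w has_derivative D t) (at (p + t *\<^sub>R (u - p)))) \<longrightarrow> extends_to_disc (\<lambda>t. D t d \<bullet> k))" for w
    by (rule real_analytic_extends_to_disc[OF ana u0])
  then obtain \<delta>' where \<delta>': "\<And>w. \<delta>' w > 0" "\<And>w p u k. p \<in> ball ?u0 (\<delta>' w) \<Longrightarrow> u \<in> ball ?u0 (\<delta>' w) \<Longrightarrow>
      extends_to_disc (\<lambda>t. Jc w (p + t *\<^sub>R (u - p)) \<bullet> k)"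
    "\<And>w p u k D d. p \<in> ball ?u0 (\<delta>' w) \<Longrightarrow> u \<in> ball ?u0 (\<delta>' w) \<Longrightarrow>
      (\<And>t. \<bar>t\<bar> < 2 \<Longrightarrow> (Jc w has_derivative D t) (at (p + t *\<^sub>R (u - p)))) \<Longrightarrow> extends_to_disc (\<lambda>t. D t d \<bullet> k)"
    by metis
  \<comment> \<open>points with parameter at most 2 on a line through two points of the ball of radius \<open>\<delta>\<close> have distance less
    than \<open>5 \<delta>\<close> from its centre\<close>
  define \<delta> where "\<delta> = min (R / 5) (Min (\<delta>' ` Basis))"
  have \<delta>: "\<delta> > 0" "\<delta> \<le> R / 5" "\<And>w. w \<in> Basis \<Longrightarrow> \<delta> \<le> \<delta>' w"
    using R(1) \<delta>'(1) by (auto simp: \<delta>_def intro: min.coboundedI2)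
  let ?B = "ball ?u0 \<delta>"
  have BS: "?B \<subseteq> ?S" using R \<delta> by (auto simp: subset_iff)
  have zero: "nij_zero (chart_inv c u)" if p: "p \<in> ?B" "chart_inv c p \<in> ?I" and u: "u \<in> ?B" for p u
  proof (rule nij_zeroI[OF cc])
    have uS: "u \<in> ?S" using u BS by blast
    show xc: "chart_inv c u \<in> fst c" by (rule ch(5)[OF uS])
    let ?P = "\<lambda>t. p + t *\<^sub>R (u - p)"
    have PS: "?P t \<in> ?S" if "\<bar>t\<bar> < 2" for t
    proof -
      have "norm (u - p) \<le> dist ?u0 u + dist ?u0 p"
        using dist_triangle2[of u p ?u0] by (simp add: dist_norm norm_minus_commute)
      then have up: "norm (u - p) \<le> 2 * \<delta>" using p(1) u by simp
      have "norm (p - ?u0 + t *\<^sub>R (u - p)) \<le> norm (p - ?u0) + \<bar>t\<bar> * norm (u - p)"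
        using norm_triangle_ineq[of "p - ?u0" "t *\<^sub>R (u - p)"] by simp
      also have "\<dots> < \<delta> + 2 * (2 * \<delta>)"
        using p(1) up that by (intro add_less_le_mono mult_mono) (auto simp: dist_norm norm_minus_commute)
      also have "\<dots> \<le> R" using \<delta>(2) by simp
      finally have "?P t \<in> ball ?u0 R" by (simp add: dist_norm norm_minus_commute algebra_simps)
      then show ?thesis using R(2) by blast
    qed
    have E1: "extends_to_disc (\<lambda>t. Jc w (?P t) \<bullet> k)" if "w \<in> Basis" for w k
      by (rule \<delta>'(2)) (use p(1) u \<delta>(3)[OF that] in auto)
    have E2: "extends_to_disc (\<lambda>t. ?D w (?P t) d \<bullet> k)" if "w \<in> Basis" for w d k
      by (rule \<delta>'(3)[of p w u]) (use p(1) u \<delta>(3)[OF that] D[OF PS] in auto)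
    have const: "extends_to_disc (\<lambda>t. r)" for r
      unfolding extends_to_disc_def by (intro exI[of _ "\<lambda>z. of_real r"]) simp
    have Jsum: "Jc w y = (\<Sum>i\<in>Basis. (w \<bullet> i) *\<^sub>R Jc i y)" if "y \<in> ?S" for w y
      by (rule linear_eq_sum_Basis[OF chart(2)[OF that]])
    have Dsum: "?D w y d = (\<Sum>i\<in>Basis. (w \<bullet> i) *\<^sub>R ?D i y d)" if y: "y \<in> ?S" for w y d
    proof -
      have "((\<lambda>y. \<Sum>i\<in>Basis. (w \<bullet> i) *\<^sub>R Jc i y) has_derivative (\<lambda>d. \<Sum>i\<in>Basis. (w \<bullet> i) *\<^sub>R ?D i y d)) (at y)"
        by (intro has_derivative_sum has_derivative_scaleR_right D y)
      then have "(Jc w has_derivative (\<lambda>d. \<Sum>i\<in>Basis. (w \<bullet> i) *\<^sub>R ?D i y d)) (at y)"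
        by (rule has_derivative_transform_within_open[OF _ ch(2) y]) (rule Jsum[symmetric])
      from fun_cong[OF has_derivative_unique[OF D[OF y] this]] show ?thesis .
    qed
    have E1': "extends_to_disc (\<lambda>t. Jc w (?P t) \<bullet> k)" for w k
    proof (rule extends_to_disc_cong)
      show "extends_to_disc (\<lambda>t. \<Sum>i\<in>Basis. (w \<bullet> i) * (Jc i (?P t) \<bullet> k))"
        by (intro extends_to_disc_sum extends_to_disc_mult const E1) auto
      show "(\<Sum>i\<in>Basis. (w \<bullet> i) * (Jc i (?P t) \<bullet> k)) = Jc w (?P t) \<bullet> k" if "\<bar>t\<bar> < 2" for t
        unfolding Jsum[OF PS[OF that], of w] by (simp add: inner_sum_left)
    qed
    have E2': "extends_to_disc (\<lambda>t. ?D w (?P t) d \<bullet> k)" for w d k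
    proof (rule extends_to_disc_cong)
      show "extends_to_disc (\<lambda>t. \<Sum>i\<in>Basis. (w \<bullet> i) * (?D i (?P t) d \<bullet> k))"
        by (intro extends_to_disc_sum extends_to_disc_mult const E2) auto
      show "(\<Sum>i\<in>Basis. (w \<bullet> i) * (?D i (?P t) d \<bullet> k)) = ?D w (?P t) d \<bullet> k" if "\<bar>t\<bar> < 2" for t
        unfolding Dsum[OF PS[OF that], of w] by (simp add: inner_sum_left)
    qed
    fix a b
    let ?N = "tangent_comp B c (nij (coord_field B c a) (coord_field B c b))"
    have ext: "extends_to_disc (\<lambda>t. ?N (?P t) \<bullet> k)" for k
    proof (rule extends_to_disc_cong)
      let ?q = "\<lambda>a b t. \<Sum>i\<in>Basis. (Jc a (?P t) \<bullet> i) * (?D b (?P t) i \<bullet> k)"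
      let ?r = "\<lambda>a b t. \<Sum>i\<in>Basis. (?D a (?P t) b \<bullet> i) * (Jc i (?P t) \<bullet> k)"
      show "extends_to_disc (\<lambda>t. ?q a b t - ?q b a t + ?r a b t - ?r b a t)"
        by (intro extends_to_disc_diff extends_to_disc_add extends_to_disc_sum extends_to_disc_mult E1' E2') auto
      fix t :: real assume t: "\<bar>t\<bar> < 2"
      note P = PS[OF t]
      have q: "?D b (?P t) (Jc a (?P t)) \<bullet> k = ?q a b t" for a b
        using arg_cong[OF linear_eq_sum_Basis[OF has_derivative_linear[OF D[OF P, of b]], of "Jc a (?P t)"], of "\<lambda>v. v \<bullet> k"]
        by (simp add: inner_sum_left)
      have r: "Jc (?D a (?P t) b) (?P t) \<bullet> k = ?r a b t" for a b
        using arg_cong[OF Jsum[OF P, of "?D a (?P t) b"], of "\<lambda>v. v \<bullet> k"] by (simp add: inner_sum_left)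
      show "?q a b t - ?q b a t + ?r a b t - ?r b a t = ?N (?P t) \<bullet> k"
        unfolding chart(3)[OF P] inner_add_left inner_diff_left q r ..
    qed
    have "?N u = 0"
    proof (rule euclidean_eqI)
      fix k :: 'f
      have pS: "p \<in> ?S" using p(1) BS by blast
      have "continuous_on UNIV ?P" by (intro continuous_intros)
      let ?O = "?P -` (snd c ` (fst c \<inter> ?I))"
      have "open (snd c ` (fst c \<inter> ?I))" by (rule chart_image_open[OF M.is_chart[OF cc] open_interior])
      then have "open ?O" using \<open>continuous_on UNIV ?P\<close> open_vimage by blast
      moreover have "0 \<in> ?O"
      proof -
        have "p = snd c (chart_inv c p)" using ch(4)[OF pS] by simp
        then show ?thesis using p(2) ch(5)[OF pS] by (auto intro!: image_eqI[of p])
      qed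
      ultimately obtain e where e: "e > 0" "ball 0 e \<subseteq> ?O" using open_contains_ball by blast
      have "?N (?P 1) \<bullet> k = 0"
      proof (rule extends_to_disc_identity[OF ext e(1)])
        fix t :: real assume "\<bar>t\<bar> < e"
        then have "t \<in> ?O" using e(2) by (auto simp: subset_iff)
        then obtain y where y: "y \<in> fst c" "y \<in> ?I" "?P t = snd c y" by auto
        have "nij_zero y" using y(2) interior_subset by blast
        then have "nij (coord_field B c a) (coord_field B c b) y = 0"
          unfolding nij_zero_def using ch(1) y(1) M.coord_field_smooth[OF cc] by blast
        then show "?N (?P t) \<bullet> k = 0"
          unfolding y(3) using ch(3)[OF y(1)] linear_0[OF M.tderiv_linear[OF cc y(1)]] by (simp add: tangent_comp_def)
      qed
      then show "?N u \<bullet> k = 0 \<bullet> k" by simp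
    qed
    then show "nij (coord_field B c a) (coord_field B c b) (chart_inv c u) = 0"
      using M.tderiv_inject[OF cc xc, of _ 0] linear_0[OF M.tderiv_linear[OF cc xc]] by (simp add: tangent_comp_def)
  qed
  let ?N0 = "{x \<in> fst c. snd c x \<in> ?B}"
  have N0: "open ?N0" "x0 \<in> ?N0" using chart_vimage_open[OF M.is_chart[OF cc] open_ball] c \<delta>(1) by auto
  obtain y where y: "y \<in> ?N0" "y \<in> ?I"
    using x0 N0 open_Int_closure_eq_empty[OF N0(1), of ?I] by blast
  have "nij_zero x" if "x \<in> ?N0" for x
    using zero[of "snd c y" "snd c x"] that y ch(3) by simp
  then show ?thesis using interior_maximal[OF _ N0(1), of "{x. nij_zero x}"] N0(2) by blast
qed

end

theorem theorem3p4:
  fixes A :: "('a::{second_countable_topology, t2_space}, 'e::euclidean_space) chart set"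
    and g :: "'a \<Rightarrow> 'e \<Rightarrow> 'e \<Rightarrow> real"
    and nabla :: "('a, 'e) connection"
    and Q :: "'a \<Rightarrow> ('e \<Rightarrow>\<^sub>L 'e) set"
    and B :: "('b::{second_countable_topology, t2_space}, 'f::euclidean_space) chart set"
    and f :: "'b \<Rightarrow> 'a"
    and Je :: "'b \<Rightarrow> 'e \<Rightarrow>\<^sub>L 'e"
    and \<epsilon> :: real
    and n m :: nat
  assumes "para_quaternionic_kaehler n A g nabla Q"
    and "\<forall>p. reduced_scalar_curvature n A g nabla p \<noteq> 0"
    and "\<epsilon> \<in> {-1, 1}"
    and "almost_eps_hermitian_submanifold A g Q \<epsilon> B f Je"
    and "DIM('f) = 2 * m" and "m > 1"
  shows
    "(integrable_structure B \<epsilon> (induced_structure A B f Je) \<longleftrightarrow>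
       (\<forall>V U J \<omega>. adapted_basis A Q \<epsilon> f Je V U J \<and> connection_forms A nabla U (adapted_signs \<epsilon>) J \<omega> \<longrightarrow>
          (\<forall>x\<in>V. \<forall>v. psi A B f Je \<omega> x v = 0)))
     \<and>
     (integrable_structure B \<epsilon> (induced_structure A B f Je) \<longleftrightarrow>
       (\<forall>x0. \<exists>V U J \<omega>. x0 \<in> V \<and>
          adapted_basis A Q \<epsilon> f Je V U J \<and> connection_forms A nabla U (adapted_signs \<epsilon>) J \<omega> \<and>
          (\<forall>x\<in>V. \<forall>v. psi A B f Je \<omega> x v = 0)))
     \<and>
     (\<forall>D. (\<forall>x. pure_complement (Q (f x)) (Je x) (range (differential B A f x)) (D x)) \<longrightarrow>
        ((\<exists>U. open U \<and> closure U = UNIV \<and> (\<forall>x\<in>U. dim (D x) > 2)) \<or>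
         (connected (UNIV :: 'b set) \<and> analytic_structure B (induced_structure A B f Je) \<and>
          (\<exists>x. dim (D x) > 2))
         \<longrightarrow> integrable_structure B \<epsilon> (induced_structure A B f Je)))"
proof -
  interpret eps_hermitian B A f nabla g Q \<epsilon> Je n
  proof unfold_locales
    show "atlas smooth_on B" "smooth_map B A f"
      using assms(4) unfolding almost_eps_hermitian_submanifold_def submanifold_def by blast+
    show "atlas smooth_on A" "affine_connection A nabla"
      using assms(1) unfolding para_quaternionic_kaehler_def levi_civita_def by blast+
  qed (fact assms)+
  have dim: "DIM('f) > 2" using assms(5,6) by simp
  have forward: "psi A B f Je \<omega> x v = 0"
    if int: "integrable_structure B \<epsilon> jM" and ab: "adapted_basis A Q \<epsilon> f Je V U J"
      and \<omega>: "connection_forms A nabla U (adapted_signs \<epsilon>) J \<omega>" and x: "x \<in> V" for V U J \<omega> x v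
    using covector_of_nij_zero[OF ab \<omega> x _ dim] int integrable_iff psi_eq_covector by simp
  have backward: "integrable_structure B \<epsilon> jM"
    if ex: "\<And>x0. \<exists>V U J \<omega>. x0 \<in> V \<and> adapted_basis A Q \<epsilon> f Je V U J \<and>
        connection_forms A nabla U (adapted_signs \<epsilon>) J \<omega> \<and> (\<forall>x\<in>V. \<forall>v. psi A B f Je \<omega> x v = 0)"
    unfolding integrable_iff
  proof
    fix x0
    obtain V U J \<omega> where x0: "x0 \<in> V" and ab: "adapted_basis A Q \<epsilon> f Je V U J"
      and \<omega>: "connection_forms A nabla U (adapted_signs \<epsilon>) J \<omega>" and psi: "\<forall>x\<in>V. \<forall>v. psi A B f Je \<omega> x v = 0"
      using ex[of x0] by blast
    show "nij_zero x0"
      by (rule nij_zero_of_covector[OF ab \<omega> x0]) (use psi x0 psi_eq_covector in simp)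
  qed
  have 1: "integrable_structure B \<epsilon> jM \<longleftrightarrow>
       (\<forall>V U J \<omega>. adapted_basis A Q \<epsilon> f Je V U J \<and> connection_forms A nabla U (adapted_signs \<epsilon>) J \<omega> \<longrightarrow>
          (\<forall>x\<in>V. \<forall>v. psi A B f Je \<omega> x v = 0))" (is "_ \<longleftrightarrow> ?all")
  proof
    show "integrable_structure B \<epsilon> jM \<Longrightarrow> ?all" using forward by blast
    assume all: ?all
    show "integrable_structure B \<epsilon> jM"
    proof (rule backward)
      fix x0
      obtain V U J \<omega> where "x0 \<in> V" "adapted_basis A Q \<epsilon> f Je V U J" "connection_forms A nabla U (adapted_signs \<epsilon>) J \<omega>"
        by (rule adapted_basis_at)
      then show "\<exists>V U J \<omega>. x0 \<in> V \<and> adapted_basis A Q \<epsilon> f Je V U J \<and>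
          connection_forms A nabla U (adapted_signs \<epsilon>) J \<omega> \<and> (\<forall>x\<in>V. \<forall>v. psi A B f Je \<omega> x v = 0)"
        using all by blast
    qed
  qed
  have 2: "integrable_structure B \<epsilon> jM \<longleftrightarrow>
       (\<forall>x0. \<exists>V U J \<omega>. x0 \<in> V \<and>
          adapted_basis A Q \<epsilon> f Je V U J \<and> connection_forms A nabla U (adapted_signs \<epsilon>) J \<omega> \<and>
          (\<forall>x\<in>V. \<forall>v. psi A B f Je \<omega> x v = 0))" (is "_ \<longleftrightarrow> ?ex")
  proof
    assume int: "integrable_structure B \<epsilon> jM"
    show ?ex
    proof
      fix x0
      obtain V U J \<omega> where "x0 \<in> V" "adapted_basis A Q \<epsilon> f Je V U J" "connection_forms A nabla U (adapted_signs \<epsilon>) J \<omega>"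
        by (rule adapted_basis_at)
      then show "\<exists>V U J \<omega>. x0 \<in> V \<and> adapted_basis A Q \<epsilon> f Je V U J \<and>
          connection_forms A nabla U (adapted_signs \<epsilon>) J \<omega> \<and> (\<forall>x\<in>V. \<forall>v. psi A B f Je \<omega> x v = 0)"
        using forward[OF int] by blast
    qed
  qed (rule backward, blast)
  have 3: "integrable_structure B \<epsilon> jM"
    if D: "\<And>x. pure_complement (Q (f x)) (Je x) (range (df x)) (D x)"
      and cases: "(\<exists>U. open U \<and> closure U = UNIV \<and> (\<forall>x\<in>U. dim (D x) > 2)) \<or>
         (connected (UNIV :: 'b set) \<and> analytic_structure B jM \<and> (\<exists>x. dim (D x) > 2))" for D
  proof -
    have local: "\<exists>N'. open N' \<and> x \<in> N' \<and> (\<forall>y\<in>N'. nij_zero y)" if big: "dim (D x) > 2" for x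
    proof -
      obtain V U J \<omega> where x: "x \<in> V" and ab: "adapted_basis A Q \<epsilon> f Je V U J"
        by (rule adapted_basis_at)
      obtain N' where "open N'" "x \<in> N'" "N' \<subseteq> V" "\<And>y. y \<in> N' \<Longrightarrow> \<exists>E'. transversal J y E'"
        by (rule transversal_open[OF ab x transversal_of_pure_complement[OF ab x D big]]) (rule that, assumption+)
      then show ?thesis using nij_zero_of_transversal[OF ab] by blast
    qed
    show ?thesis
      unfolding integrable_iff
    proof
      fix x
      from cases show "nij_zero x"
      proof
        assume "\<exists>U. open U \<and> closure U = UNIV \<and> (\<forall>x\<in>U. dim (D x) > 2)"
        then obtain U where "closure U = UNIV" "\<forall>x\<in>U. dim (D x) > 2" by blast
        then show ?thesis using nij_zero_of_dense[of U] local by blast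
      next
        assume an: "connected (UNIV :: 'b set) \<and> analytic_structure B jM \<and> (\<exists>x. dim (D x) > 2)"
        let ?I = "interior {x. nij_zero x}"
        obtain C where C: "atlas real_analytic_on C" "atlas smooth_on (B \<union> C)"
          "\<And>c w. c \<in> C \<Longrightarrow> real_analytic_on (snd c ` fst c)
             ((\<lambda>x. tderiv B (snd c) x (jM x (coord_field B c w x))) \<circ> chart_inv c)"
          using an unfolding analytic_structure_def by blast
        have "closure ?I \<subseteq> ?I" using nij_zero_propagates[OF C] by blast
        then have "closed ?I" by (rule closure_subset_eq[THEN iffD1])
        obtain x1 where "dim (D x1) > 2" using an by blast
        then obtain N' where "open N'" "x1 \<in> N'" "\<forall>y\<in>N'. nij_zero y" using local by blast
        then have "x1 \<in> ?I" using interior_maximal[of N' "{x. nij_zero x}"] by blast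
        then have "?I = UNIV"
          using connectedD[of UNIV ?I "- ?I"] an \<open>closed ?I\<close> by auto
        then show ?thesis using interior_subset by blast
      qed
    qed
  qed
  show ?thesis using 1 2 3 by blast
qed

end
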